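(* Let $K$ be an algebraically closed field of characteristic zero, $n \ge 2$ an integer, $P_n = K[x_1,\ldots,x_n]$, and let $W_n = W_n(K)$ be the Lie algebra of all $K$-derivations of $P_n$. For each integer $s$ with $1 \le s \le n-1$ put $P_s = K[x_1,\ldots,x_s] \subseteq P_n$ and \[ m_s(K)=\left\{\sum_{i=1}^s f_i\frac{\partial}{\partial x_i}+\sum_{j=s+1}^n g_j\frac{\partial}{\partial x_j}\ \middle|\ f_i\in P_s,\ g_j\in P_n\right\},\qquad I_s=\left\{\sum_{j=s+1}^n g_j\frac{\partial}{\partial x_j}\ \middle|\ g_j\in P_n\right\}. \] Then: (1) For every integer $s$ with $1\le s\le n-1$, the set $m_s(K)$ is a maximal subalgebra of the Lie algebra $W_n$. (2) For every such $s$, $I_s$ is a polynomial ideal of the Lie algebra $m_s(K)$, there is an isomorphism of Lie algebras $I_s\simeq P_s\otimes_K \mathrm{Der}_K(K[x_{s+1},\ldots,x_n])$, and the quotient Lie algebra $m_s(K)/I_s$ is isomorphic to the Lie algebra $W_s(K)$. (3) For every such $s$, $I_s$ is the unique non-trivial ideal of the Lie algebra $m_s(K)$. (4) For $s,t\in\{1,\ldots,n-1\}$ with $s\neq t$, the Lie algebras $m_s(K)$ and $m_t(K)$ are not isomorphic.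
   Context: Every element of $W_n(K)=\mathrm{Der}_K(P_n)$ is uniquely of the form $\sum_{i=1}^n f_i \frac{\partial}{\partial x_i}$ with $f_i\in P_n$; the bracket is the commutator of derivations, and $W_n(K)$ is a Lie algebra over $K$ and also a free $P_n$-module of rank $n$. Subalgebras, ideals and isomorphisms are those of Lie algebras over $K$. $W_s(K)$ denotes the Lie algebra of all $K$-derivations of $P_s=K[x_1,\ldots,x_s]$. A subalgebra (in particular, an ideal of a subalgebra) of $W_n(K)$ is called polynomial if it is a $P_n$-submodule of $W_n(K)$. A maximal subalgebra is a proper subalgebra not properly contained in any other proper subalgebra. The Lie bracket on $P_s\otimes_K \mathrm{Der}_K(K[x_{s+1},\ldots,x_n])$ is $[a\otimes D, b\otimes D'] = ab\otimes [D,D']$. A non-trivial ideal of a Lie algebra is an ideal different from zero and from the whole Lie algebra. *)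

theory Defs
  imports
    "HOL-Library.Poly_Mapping"
    "HOL-Algebra.Congruence"
    "HOL-Computational_Algebra.Polynomial"
begin

section \<open>Lie algebras over a field\<close>

record ('k, 'v) bracket_alg = "'v partial_object" +
  lzero :: 'v
  ladd :: "'v \<Rightarrow> 'v \<Rightarrow> 'v"
  lscale :: "'k \<Rightarrow> 'v \<Rightarrow> 'v"
  lbracket :: "'v \<Rightarrow> 'v \<Rightarrow> 'v"

text \<open>A vector space with a bilinear bracket; the Lie axioms are added afterwards because the
  free vector space used below to construct the tensor product does not satisfy them.\<close>

locale bracket_algebra =
  fixes L :: "('k::field, 'v, 'm) bracket_alg_scheme"
  assumes zero_closed: "lzero L \<in> carrier L"
    and add_closed: "\<lbrakk>x \<in> carrier L; y \<in> carrier L\<rbrakk> \<Longrightarrow> ladd L x y \<in> carrier L"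
    and scale_closed: "x \<in> carrier L \<Longrightarrow> lscale L c x \<in> carrier L"
    and bracket_closed: "\<lbrakk>x \<in> carrier L; y \<in> carrier L\<rbrakk> \<Longrightarrow> lbracket L x y \<in> carrier L"
    and add_assoc: "\<lbrakk>x \<in> carrier L; y \<in> carrier L; z \<in> carrier L\<rbrakk> \<Longrightarrow>
      ladd L (ladd L x y) z = ladd L x (ladd L y z)"
    and add_commute: "\<lbrakk>x \<in> carrier L; y \<in> carrier L\<rbrakk> \<Longrightarrow> ladd L x y = ladd L y x"
    and add_zero: "x \<in> carrier L \<Longrightarrow> ladd L (lzero L) x = x"
    and add_inverse: "x \<in> carrier L \<Longrightarrow> \<exists>y\<in>carrier L. ladd L x y = lzero L"
    and scale_add: "\<lbrakk>x \<in> carrier L; y \<in> carrier L\<rbrakk> \<Longrightarrow>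
      lscale L c (ladd L x y) = ladd L (lscale L c x) (lscale L c y)"
    and add_scale: "x \<in> carrier L \<Longrightarrow> lscale L (c + d) x = ladd L (lscale L c x) (lscale L d x)"
    and scale_scale: "x \<in> carrier L \<Longrightarrow> lscale L c (lscale L d x) = lscale L (c * d) x"
    and scale_one: "x \<in> carrier L \<Longrightarrow> lscale L 1 x = x"
    and bracket_add_left: "\<lbrakk>x \<in> carrier L; y \<in> carrier L; z \<in> carrier L\<rbrakk> \<Longrightarrow>
      lbracket L (ladd L x y) z = ladd L (lbracket L x z) (lbracket L y z)"
    and bracket_add_right: "\<lbrakk>x \<in> carrier L; y \<in> carrier L; z \<in> carrier L\<rbrakk> \<Longrightarrow>
      lbracket L x (ladd L y z) = ladd L (lbracket L x y) (lbracket L x z)"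
    and bracket_scale_left: "\<lbrakk>x \<in> carrier L; y \<in> carrier L\<rbrakk> \<Longrightarrow>
      lbracket L (lscale L c x) y = lscale L c (lbracket L x y)"
    and bracket_scale_right: "\<lbrakk>x \<in> carrier L; y \<in> carrier L\<rbrakk> \<Longrightarrow>
      lbracket L x (lscale L c y) = lscale L c (lbracket L x y)"

locale lie_algebra = bracket_algebra +
  assumes bracket_self: "x \<in> carrier L \<Longrightarrow> lbracket L x x = lzero L"
    and jacobi: "\<lbrakk>x \<in> carrier L; y \<in> carrier L; z \<in> carrier L\<rbrakk> \<Longrightarrow>
      ladd L (lbracket L x (lbracket L y z))
        (ladd L (lbracket L y (lbracket L z x)) (lbracket L z (lbracket L x y))) = lzero L"

definition lie_subspace :: "'v set \<Rightarrow> ('k, 'v, 'm) bracket_alg_scheme \<Rightarrow> bool" where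
  "lie_subspace U L \<longleftrightarrow> U \<subseteq> carrier L \<and> lzero L \<in> U \<and>
    (\<forall>x\<in>U. \<forall>y\<in>U. ladd L x y \<in> U) \<and> (\<forall>c. \<forall>x\<in>U. lscale L c x \<in> U)"

definition lie_subalgebra :: "'v set \<Rightarrow> ('k, 'v, 'm) bracket_alg_scheme \<Rightarrow> bool" where
  "lie_subalgebra U L \<longleftrightarrow> lie_subspace U L \<and> (\<forall>x\<in>U. \<forall>y\<in>U. lbracket L x y \<in> U)"

text \<open>Two-sided, since quotients are also taken of spaces whose bracket is not antisymmetric; in a
  Lie algebra either half of the condition implies the other.\<close>

definition lie_ideal :: "'v set \<Rightarrow> ('k, 'v, 'm) bracket_alg_scheme \<Rightarrow> bool" where
  "lie_ideal U L \<longleftrightarrow> lie_subspace U L \<and>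
    (\<forall>x\<in>carrier L. \<forall>y\<in>U. lbracket L x y \<in> U \<and> lbracket L y x \<in> U)"

definition nontrivial_ideal :: "'v set \<Rightarrow> ('k, 'v, 'm) bracket_alg_scheme \<Rightarrow> bool" where
  "nontrivial_ideal U L \<longleftrightarrow> lie_ideal U L \<and> U \<noteq> {lzero L} \<and> U \<noteq> carrier L"

definition maximal_subalgebra :: "'v set \<Rightarrow> ('k, 'v, 'm) bracket_alg_scheme \<Rightarrow> bool" where
  "maximal_subalgebra M L \<longleftrightarrow> lie_subalgebra M L \<and> M \<noteq> carrier L \<and>
    (\<forall>N. lie_subalgebra N L \<and> N \<noteq> carrier L \<longrightarrow> \<not> M \<subset> N)"

definition lie_hom ::
  "('k, 'v, 'm) bracket_alg_scheme \<Rightarrow> ('k, 'w, 'n) bracket_alg_scheme \<Rightarrow> ('v \<Rightarrow> 'w) set" where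
  "lie_hom L M = {\<phi> \<in> carrier L \<rightarrow> carrier M.
    (\<forall>x\<in>carrier L. \<forall>y\<in>carrier L. \<phi> (ladd L x y) = ladd M (\<phi> x) (\<phi> y)) \<and>
    (\<forall>c. \<forall>x\<in>carrier L. \<phi> (lscale L c x) = lscale M c (\<phi> x)) \<and>
    (\<forall>x\<in>carrier L. \<forall>y\<in>carrier L. \<phi> (lbracket L x y) = lbracket M (\<phi> x) (\<phi> y))}"

definition lie_isomorphic ::
  "('k, 'v, 'm) bracket_alg_scheme \<Rightarrow> ('k, 'w, 'n) bracket_alg_scheme \<Rightarrow> bool"
  (infix \<open>\<cong>\<^sub>L\<close> 50) where
  "L \<cong>\<^sub>L M \<longleftrightarrow> (\<exists>\<phi> \<in> lie_hom L M. bij_betw \<phi> (carrier L) (carrier M))"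

definition sub_alg ::
  "('k, 'v, 'm) bracket_alg_scheme \<Rightarrow> 'v set \<Rightarrow> ('k, 'v, 'm) bracket_alg_scheme" where
  "sub_alg L U = L\<lparr>carrier := U\<rparr>"

lemma lie_algebra_sub_alg:
  assumes "lie_algebra L" "lie_subalgebra U L"
  shows "lie_algebra (sub_alg L U)"
proof -
  interpret lie_algebra L by fact
  have U: "x \<in> carrier L" if "x \<in> U" for x
    using that assms(2) by (auto simp: lie_subalgebra_def lie_subspace_def)
  have c: "lzero L \<in> U" "\<And>x y. x \<in> U \<Longrightarrow> y \<in> U \<Longrightarrow> ladd L x y \<in> U"
    "\<And>c x. x \<in> U \<Longrightarrow> lscale L c x \<in> U" "\<And>x y. x \<in> U \<Longrightarrow> y \<in> U \<Longrightarrow> lbracket L x y \<in> U"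
    using assms(2) by (auto simp: lie_subalgebra_def lie_subspace_def)
  have inv: "\<exists>y\<in>U. ladd L x y = lzero L" if "x \<in> U" for x
  proof -
    define y where "y = lscale L (-1) x"
    have y: "y \<in> U" unfolding y_def by (rule c(3)[OF that])
    have xc: "x \<in> carrier L" using U that by blast
    define z where "z = lscale L 0 x"
    have zc: "z \<in> carrier L" unfolding z_def by (rule scale_closed[OF xc])
    have zz: "ladd L z z = z" using add_scale[OF xc, of 0 0] by (simp add: z_def)
    obtain w where w: "w \<in> carrier L" "ladd L z w = lzero L" using add_inverse[OF zc] by blast
    have "z = ladd L (lzero L) z" using add_zero[OF zc] by simp
    also have "\<dots> = ladd L z (ladd L z w)"
      using w zc add_commute zero_closed by metis
    also have "\<dots> = lzero L" using add_assoc[OF zc zc w(1)] zz w by simp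
    finally have "ladd L x y = lzero L"
      using add_scale[OF xc, of 1 "-1"] scale_one[OF xc] by (simp add: z_def y_def)
    then show ?thesis using y by blast
  qed
  show ?thesis
    by unfold_locales
      (simp_all add: sub_alg_def c inv,
        (rule add_assoc add_commute add_zero scale_add add_scale scale_scale scale_one
          bracket_add_left bracket_add_right bracket_scale_left bracket_scale_right
          bracket_self jacobi; simp add: U)+)
qed

definition lie_coset :: "('k, 'v, 'm) bracket_alg_scheme \<Rightarrow> 'v set \<Rightarrow> 'v \<Rightarrow> 'v set" where
  "lie_coset L I x = (\<lambda>y. ladd L x y) ` I"

text \<open>As for \<open>rcoset_mult\<close> in HOL-Algebra, the operations on cosets are unions over all
  representatives; for an ideal these collapse to a single coset (see the lemmas below).\<close>

definition lie_quot ::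
  "('k, 'v, 'm) bracket_alg_scheme \<Rightarrow> 'v set \<Rightarrow> ('k, 'v set) bracket_alg" where
  "lie_quot L I = \<lparr>
    carrier = lie_coset L I ` carrier L,
    lzero = lie_coset L I (lzero L),
    ladd = (\<lambda>X Y. \<Union>x\<in>X. \<Union>y\<in>Y. lie_coset L I (ladd L x y)),
    lscale = (\<lambda>c X. \<Union>x\<in>X. lie_coset L I (lscale L c x)),
    lbracket = (\<lambda>X Y. \<Union>x\<in>X. \<Union>y\<in>Y. lie_coset L I (lbracket L x y))\<rparr>"

context bracket_algebra
begin

lemma add_left_commute:
  "\<lbrakk>x \<in> carrier L; y \<in> carrier L; z \<in> carrier L\<rbrakk> \<Longrightarrow>
    ladd L x (ladd L y z) = ladd L y (ladd L x z)"
  using add_assoc add_commute by metis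

lemma lie_coset_absorb:
  assumes I: "lie_subspace I L" and x: "x \<in> carrier L" and i: "i \<in> I"
  shows "lie_coset L I (ladd L x i) = lie_coset L I x"
proof -
  have sub: "\<And>y. y \<in> I \<Longrightarrow> y \<in> carrier L"
    and add: "\<And>y z. y \<in> I \<Longrightarrow> z \<in> I \<Longrightarrow> ladd L y z \<in> I"
    and sc: "\<And>c y. y \<in> I \<Longrightarrow> lscale L c y \<in> I" and z: "lzero L \<in> I"
    using I by (auto simp: lie_subspace_def)
  have le: "lie_coset L I (ladd L y j) \<subseteq> lie_coset L I y" if "y \<in> carrier L" "j \<in> I" for y j
    using that by (auto simp: lie_coset_def add_assoc sub add)
  define j where "j = lscale L (-1) i"
  have j: "j \<in> I" using sc i by (simp add: j_def)
  have ij: "ladd L i j = lscale L 0 i"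
    using add_scale[OF sub[OF i], of 1 "-1"] scale_one[OF sub[OF i]] by (simp add: j_def)
  define o' where "o' = lscale L 0 i"
  have oc: "o' \<in> carrier L" using sub[OF i] scale_closed by (simp add: o'_def)
  have oo: "ladd L o' o' = o'" using add_scale[OF sub[OF i], of 0 0] by (simp add: o'_def)
  obtain w where w: "w \<in> carrier L" "ladd L o' w = lzero L" using add_inverse[OF oc] by blast
  have "o' = ladd L o' (ladd L o' w)"
    using add_zero[OF oc] w oc add_commute zero_closed by metis
  also have "\<dots> = lzero L" using add_assoc[OF oc oc w(1)] oo w by simp
  finally have "ladd L (ladd L x i) j = x"
    using ij add_assoc[OF x sub[OF i] sub[OF j]] add_commute[OF x zero_closed] add_zero[OF x]
    by (simp add: o'_def)
  then show ?thesis
    using le[OF x i] le[OF add_closed[OF x sub[OF i]] j] by auto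
qed

context
  fixes I assumes I: "lie_ideal I L"
begin

private lemma sub: "lie_subspace I L" and mem: "y \<in> I \<Longrightarrow> y \<in> carrier L"
  and z: "lzero L \<in> I"
  and bl: "x \<in> carrier L \<Longrightarrow> y \<in> I \<Longrightarrow> lbracket L x y \<in> I"
  and br: "x \<in> carrier L \<Longrightarrow> y \<in> I \<Longrightarrow> lbracket L y x \<in> I"
  and ad: "x \<in> I \<Longrightarrow> y \<in> I \<Longrightarrow> ladd L x y \<in> I"
  and sc: "y \<in> I \<Longrightarrow> lscale L c y \<in> I"
  using I by (auto simp: lie_ideal_def lie_subspace_def)

lemma lie_quot_add:
  assumes "x \<in> carrier L" "y \<in> carrier L"
  shows "ladd (lie_quot L I) (lie_coset L I x) (lie_coset L I y) = lie_coset L I (ladd L x y)"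
proof -
  have "lie_coset L I (ladd L (ladd L x i) (ladd L y j)) = lie_coset L I (ladd L x y)"
    if "i \<in> I" "j \<in> I" for i j
  proof -
    have "ladd L (ladd L x i) (ladd L y j) = ladd L (ladd L x y) (ladd L i j)"
      using assms that by (simp add: add_assoc add_left_commute[of i] mem add_closed)
    then show ?thesis using lie_coset_absorb[OF sub] assms that add_closed ad by metis
  qed
  then show ?thesis using z by (auto simp: lie_quot_def lie_coset_def[of L I x] lie_coset_def[of L I y])
qed

lemma lie_quot_scale:
  assumes "x \<in> carrier L"
  shows "lscale (lie_quot L I) c (lie_coset L I x) = lie_coset L I (lscale L c x)"
proof -
  have "lie_coset L I (lscale L c (ladd L x i)) = lie_coset L I (lscale L c x)" if "i \<in> I" for i
    using lie_coset_absorb[OF sub scale_closed sc] assms that by (simp add: scale_add mem)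
  then show ?thesis using z by (auto simp: lie_quot_def lie_coset_def[of L I x])
qed

lemma lie_quot_bracket:
  assumes "x \<in> carrier L" "y \<in> carrier L"
  shows "lbracket (lie_quot L I) (lie_coset L I x) (lie_coset L I y) = lie_coset L I (lbracket L x y)"
proof -
  have "lie_coset L I (lbracket L (ladd L x i) (ladd L y j)) = lie_coset L I (lbracket L x y)"
    if "i \<in> I" "j \<in> I" for i j
  proof -
    let ?k = "ladd L (lbracket L x j) (ladd L (lbracket L i y) (lbracket L i j))"
    have "lbracket L (ladd L x i) (ladd L y j) = ladd L (lbracket L x y) ?k"
      using assms that
      by (simp add: bracket_add_left bracket_add_right add_assoc
        add_left_commute[of "lbracket L i y"] mem add_closed bracket_closed)
    moreover have "?k \<in> I" using assms that by (simp add: ad bl br mem)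
    ultimately show ?thesis using lie_coset_absorb[OF sub] assms bracket_closed by metis
  qed
  then show ?thesis using z by (auto simp: lie_quot_def lie_coset_def[of L I x] lie_coset_def[of L I y])
qed

end

end

lemma lie_algebra_lie_quot:
  assumes "lie_algebra L" "lie_ideal I L"
  shows "lie_algebra (lie_quot L I)"
proof -
  interpret lie_algebra L by fact
  have car: "carrier (lie_quot L I) = lie_coset L I ` carrier L"
    and z: "lzero (lie_quot L I) = lie_coset L I (lzero L)"
    by (simp_all add: lie_quot_def)
  note [simp] = lie_quot_add[OF assms(2)] lie_quot_scale[OF assms(2)]
    lie_quot_bracket[OF assms(2)] zero_closed add_closed scale_closed bracket_closed
  have inv: "\<exists>y\<in>carrier L. lie_coset L I (ladd L x y) = lie_coset L I (lzero L)"
    if "x \<in> carrier L" for x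
    using add_inverse[OF that] by (auto intro: bexI[rotated])
  show ?thesis
    by (unfold_locales; (simp only: car z)?; (elim imageE)?; simp?;
      (rule imageI | rule arg_cong[where f = "lie_coset L I"])?;
      (rule add_assoc add_commute add_zero scale_add add_scale scale_scale scale_one
        bracket_add_left bracket_add_right bracket_scale_left bracket_scale_right
        bracket_self jacobi)?; (simp; fail | erule inv))
qed


section \<open>Polynomials and derivations\<close>

text \<open>Polynomials in countably many variables \<open>x\<^sub>0, x\<^sub>1, \<dots>\<close>; a monomial is its exponent vector.\<close>

type_synonym 'k mpol = "(nat \<Rightarrow>\<^sub>0 nat) \<Rightarrow>\<^sub>0 'k"

definition polys_in :: "nat set \<Rightarrow> 'k::zero mpol set" where
  "polys_in V = {p. \<forall>m\<in>Poly_Mapping.keys p. Poly_Mapping.keys m \<subseteq> V}"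

abbreviation P :: "nat \<Rightarrow> 'k::zero mpol set" where
  "P n \<equiv> polys_in {1..n}"

definition pconst :: "'k::zero \<Rightarrow> 'k mpol" where
  "pconst c = Poly_Mapping.single 0 c"

text \<open>Each monomial \<open>m\<close> contributes \<open>m\<^sub>i * x^(m - e\<^sub>i)\<close>; when \<open>m\<^sub>i = 0\<close> the coefficient vanishes, so
  the truncated subtraction of exponents is harmless.\<close>

definition pdiff :: "nat \<Rightarrow> 'k::comm_semiring_1 mpol \<Rightarrow> 'k mpol" where
  "pdiff i p = (\<Sum>m\<in>Poly_Mapping.keys p.
     Poly_Mapping.single (m - Poly_Mapping.single i 1)
       (of_nat (Poly_Mapping.lookup m i) * Poly_Mapping.lookup p m))"

text \<open>A map on the subring \<open>polys_in V\<close> is represented by its extension by zero, so that equality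
  of functions is equality of maps on the subring and the pointwise operations can be used.\<close>

type_synonym 'k vfield = "'k mpol \<Rightarrow> 'k mpol"

definition zero_ext :: "'k::zero mpol set \<Rightarrow> 'k vfield \<Rightarrow> 'k vfield" where
  "zero_ext A D = (\<lambda>p. if p \<in> A then D p else 0)"

definition derivations :: "nat set \<Rightarrow> 'k::field vfield set" where
  "derivations V = {D. (\<forall>p. p \<notin> polys_in V \<longrightarrow> D p = 0) \<and>
    (\<forall>p\<in>polys_in V. D p \<in> polys_in V) \<and>
    (\<forall>p\<in>polys_in V. \<forall>q\<in>polys_in V. D (p + q) = D p + D q) \<and>
    (\<forall>c. \<forall>p\<in>polys_in V. D (pconst c * p) = pconst c * D p) \<and>
    (\<forall>p\<in>polys_in V. \<forall>q\<in>polys_in V. D (p * q) = D p * q + p * D q)}"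

definition Der :: "nat set \<Rightarrow> ('k::field, 'k vfield) bracket_alg" where
  "Der V = \<lparr>
    carrier = derivations V,
    lzero = (\<lambda>p. 0),
    ladd = (\<lambda>D E p. D p + E p),
    lscale = (\<lambda>c D p. pconst c * D p),
    lbracket = (\<lambda>D E p. D (E p) - E (D p))\<rparr>"

abbreviation W :: "nat \<Rightarrow> ('k::field, 'k vfield) bracket_alg" where
  "W n \<equiv> Der {1..n}"

definition polynomial_submodule :: "nat \<Rightarrow> 'k::field vfield set \<Rightarrow> bool" where
  "polynomial_submodule n U \<longleftrightarrow> U \<subseteq> carrier (W n) \<and> lzero (W n) \<in> U \<and>
    (\<forall>D\<in>U. \<forall>E\<in>U. ladd (W n) D E \<in> U) \<and> (\<forall>f\<in>P n. \<forall>D\<in>U. (\<lambda>p. f * D p) \<in> U)"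

definition m_set :: "nat \<Rightarrow> nat \<Rightarrow> 'k::field vfield set" where
  "m_set n s = {zero_ext (P n) (\<lambda>p. (\<Sum>i=1..s. f i * pdiff i p) + (\<Sum>j=s+1..n. g j * pdiff j p)) | f g.
     (\<forall>i\<in>{1..s}. f i \<in> P s) \<and> (\<forall>j\<in>{s+1..n}. g j \<in> P n)}"

definition I_set :: "nat \<Rightarrow> nat \<Rightarrow> 'k::field vfield set" where
  "I_set n s = {zero_ext (P n) (\<lambda>p. \<Sum>j=s+1..n. g j * pdiff j p) | g. \<forall>j\<in>{s+1..n}. g j \<in> P n}"

abbreviation m_alg :: "nat \<Rightarrow> nat \<Rightarrow> ('k::field, 'k vfield) bracket_alg" where
  "m_alg n s \<equiv> sub_alg (W n) (m_set n s)"

abbreviation I_alg :: "nat \<Rightarrow> nat \<Rightarrow> ('k::field, 'k vfield) bracket_alg" where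
  "I_alg n s \<equiv> sub_alg (W n) (I_set n s)"

lemma zero_in_polys_in [simp]: "0 \<in> polys_in V"
  by (simp add: polys_in_def)

lemma polys_in_add: "\<lbrakk>p \<in> polys_in V; q \<in> polys_in V\<rbrakk> \<Longrightarrow> p + q \<in> polys_in V"
  using Poly_Mapping.keys_add[of p q] by (auto simp: polys_in_def)

lemma polys_in_diff:
  fixes p :: "'k::ab_group_add mpol"
  shows "\<lbrakk>p \<in> polys_in V; q \<in> polys_in V\<rbrakk> \<Longrightarrow> p - q \<in> polys_in V"
  using Poly_Mapping.keys_diff[of p q] by (auto simp: polys_in_def)

lemma polys_in_mult:
  assumes "p \<in> polys_in V" "q \<in> polys_in V"
  shows "p * q \<in> polys_in V"
  unfolding polys_in_def
proof safe
  fix m x assume "m \<in> Poly_Mapping.keys (p * q)" and x: "x \<in> Poly_Mapping.keys m"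
  then obtain a b where "m = a + b" "a \<in> Poly_Mapping.keys p" "b \<in> Poly_Mapping.keys q"
    using Poly_Mapping.keys_mult[of p q] by blast
  then have "Poly_Mapping.keys a \<subseteq> V" "Poly_Mapping.keys b \<subseteq> V"
    using assms unfolding polys_in_def by blast+
  then show "x \<in> V" using x \<open>m = a + b\<close> Poly_Mapping.keys_add[of a b] by blast
qed

lemma pconst_in_polys_in [simp]: "pconst c \<in> polys_in V"
  by (auto simp: polys_in_def pconst_def)

lemma derivationsD:
  assumes "D \<in> derivations V"
  shows "p \<notin> polys_in V \<Longrightarrow> D p = 0"
    and "D p \<in> polys_in V"
    and "\<lbrakk>p \<in> polys_in V; q \<in> polys_in V\<rbrakk> \<Longrightarrow> D (p + q) = D p + D q"
    and "p \<in> polys_in V \<Longrightarrow> D (pconst c * p) = pconst c * D p"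
    and "\<lbrakk>p \<in> polys_in V; q \<in> polys_in V\<rbrakk> \<Longrightarrow> D (p * q) = D p * q + p * D q"
proof -
  note D = assms[unfolded derivations_def mem_Collect_eq]
  note d1 = D[THEN conjunct1, rule_format]
  note d2 = D[THEN conjunct2, THEN conjunct1, rule_format]
  note d3 = D[THEN conjunct2, THEN conjunct2, THEN conjunct1, rule_format]
  note d4 = D[THEN conjunct2, THEN conjunct2, THEN conjunct2, THEN conjunct1, rule_format]
  note d5 = D[THEN conjunct2, THEN conjunct2, THEN conjunct2, THEN conjunct2, rule_format]
  show "p \<notin> polys_in V \<Longrightarrow> D p = 0" by (rule d1)
  show "D p \<in> polys_in V" by (cases "p \<in> polys_in V") (simp_all add: d1 d2)
  show "\<lbrakk>p \<in> polys_in V; q \<in> polys_in V\<rbrakk> \<Longrightarrow> D (p + q) = D p + D q" by (rule d3)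
  show "p \<in> polys_in V \<Longrightarrow> D (pconst c * p) = pconst c * D p" by (rule d4)
  show "\<lbrakk>p \<in> polys_in V; q \<in> polys_in V\<rbrakk> \<Longrightarrow> D (p * q) = D p * q + p * D q" by (rule d5)
qed

lemma derivations_zero:
  assumes "D \<in> derivations V"
  shows "D 0 = 0"
proof -
  have "D (0 + 0) = D 0 + D 0"
    by (rule derivationsD(3)[OF assms]) simp_all
  then show ?thesis
    by (simp only: add_0_right add_cancel_right_right)
qed

lemma derivations_diff:
  assumes "D \<in> derivations V" "p \<in> polys_in V" "q \<in> polys_in V"
  shows "D (p - q) = D p - D q"
proof -
  have "D ((p - q) + q) = D (p - q) + D q"
    by (rule derivationsD(3)[OF assms(1) polys_in_diff[OF assms(2,3)] assms(3)])
  then show ?thesis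
    by (simp only: diff_add_cancel add_diff_cancel_right')
qed

lemma derivations_commutator:
  fixes D E :: "'k::field vfield"
  assumes D: "D \<in> derivations V" and E: "E \<in> derivations V"
  shows "(\<lambda>p. D (E p) - E (D p)) \<in> derivations V"
proof -
  note cl = derivationsD(2)[OF D] derivationsD(2)[OF E]
  note a = derivationsD(3)[OF D] derivationsD(3)[OF E]
  note s = derivationsD(4)[OF D] derivationsD(4)[OF E]
  note m = derivationsD(5)[OF D] derivationsD(5)[OF E]
  have 1: "D (E p) - E (D p) = 0" if p: "p \<notin> polys_in V" for p
    by (simp only: derivationsD(1)[OF D p] derivationsD(1)[OF E p]
        derivations_zero[OF D] derivations_zero[OF E] diff_self)
  have 2: "D (E p) - E (D p) \<in> polys_in V" for p
    by (intro polys_in_diff cl)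
  have 3: "D (E (p + q)) - E (D (p + q)) = D (E p) - E (D p) + (D (E q) - E (D q))"
    if p: "p \<in> polys_in V" and q: "q \<in> polys_in V" for p q
    by (simp only: a[OF p q] a[OF cl(1) cl(1)] a[OF cl(2) cl(2)] add_diff_add)
  have 4: "D (E (pconst c * p)) - E (D (pconst c * p)) = pconst c * (D (E p) - E (D p))"
    if p: "p \<in> polys_in V" for c p
    by (simp only: s[OF p] s[OF cl(1)] s[OF cl(2)] right_diff_distrib)
  have 5: "D (E (p * q)) - E (D (p * q)) = (D (E p) - E (D p)) * q + p * (D (E q) - E (D q))"
    if p: "p \<in> polys_in V" and q: "q \<in> polys_in V" for p q
    by (simp only: a polys_in_mult cl p q m left_diff_distrib right_diff_distrib)
      (simp only: algebra_simps)
  show ?thesis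
    unfolding derivations_def mem_Collect_eq using 1 2 3 4 5 by blast
qed

lemma pconst_simps:
  "pconst (c + d) = pconst c + pconst d"
  "pconst (c * d) = pconst c * (pconst d :: 'k::comm_ring_1 mpol)"
  "pconst 1 = (1 :: 'k mpol)"
  "pconst (- c) = - pconst c"
  by (simp_all add: pconst_def single_add mult_single single_uminus)

lemma lie_algebra_Der: "lie_algebra (Der V :: ('k::field, 'k vfield) bracket_alg)"
proof -
  have zero: "(\<lambda>p. 0) \<in> derivations V"
    by (simp add: derivations_def)
  have add: "(\<lambda>p. D p + E p) \<in> derivations V"
    if D: "D \<in> derivations V" and E: "E \<in> derivations V" for D E :: "'k vfield"
  proof -
    have "D (pconst c * p) + E (pconst c * p) = pconst c * (D p + E p)" if "p \<in> polys_in V" for c p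
      by (simp only: derivationsD(4)[OF D that] derivationsD(4)[OF E that] distrib_left)
    moreover have "D (p * q) + E (p * q) = (D p + E p) * q + p * (D q + E q)"
      if "p \<in> polys_in V" "q \<in> polys_in V" for p q
      by (simp only: derivationsD(5)[OF D that] derivationsD(5)[OF E that])
        (simp only: algebra_simps)
    ultimately show ?thesis
      unfolding derivations_def
      by (simp add: derivationsD(1,2,3)[OF D] derivationsD(1,2,3)[OF E] polys_in_add add_ac)
  qed
  have scale: "(\<lambda>p. pconst c * D p) \<in> derivations V"
    if D: "D \<in> derivations V" for D :: "'k vfield" and c
  proof -
    have "pconst c * D (pconst d * p) = pconst d * (pconst c * D p)" if "p \<in> polys_in V" for d p
      by (simp only: derivationsD(4)[OF D that] mult.left_commute)
    moreover have "pconst c * D (p * q) = pconst c * D p * q + p * (pconst c * D q)"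
      if "p \<in> polys_in V" "q \<in> polys_in V" for p q
      by (simp only: derivationsD(5)[OF D that] distrib_left mult_ac)
    ultimately show ?thesis
      unfolding derivations_def
      by (simp add: derivationsD(1,2,3)[OF D] polys_in_mult distrib_left)
  qed
  have neg: "\<exists>E\<in>derivations V. \<forall>p. D p + E p = 0" if "D \<in> derivations V" for D :: "'k vfield"
    by (rule bexI[OF _ scale[OF that, of "-1"]]) (simp add: pconst_simps)
  note d = derivationsD(2) derivationsD(3) derivationsD(4) derivations_diff
  show ?thesis
    by (unfold_locales; (simp add: Der_def zero add scale neg derivations_commutator fun_eq_iff
      d[where V = V] right_diff_distrib; fail | simp add: Der_def fun_eq_iff pconst_simps
      d[where V = V] algebra_simps))
qed


section \<open>Tensor product of a polynomial ring and a Lie algebra\<close>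

text \<open>\<open>A \<otimes>\<^sub>K L\<close> is the free vector space on \<open>A \<times> L\<close> modulo the subspace spanned by the bilinearity
  relations. The free space carries the bilinear extension of
  \<open>[(a, D), (b, E)] = (a b, [D, E])\<close>, and the bracket of the tensor product is the induced one,
  well defined because the relations span an ideal (\<open>tensor_relations_ideal\<close>), and with
  \<open>[a \<otimes> D, b \<otimes> E] = a b \<otimes> [D, E]\<close> (\<open>tensor_alg_bracket\<close>).\<close>

definition pm_scale :: "'k::field \<Rightarrow> ('b \<Rightarrow>\<^sub>0 'k) \<Rightarrow> ('b \<Rightarrow>\<^sub>0 'k)" where
  "pm_scale c = Poly_Mapping.map ((*) c)"

definition free_tensor ::
  "'k::field mpol set \<Rightarrow> ('k, 'v, 'm) bracket_alg_scheme \<Rightarrow>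
    ('k, ('k mpol \<times> 'v) \<Rightarrow>\<^sub>0 'k) bracket_alg" where
  "free_tensor A L = \<lparr>
    carrier = {u. Poly_Mapping.keys u \<subseteq> A \<times> carrier L},
    lzero = 0,
    ladd = (+),
    lscale = pm_scale,
    lbracket = (\<lambda>u v. \<Sum>(a, D)\<in>Poly_Mapping.keys u. \<Sum>(b, E)\<in>Poly_Mapping.keys v.
      Poly_Mapping.single (a * b, lbracket L D E)
        (Poly_Mapping.lookup u (a, D) * Poly_Mapping.lookup v (b, E)))\<rparr>"

definition lie_span :: "('k, 'v, 'm) bracket_alg_scheme \<Rightarrow> 'v set \<Rightarrow> 'v set" where
  "lie_span L S = \<Inter> {U. lie_subspace U L \<and> S \<subseteq> U}"

definition tensor_relations ::
  "'k::field mpol set \<Rightarrow> ('k, 'v, 'm) bracket_alg_scheme \<Rightarrow> (('k mpol \<times> 'v) \<Rightarrow>\<^sub>0 'k) set" where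
  "tensor_relations A L = (let e = (\<lambda>a D. Poly_Mapping.single (a, D) 1) in
    {e (a + b) D - e a D - e b D | a b D. a \<in> A \<and> b \<in> A \<and> D \<in> carrier L} \<union>
    {e a (ladd L D E) - e a D - e a E | a D E. a \<in> A \<and> D \<in> carrier L \<and> E \<in> carrier L} \<union>
    {e (pconst c * a) D - pm_scale c (e a D) | c a D. a \<in> A \<and> D \<in> carrier L} \<union>
    {e a (lscale L c D) - pm_scale c (e a D) | c a D. a \<in> A \<and> D \<in> carrier L})"

definition tensor_alg ::
  "'k::field mpol set \<Rightarrow> ('k, 'v, 'm) bracket_alg_scheme \<Rightarrow>
    ('k, (('k mpol \<times> 'v) \<Rightarrow>\<^sub>0 'k) set) bracket_alg" where
  "tensor_alg A L = lie_quot (free_tensor A L) (lie_span (free_tensor A L) (tensor_relations A L))"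

lemma lookup_pm_scale [simp]: "Poly_Mapping.lookup (pm_scale c u) x = c * Poly_Mapping.lookup u x"
  by (simp add: pm_scale_def map.rep_eq when_def)

lemma pm_scale_pm_scale: "pm_scale c (pm_scale d u) = pm_scale (c * d) u"
  by (rule poly_mapping_eqI) (simp add: mult.assoc)

lemma pm_scale_single [simp]: "pm_scale c (Poly_Mapping.single x d) = Poly_Mapping.single x (c * d)"
  by (rule poly_mapping_eqI) (simp add: lookup_single when_def)

lemma pm_scale_sum: "pm_scale c (sum f S) = (\<Sum>x\<in>S. pm_scale c (f x))"
  by (rule poly_mapping_eqI) (simp add: lookup_sum sum_distrib_left)

context
  fixes A :: "'k::field mpol set" and L :: "('k, 'v, 'm) bracket_alg_scheme"
begin

private abbreviation "B \<equiv> lbracket (free_tensor A L)"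
private abbreviation "e \<equiv> (\<lambda>a D. Poly_Mapping.single (a, D) 1)"
private abbreviation "N \<equiv> lie_span (free_tensor A L) (tensor_relations A L)"

private lemma B_superset:
  assumes "finite S" "Poly_Mapping.keys u \<subseteq> S" "finite T" "Poly_Mapping.keys v \<subseteq> T"
  shows "B u v = (\<Sum>x\<in>S. \<Sum>y\<in>T. Poly_Mapping.single (fst x * fst y, lbracket L (snd x) (snd y))
    (Poly_Mapping.lookup u x * Poly_Mapping.lookup v y))"
proof -
  have "B u v = (\<Sum>x\<in>Poly_Mapping.keys u. \<Sum>y\<in>Poly_Mapping.keys v.
    Poly_Mapping.single (fst x * fst y, lbracket L (snd x) (snd y))
      (Poly_Mapping.lookup u x * Poly_Mapping.lookup v y))"
    by (simp add: free_tensor_def split_def)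
  also have "\<dots> = (\<Sum>x\<in>S. \<Sum>y\<in>Poly_Mapping.keys v.
    Poly_Mapping.single (fst x * fst y, lbracket L (snd x) (snd y))
      (Poly_Mapping.lookup u x * Poly_Mapping.lookup v y))"
    by (rule sum.mono_neutral_left) (use assms in \<open>auto simp: in_keys_iff\<close>)
  also have "\<dots> = (\<Sum>x\<in>S. \<Sum>y\<in>T. Poly_Mapping.single (fst x * fst y, lbracket L (snd x) (snd y))
      (Poly_Mapping.lookup u x * Poly_Mapping.lookup v y))"
    by (intro sum.cong refl sum.mono_neutral_left) (use assms in \<open>auto simp: in_keys_iff\<close>)
  finally show ?thesis .
qed

private lemma B_add_left: "B (u + v) w = B u w + B v w"
proof -
  let ?S = "Poly_Mapping.keys u \<union> Poly_Mapping.keys v"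
  have "Poly_Mapping.keys (u + v) \<subseteq> ?S" by (rule Poly_Mapping.keys_add)
  then show ?thesis
    by (simp add: B_superset[where S = ?S and T = "Poly_Mapping.keys w"] lookup_add
        distrib_right single_add sum.distrib)
qed

private lemma B_add_right: "B w (u + v) = B w u + B w v"
proof -
  let ?S = "Poly_Mapping.keys u \<union> Poly_Mapping.keys v"
  have "Poly_Mapping.keys (u + v) \<subseteq> ?S" by (rule Poly_Mapping.keys_add)
  then show ?thesis
    by (simp add: B_superset[where T = ?S and S = "Poly_Mapping.keys w"] lookup_add
        distrib_left single_add sum.distrib)
qed

private lemma B_diff_left: "B (u - v) w = B u w - B v w"
  using B_add_left[of "u - v" v w] by (simp add: algebra_simps)

private lemma B_diff_right: "B w (u - v) = B w u - B w v"
  using B_add_right[of w "u - v" v] by (simp add: algebra_simps)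

private lemma keys_pm_scale: "Poly_Mapping.keys (pm_scale c u) \<subseteq> Poly_Mapping.keys u"
  by (auto simp: in_keys_iff)

private lemma B_scale_left: "B (pm_scale c u) w = pm_scale c (B u w)"
  by (simp add: B_superset[where S = "Poly_Mapping.keys u" and T = "Poly_Mapping.keys w"]
      keys_pm_scale pm_scale_sum mult.assoc)

private lemma B_scale_right: "B w (pm_scale c u) = pm_scale c (B w u)"
  by (simp add: B_superset[where T = "Poly_Mapping.keys u" and S = "Poly_Mapping.keys w"]
      keys_pm_scale pm_scale_sum mult.left_commute)

lemma free_tensor_bracket_single:
  "lbracket (free_tensor A L) (Poly_Mapping.single (a, D) 1) (Poly_Mapping.single (b, E) 1) =
    Poly_Mapping.single (a * b, lbracket L D E) 1"
  by (simp add: free_tensor_def)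

private lemma B_expand_left:
  "B u w = (\<Sum>x\<in>Poly_Mapping.keys u. pm_scale (Poly_Mapping.lookup u x) (B (e (fst x) (snd x)) w))"
proof -
  have "B (e (fst x) (snd x)) w = (\<Sum>y\<in>Poly_Mapping.keys w.
     Poly_Mapping.single (fst x * fst y, lbracket L (snd x) (snd y)) (Poly_Mapping.lookup w y))" for x
    by (simp add: free_tensor_def split_def)
  then show ?thesis
    by (simp add: B_superset[where T = "Poly_Mapping.keys w" and S = "Poly_Mapping.keys u"] pm_scale_sum)
qed

private lemma B_expand_right:
  "B u w = (\<Sum>x\<in>Poly_Mapping.keys w. pm_scale (Poly_Mapping.lookup w x) (B u (e (fst x) (snd x))))"
proof -
  have "B u (e (fst x) (snd x)) = (\<Sum>y\<in>Poly_Mapping.keys u.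
     Poly_Mapping.single (fst y * fst x, lbracket L (snd y) (snd x)) (Poly_Mapping.lookup u y))" for x
    by (simp add: free_tensor_def split_def)
  moreover have "B u w = (\<Sum>x\<in>Poly_Mapping.keys w. \<Sum>y\<in>Poly_Mapping.keys u.
     Poly_Mapping.single (fst y * fst x, lbracket L (snd y) (snd x))
       (Poly_Mapping.lookup u y * Poly_Mapping.lookup w x))"
    by (subst B_superset[OF finite_keys order_refl finite_keys order_refl]) (rule sum.swap)
  ultimately show ?thesis
    by (simp add: pm_scale_sum mult.commute)
qed

context
  assumes L: "bracket_algebra L"
    and A: "\<And>a b. a \<in> A \<Longrightarrow> b \<in> A \<Longrightarrow> a + b \<in> A" "\<And>a b. a \<in> A \<Longrightarrow> b \<in> A \<Longrightarrow> a * b \<in> A"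
      "\<And>c. pconst c \<in> A"
begin

interpretation L: bracket_algebra L by (rule L)

private lemma diff_car:
  "u \<in> carrier (free_tensor A L) \<Longrightarrow> v \<in> carrier (free_tensor A L) \<Longrightarrow>
    u - v \<in> carrier (free_tensor A L)"
  using Poly_Mapping.keys_diff[of u v] by (auto simp: free_tensor_def)

private lemma single_car:
  "a \<in> A \<Longrightarrow> D \<in> carrier L \<Longrightarrow> Poly_Mapping.single (a, D) c \<in> carrier (free_tensor A L)"
  by (auto simp: free_tensor_def)

private lemma add_car:
  "u \<in> carrier (free_tensor A L) \<Longrightarrow> v \<in> carrier (free_tensor A L) \<Longrightarrow>
    u + v \<in> carrier (free_tensor A L)"
  using Poly_Mapping.keys_add[of u v] by (auto simp: free_tensor_def)

private lemma scale_car: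
  "u \<in> carrier (free_tensor A L) \<Longrightarrow> pm_scale c u \<in> carrier (free_tensor A L)"
  using keys_pm_scale[of c u] by (auto simp: free_tensor_def)

private lemma sum_car:
  "(\<And>x. x \<in> S \<Longrightarrow> f x \<in> carrier (free_tensor A L)) \<Longrightarrow> sum f S \<in> carrier (free_tensor A L)"
  by (induction S rule: infinite_finite_induct) (auto simp: add_car, simp_all add: free_tensor_def)

lemma bracket_algebra_free_tensor: "bracket_algebra (free_tensor A L)"
proof -
  have br: "B u v \<in> carrier (free_tensor A L)"
    if "u \<in> carrier (free_tensor A L)" "v \<in> carrier (free_tensor A L)" for u v
  proof -
    have "fst x \<in> A" "snd x \<in> carrier L" if "x \<in> Poly_Mapping.keys u \<union> Poly_Mapping.keys v" for x
      using that \<open>u \<in> _\<close> \<open>v \<in> _\<close> by (auto simp: free_tensor_def)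
    then show ?thesis
      by (subst B_superset[where S = "Poly_Mapping.keys u" and T = "Poly_Mapping.keys v"])
        (auto intro!: sum_car single_car A L.bracket_closed)
  qed
  have neg: "\<exists>v\<in>carrier (free_tensor A L). u + v = 0" if "u \<in> carrier (free_tensor A L)" for u
    by (rule bexI[of _ "- u"]) (use that in \<open>auto simp: free_tensor_def\<close>)
  have ops: "lzero (free_tensor A L) = 0" "ladd (free_tensor A L) = (+)"
    "lscale (free_tensor A L) = pm_scale" "0 \<in> carrier (free_tensor A L)"
    by (simp_all add: free_tensor_def)
  show ?thesis
    by (unfold_locales;
      (simp add: ops br neg add_car scale_car add.assoc add.commute B_add_left B_add_right
        B_scale_left B_scale_right pm_scale_pm_scale)?;
      (rule poly_mapping_eqI; simp add: lookup_add algebra_simps)?)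
qed

private lemma N_subspace: "lie_subspace N (free_tensor A L)"
  and N_rel: "tensor_relations A L \<subseteq> N"
proof -
  interpret F: bracket_algebra "free_tensor A L" by (rule bracket_algebra_free_tensor)
  have "tensor_relations A L \<subseteq> carrier (free_tensor A L)"
    unfolding tensor_relations_def Let_def
    by (auto intro!: diff_car single_car A L.add_closed L.scale_closed)
  then have "lie_subspace (carrier (free_tensor A L)) (free_tensor A L) \<and>
      tensor_relations A L \<subseteq> carrier (free_tensor A L)"
    by (simp add: lie_subspace_def F.zero_closed F.add_closed F.scale_closed)
  then show "lie_subspace N (free_tensor A L)"
    unfolding lie_span_def lie_subspace_def by blast
  show "tensor_relations A L \<subseteq> N" unfolding lie_span_def by blast
qed

private lemma N_scale: "u \<in> N \<Longrightarrow> pm_scale c u \<in> N"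
  and N_add: "u \<in> N \<Longrightarrow> v \<in> N \<Longrightarrow> u + v \<in> N"
  and N_zero: "0 \<in> N"
  using N_subspace by (auto simp: lie_subspace_def free_tensor_def)

private lemma N_sum: "(\<And>x. x \<in> S \<Longrightarrow> f x \<in> N) \<Longrightarrow> sum f S \<in> N"
  by (induction S rule: infinite_finite_induct) (auto simp: N_add N_zero)

private lemma rels:
  "\<lbrakk>a \<in> A; b \<in> A; D \<in> carrier L\<rbrakk> \<Longrightarrow> e (a + b) D - e a D - e b D \<in> tensor_relations A L"
  "\<lbrakk>a \<in> A; D \<in> carrier L; E \<in> carrier L\<rbrakk> \<Longrightarrow>
    e a (ladd L D E) - e a D - e a E \<in> tensor_relations A L"
  "\<lbrakk>a \<in> A; D \<in> carrier L\<rbrakk> \<Longrightarrow>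
    e (pconst c * a) D - pm_scale c (e a D) \<in> tensor_relations A L"
  "\<lbrakk>a \<in> A; D \<in> carrier L\<rbrakk> \<Longrightarrow>
    e a (lscale L c D) - pm_scale c (e a D) \<in> tensor_relations A L"
  unfolding tensor_relations_def Let_def by blast+

private lemma B_rel:
  assumes a: "a \<in> A" and D: "D \<in> carrier L" and r: "r \<in> tensor_relations A L"
  shows "B (e a D) r \<in> N" "B r (e a D) \<in> N"
proof -
  have "B (e a D) r \<in> tensor_relations A L \<and> B r (e a D) \<in> tensor_relations A L"
    using r[unfolded tensor_relations_def Let_def]
  proof (elim UnE CollectE exE conjE)
    fix b c E assume r: "r = e (b + c) E - e b E - e c E" "b \<in> A" "c \<in> A" "E \<in> carrier L"
    have "B (e a D) r = e (a * b + a * c) (lbracket L D E) - e (a * b) (lbracket L D E) - e (a * c) (lbracket L D E)"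
      "B r (e a D) = e (b * a + c * a) (lbracket L E D) - e (b * a) (lbracket L E D) - e (c * a) (lbracket L E D)"
      unfolding r by (simp_all only: B_diff_left B_diff_right free_tensor_bracket_single distrib_left distrib_right)
    then show ?thesis using r(2-) a D by (simp only: rels A L.bracket_closed simp_thms)
  next
    fix b E F assume r: "r = e b (ladd L E F) - e b E - e b F" "b \<in> A" "E \<in> carrier L" "F \<in> carrier L"
    have "B (e a D) r = e (a * b) (ladd L (lbracket L D E) (lbracket L D F)) - e (a * b) (lbracket L D E) - e (a * b) (lbracket L D F)"
      "B r (e a D) = e (b * a) (ladd L (lbracket L E D) (lbracket L F D)) - e (b * a) (lbracket L E D) - e (b * a) (lbracket L F D)"
      unfolding r(1) using r D
      by (simp_all only: B_diff_left B_diff_right free_tensor_bracket_single L.bracket_add_left L.bracket_add_right)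
    then show ?thesis using r(2-) a D by (simp only: rels A L.bracket_closed simp_thms)
  next
    fix c b E assume r: "r = e (pconst c * b) E - pm_scale c (e b E)" "b \<in> A" "E \<in> carrier L"
    have "B (e a D) r = e (pconst c * (a * b)) (lbracket L D E) - pm_scale c (e (a * b) (lbracket L D E))"
      "B r (e a D) = e (pconst c * (b * a)) (lbracket L E D) - pm_scale c (e (b * a) (lbracket L E D))"
      unfolding r
      by (simp_all only: B_diff_left B_diff_right B_scale_left B_scale_right
          free_tensor_bracket_single mult.left_commute mult.assoc)
    then show ?thesis using r(2-) a D by (simp only: rels A L.bracket_closed simp_thms)
  next
    fix c b E assume r: "r = e b (lscale L c E) - pm_scale c (e b E)" "b \<in> A" "E \<in> carrier L"
    have "B (e a D) r = e (a * b) (lscale L c (lbracket L D E)) - pm_scale c (e (a * b) (lbracket L D E))"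
      "B r (e a D) = e (b * a) (lscale L c (lbracket L E D)) - pm_scale c (e (b * a) (lbracket L E D))"
      unfolding r(1) using r D
      by (simp_all only: B_diff_left B_diff_right B_scale_left B_scale_right
          free_tensor_bracket_single L.bracket_scale_left L.bracket_scale_right)
    then show ?thesis using r(2-) a D by (simp only: rels A L.bracket_closed simp_thms)
  qed
  then show "B (e a D) r \<in> N" "B r (e a D) \<in> N" using N_rel by auto
qed

lemma tensor_relations_ideal:
  "lie_ideal (lie_span (free_tensor A L) (tensor_relations A L)) (free_tensor A L)"
  unfolding lie_ideal_def
proof (intro conjI ballI N_subspace)
  fix x y assume x: "x \<in> carrier (free_tensor A L)" and y: "y \<in> N"
  let ?U = "{y \<in> carrier (free_tensor A L). B x y \<in> N \<and> B y x \<in> N}"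
  have x': "fst z \<in> A \<and> snd z \<in> carrier L" if "z \<in> Poly_Mapping.keys x" for z
    using x that by (auto simp: free_tensor_def)
  have "tensor_relations A L \<subseteq> ?U"
  proof
    fix r assume r: "r \<in> tensor_relations A L"
    have "B x r \<in> N"
      by (subst B_expand_left) (use x' r in \<open>blast intro: N_sum N_scale B_rel\<close>)
    moreover have "B r x \<in> N"
      by (subst B_expand_right) (use x' r in \<open>blast intro: N_sum N_scale B_rel\<close>)
    ultimately show "r \<in> ?U" using r N_rel N_subspace by (auto simp: lie_subspace_def)
  qed
  moreover have "lie_subspace ?U (free_tensor A L)"
  proof -
    have ops: "lzero (free_tensor A L) = 0" "ladd (free_tensor A L) = (+)"
      "lscale (free_tensor A L) = pm_scale" "0 \<in> carrier (free_tensor A L)"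
      by (simp_all add: free_tensor_def)
    have "B x 0 = 0" "B 0 x = 0" by (simp_all add: free_tensor_def)
    then show ?thesis
      by (auto simp: lie_subspace_def ops N_zero N_add N_scale add_car scale_car
          B_add_left B_add_right B_scale_left B_scale_right)
  qed
  ultimately have "y \<in> ?U" using y unfolding lie_span_def by blast
  then show "B x y \<in> N" "B y x \<in> N" by auto
qed

lemma tensor_alg_bracket:
  defines "pure \<equiv> \<lambda>a D. lie_coset (free_tensor A L)
    (lie_span (free_tensor A L) (tensor_relations A L)) (Poly_Mapping.single (a, D) 1)"
  assumes "a \<in> A" "D \<in> carrier L" "b \<in> A" "E \<in> carrier L"
  shows "lbracket (tensor_alg A L) (pure a D) (pure b E) = pure (a * b) (lbracket L D E)"
  unfolding pure_def tensor_alg_def using assms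
  by (simp add: bracket_algebra.lie_quot_bracket[OF bracket_algebra_free_tensor tensor_relations_ideal]
      single_car free_tensor_bracket_single)

end

end

end

theory Submission
  imports Defs
begin

text \<open>A derivation of a polynomial ring is determined by its values on the variables; \<open>m\<^sub>s\<close> consists of
  the derivations that preserve \<open>P\<^sub>s\<close>, and \<open>I\<^sub>s\<close> is the kernel of the restriction map from \<open>m\<^sub>s\<close> to
  \<open>W\<^sub>s\<close>.

  Since bracketing with the \<open>\<partial>\<^sub>i\<close> lowers degrees, a non-zero ideal of \<open>m\<^sub>s\<close> contains a non-zero
  derivation with constant coefficients; brackets with \<open>x\<^sub>j \<partial>\<^sub>k\<close> and then with \<open>g \<partial>\<^sub>k\<close> produce first
  all of \<open>I\<^sub>s\<close> and, if the ideal is larger, all of \<open>m\<^sub>s\<close>. Likewise, a subalgebra properly containing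
  \<open>m\<^sub>s\<close> contains some \<open>D\<close> outside \<open>m\<^sub>s\<close> with \<open>[\<partial>\<^sub>i, D]\<close> in \<open>m\<^sub>s\<close> for all \<open>i\<close>; then a coefficient
  \<open>f\<close> of \<open>D\<close> has a non-zero constant derivative \<open>\<partial>\<^sub>q f\<close> with \<open>q > s\<close>, and \<open>[g \<partial>\<^sub>q, f \<partial>\<^sub>r]\<close> gives every
  \<open>g \<partial>\<^sub>r\<close>.

  An isomorphism from \<open>m\<^sub>s\<close> to \<open>m\<^sub>t\<close>, followed by restriction to \<open>P\<^sub>t\<close>, has a proper ideal as its kernel,
  so it is non-zero on \<open>\<partial>\<^sub>1, \<dots>, \<partial>\<^sub>s\<close>. The images of the Euler fields \<open>x\<^sub>i \<partial>\<^sub>i\<close> and of the \<open>\<partial>\<^sub>i\<close> in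
  \<open>W\<^sub>t\<close> keep their commutation relations, which is only possible if \<open>s \<le> t\<close>.\<close>

section \<open>Partial derivatives and polynomial subrings\<close>

definition pvar :: "nat \<Rightarrow> 'k::comm_semiring_1 mpol" where
  "pvar i = Poly_Mapping.single (Poly_Mapping.single i 1) 1"

definition mdeg :: "(nat \<Rightarrow>\<^sub>0 nat) \<Rightarrow> nat" where
  "mdeg m = Sum_any (Poly_Mapping.lookup m)"

lemma mdeg_add: "mdeg (m + l) = mdeg m + mdeg l"
  by (simp add: mdeg_def lookup_add Sum_any.distrib)

lemma mdeg_single [simp]: "mdeg (Poly_Mapping.single i k) = k"
  by (simp add: mdeg_def lookup_single)

lemma exponent_minus_plus:
  assumes "i \<in> Poly_Mapping.keys m"
  shows "m - Poly_Mapping.single i 1 + Poly_Mapping.single i (1::nat) = m"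
  using assms by (intro poly_mapping_eqI) (auto simp: lookup_add lookup_minus lookup_single when_def in_keys_iff)

lemma keys_plus_exponent: "Poly_Mapping.keys (m + l) = Poly_Mapping.keys m \<union> Poly_Mapping.keys (l :: nat \<Rightarrow>\<^sub>0 nat)"
  by (auto simp: in_keys_iff lookup_add)

lemma sum_single_lookup: "p = (\<Sum>m\<in>Poly_Mapping.keys p. Poly_Mapping.single m (Poly_Mapping.lookup p m))"
  by (rule poly_mapping_eqI) (auto simp: lookup_sum lookup_single when_def in_keys_iff sum.delta)

section \<open>Induction principles for polynomials\<close>

lemma mpol_induct [case_names single add]:
  fixes p :: "'k::comm_monoid_add mpol"
  assumes single: "\<And>m c. Q (Poly_Mapping.single m c)" and add: "\<And>p q. Q p \<Longrightarrow> Q q \<Longrightarrow> Q (p + q)"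
  shows "Q p"
proof -
  have "Q (\<Sum>m\<in>S. Poly_Mapping.single m (Poly_Mapping.lookup p m))" for S
    \<comment> \<open>A monomial with coefficient zero is the zero polynomial, the value of a sum
      over an empty or infinite set.\<close>
    using single[of 0 0] by (induction S rule: infinite_finite_induct) (auto intro: single add)
  then show ?thesis using sum_single_lookup[of p] by metis
qed

lemma polys_in_single: "Poly_Mapping.keys m \<subseteq> V \<Longrightarrow> Poly_Mapping.single m c \<in> polys_in V"
  by (simp add: polys_in_def)

text \<open>Only subsets of the support are summed, so every partial sum stays in
  \<open>polys_in V\<close>; this provides the membership facts of the \<open>add\<close>
  case.\<close>

lemma polys_in_add_induct [consumes 1, case_names single add]:
  fixes p :: "'k::comm_monoid_add mpol"
  assumes p: "p \<in> polys_in V"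
    and single: "\<And>m c. Poly_Mapping.keys m \<subseteq> V \<Longrightarrow> Q (Poly_Mapping.single m c)"
    and add: "\<And>p q. p \<in> polys_in V \<Longrightarrow> q \<in> polys_in V \<Longrightarrow> Q p \<Longrightarrow> Q q \<Longrightarrow> Q (p + q)"
  shows "Q p"
proof -
  have "sum (\<lambda>m. Poly_Mapping.single m (Poly_Mapping.lookup p m)) S \<in> polys_in V \<and>
    Q (\<Sum>m\<in>S. Poly_Mapping.single m (Poly_Mapping.lookup p m))" if "S \<subseteq> Poly_Mapping.keys p" for S
    using that
  proof (induction S rule: infinite_finite_induct)
    case (insert m S)
    have "Poly_Mapping.keys m \<subseteq> V" using insert p by (auto simp: polys_in_def)
    then show ?case using insert single by (auto intro: add polys_in_add polys_in_single)
  qed (use single[of 0 0] in auto)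
  then show ?thesis using sum_single_lookup[of p] by (metis order_refl)
qed

text \<open>A monomial is stripped of one variable at a time, by induction on its total degree. The
  cases match the rules that govern a derivation.\<close>

lemma polys_in_induct [consumes 1, case_names const var add mult]:
  fixes p :: "'k::comm_semiring_1 mpol"
  assumes p: "p \<in> polys_in V"
    and const: "\<And>c. Q (pconst c)" and var: "\<And>i. i \<in> V \<Longrightarrow> Q (pvar i)"
    and add: "\<And>p q. p \<in> polys_in V \<Longrightarrow> q \<in> polys_in V \<Longrightarrow> Q p \<Longrightarrow> Q q \<Longrightarrow> Q (p + q)"
    and mult: "\<And>p q. p \<in> polys_in V \<Longrightarrow> q \<in> polys_in V \<Longrightarrow> Q p \<Longrightarrow> Q q \<Longrightarrow> Q (p * q)"
  shows "Q p"
proof -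
  have single: "Poly_Mapping.single m c \<in> polys_in V \<and> Q (Poly_Mapping.single m c)"
    if "Poly_Mapping.keys m \<subseteq> V" for m c
    using that
  proof (induction "mdeg m" arbitrary: m rule: less_induct)
    case less
    show ?case
    proof (cases "Poly_Mapping.keys m = {}")
      case True
      then show ?thesis
        using const[of c] pconst_in_polys_in[of c V] by (simp add: pconst_def)
    next
      case False
      then obtain i where i: "i \<in> Poly_Mapping.keys m" by blast
      define l where "l = m - Poly_Mapping.single i 1"
      have m: "m = Poly_Mapping.single i 1 + l"
        using exponent_minus_plus[OF i] by (simp add: l_def add.commute)
      have k: "Poly_Mapping.keys l \<subseteq> V" "i \<in> V"
        using less.prems by (auto simp: m keys_plus_exponent)
      have "Poly_Mapping.single m c = pvar i * Poly_Mapping.single l c"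
        by (simp add: m pvar_def mult_single)
      moreover have "mdeg l < mdeg m" by (simp add: m mdeg_add)
      moreover have "pvar i \<in> (polys_in V :: 'k mpol set)" using k by (simp add: pvar_def polys_in_def)
      ultimately show ?thesis
        using less.hyps[OF _ k(1)] k var[OF k(2)] by (auto intro: mult polys_in_mult)
    qed
  qed
  show ?thesis using p by (induction rule: polys_in_add_induct) (auto intro: add simp: single)
qed

section \<open>Closure properties of polynomial subrings\<close>

lemma polys_in_sum: "(\<And>x. x \<in> S \<Longrightarrow> f x \<in> polys_in V) \<Longrightarrow> sum f S \<in> polys_in V"
  by (induction S rule: infinite_finite_induct) (auto intro: polys_in_add)

lemma polys_in_mono: "U \<subseteq> V \<Longrightarrow> p \<in> polys_in U \<Longrightarrow> p \<in> polys_in V"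
  by (fastforce simp: polys_in_def)

lemma polys_in_uminus: "p \<in> polys_in V \<Longrightarrow> - p \<in> (polys_in V :: 'k::ab_group_add mpol set)"
  by (simp add: polys_in_def)

lemma pvar_in_polys_in [simp]: "pvar i \<in> (polys_in V :: 'k::comm_semiring_1 mpol set) \<longleftrightarrow> i \<in> V"
  by (simp add: pvar_def polys_in_def)

lemma one_in_polys_in [simp]: "1 \<in> (polys_in V :: 'k::comm_semiring_1 mpol set)"
  by (simp add: polys_in_def)

lemma pconst_zero [simp]: "pconst 0 = 0"
  by (simp add: pconst_def)

lemma pconst_eq_0_iff [simp]: "pconst c = 0 \<longleftrightarrow> c = 0"
  by (metis pconst_def lookup_single_eq lookup_zero pconst_zero)

section \<open>Coefficients and formal partial derivatives\<close>

lemma lookup_pconst_mult: "Poly_Mapping.lookup (pconst c * p) m = c * Poly_Mapping.lookup p m"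
  by (simp add: pconst_def flip: mult_map_scale_conv_mult) (simp add: map.rep_eq when_def)

text \<open>This form is free of truncated subtraction, so that identities for \<open>pdiff\<close>
  can be checked by comparing coefficients.\<close>

lemma lookup_pdiff:
  "Poly_Mapping.lookup (pdiff i p) m =
    of_nat (Suc (Poly_Mapping.lookup m i)) * Poly_Mapping.lookup p (m + Poly_Mapping.single i 1)"
proof -
  let ?e = "Poly_Mapping.single i (1::nat)"
  \<comment> \<open>Truncated subtraction can produce \<open>m\<close> from a wrong \<open>l\<close>
    only if \<open>l\<close> has exponent 0 at \<open>i\<close>, and such terms have coefficient
    0.\<close>
  have eq: "l - ?e = m \<longleftrightarrow> l = m + ?e" if "Poly_Mapping.lookup l i \<noteq> 0" for l
    using exponent_minus_plus[of i l] that by (auto simp: in_keys_iff)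
  have "Poly_Mapping.lookup (pdiff i p) m = (\<Sum>l\<in>Poly_Mapping.keys p.
      if l = m + ?e then of_nat (Poly_Mapping.lookup l i) * Poly_Mapping.lookup p l else 0)"
    unfolding pdiff_def lookup_sum
  proof (rule sum.cong[OF refl])
    fix l
    show "Poly_Mapping.lookup (Poly_Mapping.single (l - ?e)
          (of_nat (Poly_Mapping.lookup l i) * Poly_Mapping.lookup p l)) m =
        (if l = m + ?e then of_nat (Poly_Mapping.lookup l i) * Poly_Mapping.lookup p l else 0)"
      using eq[of l] by (cases "Poly_Mapping.lookup l i = 0") (auto simp: lookup_single when_def)
  qed
  also have "\<dots> = of_nat (Suc (Poly_Mapping.lookup m i)) * Poly_Mapping.lookup p (m + ?e)"
    by (simp add: sum.delta in_keys_iff lookup_add del: of_nat_Suc)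
  finally show ?thesis .
qed

lemma pdiff_add: "pdiff i (p + q) = pdiff i p + pdiff i q"
  by (rule poly_mapping_eqI) (simp add: lookup_pdiff lookup_add distrib_left)

lemma pdiff_zero [simp]: "pdiff i 0 = 0"
  by (simp add: pdiff_def)

lemma pdiff_sum: "pdiff i (sum f S) = (\<Sum>x\<in>S. pdiff i (f x))"
  by (induction S rule: infinite_finite_induct) (simp_all add: pdiff_add)

lemma pdiff_single: "pdiff i (Poly_Mapping.single m c) =
    Poly_Mapping.single (m - Poly_Mapping.single i 1) (of_nat (Poly_Mapping.lookup m i) * c)"
  by (cases "c = 0") (simp_all add: pdiff_def)

lemma pdiff_mult: "pdiff i (p * q) = pdiff i p * q + p * pdiff i q"
proof (induction p rule: mpol_induct)
  case (single m c)
  show ?case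
  proof (induction q rule: mpol_induct)
    case (single l d)
    let ?e = "Poly_Mapping.single i (1::nat)"
    \<comment> \<open>Subtracting before or after the addition can differ only if the exponent of
      \<open>a\<close> at \<open>i\<close> is 0; in \<open>1\<close> and \<open>2\<close> that case
      carries the coefficient 0.\<close>
    have shift: "a - ?e + b = a + b - ?e" if "Poly_Mapping.lookup a i \<noteq> 0" for a b
      by (rule poly_mapping_eqI)
        (use that in \<open>auto simp: lookup_add lookup_minus lookup_single when_def\<close>)
    have 1: "Poly_Mapping.single (m - ?e + l) (of_nat (Poly_Mapping.lookup m i) * c * d) =
        Poly_Mapping.single (m + l - ?e) (of_nat (Poly_Mapping.lookup m i) * c * d)"
      using shift[of m l] by (cases "Poly_Mapping.lookup m i = 0") simp_all
    have 2: "Poly_Mapping.single (m + (l - ?e)) (c * (of_nat (Poly_Mapping.lookup l i) * d)) =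
        Poly_Mapping.single (m + l - ?e) (c * (of_nat (Poly_Mapping.lookup l i) * d))"
      using shift[of l m] by (cases "Poly_Mapping.lookup l i = 0") (simp_all add: add.commute)
    show ?case
      by (simp only: mult_single pdiff_single 1 2 lookup_add of_nat_add flip: single_add)
        (simp only: algebra_simps)
  qed (simp add: distrib_left pdiff_add add_ac)
qed (simp add: distrib_right pdiff_add add_ac)

lemma pdiff_pconst [simp]: "pdiff i (pconst c) = 0"
  by (simp add: pconst_def pdiff_single)

lemma pdiff_one [simp]: "pdiff i 1 = 0"
  using pdiff_pconst[of i 1] by (simp only: pconst_def single_one)

lemma pdiff_pvar: "pdiff i (pvar j) = (if i = j then 1 else 0)"
  by (simp add: pvar_def pdiff_single lookup_single when_def)

lemma pdiff_pconst_mult: "pdiff i (pconst c * p) = pconst c * pdiff i p"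
  by (simp add: pdiff_mult)

lemma pdiff_commute: "pdiff i (pdiff j p) = pdiff j (pdiff i p)"
  by (rule poly_mapping_eqI)
    (auto simp: lookup_pdiff lookup_add lookup_single when_def mult_ac add_ac)

lemma pdiff_polys_in: "p \<in> polys_in V \<Longrightarrow> pdiff i p \<in> polys_in V"
  unfolding polys_in_def
proof safe
  fix m j assume p: "\<forall>m\<in>Poly_Mapping.keys p. Poly_Mapping.keys m \<subseteq> V"
    and m: "m \<in> Poly_Mapping.keys (pdiff i p)" and j: "j \<in> Poly_Mapping.keys m"
  have "m + Poly_Mapping.single i 1 \<in> Poly_Mapping.keys p"
    using m by (auto simp: in_keys_iff lookup_pdiff)
  then have "Poly_Mapping.keys (m + Poly_Mapping.single i 1) \<subseteq> V" using p by blast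
  then show "j \<in> V" using j by (auto simp: keys_plus_exponent)
qed

lemma pdiff_eq_0:
  assumes "p \<in> polys_in V" "i \<notin> V"
  shows "pdiff i p = 0"
proof (rule poly_mapping_eqI)
  fix m
  have "m + Poly_Mapping.single i 1 \<notin> Poly_Mapping.keys p"
    using assms by (fastforce simp: polys_in_def keys_plus_exponent)
  then show "Poly_Mapping.lookup (pdiff i p) m = Poly_Mapping.lookup 0 m"
    by (simp add: lookup_pdiff in_keys_iff)
qed

text \<open>Characteristic zero enters here: a monomial containing \<open>x\<^sub>i\<close> survives
  in the \<open>i\<close>-th derivative, its coefficient being multiplied by a positive
  integer.\<close>

lemma polys_in_pdiff_eq_0:
  fixes p :: "'k::field_char_0 mpol"
  assumes p: "p \<in> polys_in V" and z: "\<And>i. i \<in> V - U \<Longrightarrow> pdiff i p = 0"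
  shows "p \<in> polys_in U"
  unfolding polys_in_def
proof safe
  fix m i assume m: "m \<in> Poly_Mapping.keys p" and i: "i \<in> Poly_Mapping.keys m"
  show "i \<in> U"
  proof (rule ccontr)
    assume "i \<notin> U"
    moreover have "i \<in> V" using p m i by (auto simp: polys_in_def)
    ultimately have "Poly_Mapping.lookup (pdiff i p) (m - Poly_Mapping.single i 1) = 0"
      using z[of i] by simp
    then show False
      using m by (simp add: lookup_pdiff exponent_minus_plus[OF i, simplified] in_keys_iff del: of_nat_Suc)
  qed
qed

lemma polys_in_empty: "p \<in> polys_in {} \<Longrightarrow> \<exists>c. p = pconst c"
proof (rule exI)
  assume "p \<in> polys_in {}"
  then show "p = pconst (Poly_Mapping.lookup p 0)"
    by (intro poly_mapping_eqI) (auto simp: polys_in_def pconst_def lookup_single when_def in_keys_iff)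
qed

text \<open>The witness is the term-by-term antiderivative, whose divisions by positive integers
  require characteristic zero.\<close>

lemma pdiff_surj:
  fixes p :: "'k::field_char_0 mpol"
  assumes "p \<in> polys_in V" "i \<in> V"
  shows "\<exists>q\<in>polys_in V. pdiff i q = p"
proof -
  define q where "q = (\<Sum>m\<in>Poly_Mapping.keys p. Poly_Mapping.single (m + Poly_Mapping.single i 1)
    (Poly_Mapping.lookup p m / of_nat (Suc (Poly_Mapping.lookup m i))))"
  have "q \<in> polys_in V" unfolding q_def
    using assms by (intro polys_in_sum polys_in_single) (auto simp: keys_plus_exponent polys_in_def)
  moreover have "pdiff i q = (\<Sum>m\<in>Poly_Mapping.keys p. Poly_Mapping.single m (Poly_Mapping.lookup p m))"
    unfolding q_def by (simp add: pdiff_sum pdiff_single lookup_add lookup_single del: of_nat_Suc)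
  ultimately show ?thesis using sum_single_lookup[of p] by metis
qed

section \<open>Derivations in coordinates\<close>

definition vf :: "nat set \<Rightarrow> (nat \<Rightarrow> 'k mpol) \<Rightarrow> 'k::field vfield" where
  "vf V a = zero_ext (polys_in V) (\<lambda>p. \<Sum>i\<in>V. a i * pdiff i p)"

lemma derivations_pconst:
  assumes D: "D \<in> derivations V"
  shows "D (pconst c) = 0"
proof -
  have "D (1 * 1) = D 1 * 1 + 1 * D 1" by (rule derivationsD(5)[OF D]) simp_all
  then have "D 1 = 0" by (simp only: mult_1_left mult_1_right add_cancel_right_right)
  then show ?thesis using derivationsD(4)[OF D, of 1 c] by simp
qed

text \<open>Additivity and the Leibniz rule carry agreement from the variables to all of
  \<open>polys_in V\<close>; elsewhere both maps are 0 by convention. Most identities between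
  derivations below are checked this way.\<close>

lemma derivations_eqI:
  assumes D: "D \<in> derivations V" and E: "E \<in> derivations V"
    and eq: "\<And>i. i \<in> V \<Longrightarrow> D (pvar i) = E (pvar i)"
  shows "D = E"
proof
  fix p
  show "D p = E p"
  proof (cases "p \<in> polys_in V")
    case True
    then show ?thesis
      by (induction rule: polys_in_induct)
        (simp_all add: derivations_pconst[OF D] derivations_pconst[OF E] eq
          derivationsD(3,5)[OF D] derivationsD(3,5)[OF E])
  next
    case False
    then show ?thesis by (simp add: derivationsD(1)[OF D] derivationsD(1)[OF E])
  qed
qed

lemma vf_in_derivations:
  assumes "\<And>i. i \<in> V \<Longrightarrow> a i \<in> polys_in V"
  shows "vf V a \<in> derivations V"
proof -
  let ?D = "\<lambda>p. \<Sum>i\<in>V. a i * pdiff i p"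
  have "?D p \<in> polys_in V" if "p \<in> polys_in V" for p
    using assms that by (intro polys_in_sum polys_in_mult pdiff_polys_in)
  moreover have "?D (p + q) = ?D p + ?D q" for p q
    by (simp only: pdiff_add distrib_left sum.distrib)
  moreover have "?D (pconst c * p) = pconst c * ?D p" for c p
    by (simp only: pdiff_pconst_mult sum_distrib_left mult.left_commute)
  moreover have "?D (p * q) = ?D p * q + p * ?D q" for p q
    by (simp only: pdiff_mult sum_distrib_left sum_distrib_right distrib_left sum.distrib mult_ac)
  ultimately show ?thesis
    unfolding derivations_def vf_def zero_ext_def
    by (intro CollectI conjI allI impI ballI; simp only: polys_in_add polys_in_mult pconst_in_polys_in if_True if_False)
qed

lemma vf_pvar: "finite V \<Longrightarrow> i \<in> V \<Longrightarrow> vf V a (pvar i) = a i"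
  by (simp add: vf_def zero_ext_def pdiff_pvar mult.commute flip: of_bool_def)

lemma derivations_eq_vf:
  assumes D: "D \<in> derivations V" and V: "finite V"
  shows "D = vf V (\<lambda>i. D (pvar i))"
  by (rule derivations_eqI[OF D vf_in_derivations]) (simp_all add: derivationsD(2)[OF D] vf_pvar[OF V])

lemma derivations_apply:
  assumes "D \<in> derivations V" "finite V" "p \<in> polys_in V"
  shows "D p = (\<Sum>i\<in>V. D (pvar i) * pdiff i p)"
proof -
  have "D p = vf V (\<lambda>i. D (pvar i)) p" by (rule fun_cong[OF derivations_eq_vf[OF assms(1,2)]])
  also have "\<dots> = (\<Sum>i\<in>V. D (pvar i) * pdiff i p)" using assms(3) by (simp add: vf_def zero_ext_def)
  finally show ?thesis .
qed

declare One_nat_def [simp del] \<comment> \<open>otherwise \<open>{1..n}\<close> becomes \<open>{Suc 0..n}\<close>\<close>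

lemma Der_simps [simp]:
  "carrier (Der V) = derivations V" "lzero (Der V) = (\<lambda>p. 0)"
  "ladd (Der V) D E = (\<lambda>p. D p + E p)" "lscale (Der V) c D = (\<lambda>p. pconst c * D p)"
  "lbracket (Der V) D E = (\<lambda>p. D (E p) - E (D p))"
  by (simp_all add: Der_def)

lemma sub_alg_simps [simp]:
  "carrier (sub_alg L U) = U" "lzero (sub_alg L U) = lzero L" "ladd (sub_alg L U) = ladd L"
  "lscale (sub_alg L U) = lscale L" "lbracket (sub_alg L U) = lbracket L"
  by (simp_all add: sub_alg_def)

lemma derivations_null: "(\<lambda>p. 0) \<in> derivations V"
  using bracket_algebra.zero_closed[OF lie_algebra.axioms(1)[OF lie_algebra_Der[of V]]] by simp

lemma derivations_add:
  "D \<in> derivations V \<Longrightarrow> E \<in> derivations V \<Longrightarrow> (\<lambda>p. D p + E p) \<in> derivations V"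
  using bracket_algebra.add_closed[OF lie_algebra.axioms(1)[OF lie_algebra_Der[of V]]] by simp

lemma derivations_scale:
  "D \<in> derivations V \<Longrightarrow> (\<lambda>p. pconst c * D p) \<in> derivations V"
  using bracket_algebra.scale_closed[OF lie_algebra.axioms(1)[OF lie_algebra_Der[of V]]] by simp

lemma derivations_subtract:
  assumes "D \<in> derivations V" "E \<in> derivations V"
  shows "(\<lambda>p. D p - E p) \<in> derivations V"
  using derivations_add[OF assms(1) derivations_scale[OF assms(2), of "-1"]] by (simp add: pconst_simps)

text \<open>The derivation \<open>g \<partial>\<^sub>k\<close>.\<close>

definition pf :: "nat set \<Rightarrow> 'k mpol \<Rightarrow> nat \<Rightarrow> 'k::field vfield" where
  "pf V g k = vf V (\<lambda>i. if i = k then g else 0)"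

lemma pf_in_derivations: "g \<in> polys_in V \<Longrightarrow> pf V g k \<in> derivations V"
  by (simp add: pf_def vf_in_derivations)

lemma pf_pvar: "finite V \<Longrightarrow> i \<in> V \<Longrightarrow> pf V g k (pvar i) = (if i = k then g else 0)"
  by (simp add: pf_def vf_pvar)

lemma pf_apply: "finite V \<Longrightarrow> k \<in> V \<Longrightarrow> p \<in> polys_in V \<Longrightarrow> pf V g k p = g * pdiff k p"
  by (simp add: pf_def vf_def zero_ext_def if_distrib[where f = "\<lambda>x. x * _"] cong: if_cong)

lemma derivations_eq_sum_pf:
  assumes D: "D \<in> derivations V" and V: "finite V"
  shows "D = (\<lambda>p. \<Sum>i\<in>V. pf V (D (pvar i)) i p)"
proof
  fix p
  show "D p = (\<Sum>i\<in>V. pf V (D (pvar i)) i p)"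
  proof (cases "p \<in> polys_in V")
    case True
    then show ?thesis by (simp add: derivations_apply[OF D V True] pf_apply V)
  next
    case False
    then show ?thesis by (simp add: derivationsD(1)[OF D] pf_def vf_def zero_ext_def)
  qed
qed

section \<open>Subspaces of derivations and descent by degree\<close>

lemma lie_subspace_DerD:
  assumes "lie_subspace N (Der V)"
  shows "D \<in> N \<Longrightarrow> D \<in> derivations V" "(\<lambda>p. 0) \<in> N"
    "D \<in> N \<Longrightarrow> E \<in> N \<Longrightarrow> (\<lambda>p. D p + E p) \<in> N" "D \<in> N \<Longrightarrow> (\<lambda>p. pconst c * D p) \<in> N"
    "D \<in> N \<Longrightarrow> E \<in> N \<Longrightarrow> (\<lambda>p. D p - E p) \<in> N"
proof -
  note N = assms[unfolded lie_subspace_def, simplified]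
  show "D \<in> N \<Longrightarrow> D \<in> derivations V" and "(\<lambda>p. 0) \<in> N"
    and a: "\<And>D E. D \<in> N \<Longrightarrow> E \<in> N \<Longrightarrow> (\<lambda>p. D p + E p) \<in> N"
    and s: "\<And>c D. D \<in> N \<Longrightarrow> (\<lambda>p. pconst c * D p) \<in> N"
    using N by auto
  show "D \<in> N \<Longrightarrow> E \<in> N \<Longrightarrow> (\<lambda>p. D p - E p) \<in> N"
    using a[OF _ s[of E "-1"], of D] by (simp add: pconst_simps)
qed

lemma lie_subspace_Der_sum:
  assumes "lie_subspace N (Der V)" "\<And>i. i \<in> S \<Longrightarrow> F i \<in> N"
  shows "(\<lambda>p. \<Sum>i\<in>S. F i p) \<in> N"
  using assms(2)
  by (induction S rule: infinite_finite_induct) (auto intro: lie_subspace_DerD[OF assms(1)])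

text \<open>Through \<open>derivations_eq_sum_pf\<close>, membership in a subspace reduces to fields
  with a single coefficient.\<close>

lemma lie_subspace_Der_memI:
  assumes "lie_subspace N (Der V)" "D \<in> derivations V" "finite V"
    and "\<And>i. i \<in> V \<Longrightarrow> pf V (D (pvar i)) i \<in> N"
  shows "D \<in> N"
  by (subst derivations_eq_sum_pf[OF assms(2,3)]) (rule lie_subspace_Der_sum[OF assms(1,4)])

text \<open>The other half of the commutator vanishes, because
  \<open>\<partial>\<^sub>i x\<^sub>j\<close> is constant and \<open>D\<close> kills
  constants.\<close>

lemma bracket_pf_one:
  assumes D: "D \<in> derivations V" and V: "finite V" "i \<in> V" "j \<in> V"
  shows "lbracket (Der V) (pf V 1 i) D (pvar j) = pdiff i (D (pvar j))"
  using V derivationsD(2)[OF D] derivations_pconst[OF D, of 1] derivations_pconst[OF D, of 0]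
  by (simp add: pf_pvar pf_apply pconst_simps pdiff_pvar)

text \<open>Bracketing with \<open>\<partial>\<^sub>i\<close> lowers the total degree of the coefficients, so a chain of such brackets
  outside \<open>S\<close> must stop.\<close>

lemma derivations_descent:
  assumes D: "D \<in> N" "D \<notin> S" and N: "N \<subseteq> derivations V" and V: "finite V"
    and ad: "\<And>i D. i \<in> V \<Longrightarrow> D \<in> N \<Longrightarrow> lbracket (Der V) (pf V 1 i) D \<in> N"
    and S: "(\<lambda>p. 0) \<in> S"
  obtains D' where "D' \<in> N" "D' \<notin> S" "\<And>i. i \<in> V \<Longrightarrow> lbracket (Der V) (pf V 1 i) D' \<in> S"
proof -
  \<comment> \<open>Here \<open>d\<close> is a strict bound on the degrees of all coefficients; for
    \<open>d = 0\<close> only the zero derivation remains, and it lies in \<open>S\<close>.\<close>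
  have "\<exists>D'\<in>N - S. \<forall>i\<in>V. lbracket (Der V) (pf V 1 i) D' \<in> S"
    if "D \<in> N" "D \<notin> S" "\<forall>j\<in>V. \<forall>m\<in>Poly_Mapping.keys (D (pvar j)). mdeg m < d" for d D
    using that
  proof (induction d arbitrary: D)
    case 0
    then have "D (pvar j) = 0" if "j \<in> V" for j using that by auto
    then have "D = (\<lambda>p. 0)"
      using 0 N by (intro derivations_eqI[of D V]) (auto simp: derivations_null)
    then show ?case using 0 S by simp
  next
    case (Suc d)
    show ?case
    proof (cases "\<forall>i\<in>V. lbracket (Der V) (pf V 1 i) D \<in> S")
      case True
      then show ?thesis using Suc.prems by blast
    next
      case False
      then obtain i where i: "i \<in> V" "lbracket (Der V) (pf V 1 i) D \<notin> S" by blast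
      have Dd: "D \<in> derivations V" using Suc.prems N by blast
      have c: "lbracket (Der V) (pf V 1 i) D (pvar j) = pdiff i (D (pvar j))" if "j \<in> V" for j
        by (rule bracket_pf_one[OF Dd V i(1) that])
      have "mdeg m < d" if "j \<in> V" "m \<in> Poly_Mapping.keys (pdiff i (D (pvar j)))" for j m
      proof -
        have "m + Poly_Mapping.single i 1 \<in> Poly_Mapping.keys (D (pvar j))"
          using that(2) by (auto simp: in_keys_iff lookup_pdiff)
        then have "mdeg (m + Poly_Mapping.single i 1) < Suc d" using Suc.prems(3) that(1) by blast
        then show ?thesis by (simp add: mdeg_add)
      qed
      then show ?thesis
        using Suc.IH[OF ad[OF i(1) Suc.prems(1)] i(2)] c by metis
    qed
  qed
  moreover have "finite (mdeg ` (\<Union>j\<in>V. Poly_Mapping.keys (D (pvar j))))" using V by simp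
  then obtain d where "\<forall>x\<in>mdeg ` (\<Union>j\<in>V. Poly_Mapping.keys (D (pvar j))). x < d"
    by (auto simp: finite_nat_set_iff_bounded)
  ultimately show thesis using that D by (metis (no_types, lifting) DiffE UN_I image_eqI)
qed

section \<open>The subalgebra \<open>m\<^sub>s\<close> and its ideal \<open>I\<^sub>s\<close>\<close>

lemma sum_split_interval:
  "s \<le> n \<Longrightarrow> (\<Sum>i=1..n. f i) = (\<Sum>i=1..s. f i) + (\<Sum>j=s+1..(n::nat). f j :: 'a::comm_monoid_add)"
  by (subst sum.union_disjoint[symmetric]) (auto intro!: sum.cong)

text \<open>The coefficients of a derivation are its values on the variables. This form, rather than
  the explicit sums, is used from here on.\<close>

lemma m_set_iff:
  assumes "s \<le> n"
  shows "D \<in> m_set n s \<longleftrightarrow> D \<in> derivations {1..n} \<and> (\<forall>i\<in>{1..s}. D (pvar i) \<in> P s)"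
proof
  assume "D \<in> m_set n s"
  then obtain f g where fg: "\<forall>i\<in>{1..s}. f i \<in> P s" "\<forall>j\<in>{s+1..n}. g j \<in> P n"
    and D: "D = zero_ext (P n) (\<lambda>p. (\<Sum>i=1..s. f i * pdiff i p) + (\<Sum>j=s+1..n. g j * pdiff j p))"
    unfolding m_set_def by blast
  let ?h = "\<lambda>i. if i \<le> s then f i else g i"
  have D: "D = vf {1..n} ?h"
    unfolding D vf_def sum_split_interval[OF assms] by (auto intro!: arg_cong2[where f = "(+)"] ext sum.cong arg_cong[where f = "zero_ext (P n)"])
  have "?h i \<in> P n" if "i \<in> {1..n}" for i
    using fg that assms by (auto intro: polys_in_mono[of "{1..s}" "{1..n}"])
  then show "D \<in> derivations {1..n} \<and> (\<forall>i\<in>{1..s}. D (pvar i) \<in> P s)"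
    using assms fg by (auto simp: D vf_pvar intro!: vf_in_derivations)
next
  assume D: "D \<in> derivations {1..n} \<and> (\<forall>i\<in>{1..s}. D (pvar i) \<in> P s)"
  then have "D = vf {1..n} (\<lambda>i. D (pvar i))" by (intro derivations_eq_vf) auto
  moreover have "\<forall>j\<in>{s+1..n}. D (pvar j) \<in> P n" using D by (blast intro: derivationsD(2))
  ultimately show "D \<in> m_set n s"
    unfolding vf_def sum_split_interval[OF assms] m_set_def using D
    by (intro CollectI exI[of _ "\<lambda>i. D (pvar i)"] conjI) auto
qed

lemma I_set_iff:
  assumes "s \<le> n"
  shows "D \<in> I_set n s \<longleftrightarrow> D \<in> derivations {1..n} \<and> (\<forall>i\<in>{1..s}. D (pvar i) = 0)"
proof
  assume "D \<in> I_set n s"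
  then obtain g where g: "\<forall>j\<in>{s+1..n}. g j \<in> P n"
    and D: "D = zero_ext (P n) (\<lambda>p. \<Sum>j=s+1..n. g j * pdiff j p)"
    unfolding I_set_def by blast
  let ?h = "\<lambda>i. if i \<le> s then 0 else g i"
  have D: "D = vf {1..n} ?h"
    unfolding D vf_def sum_split_interval[OF assms] by (auto intro!: ext sum.cong arg_cong[where f = "zero_ext (P n)"])
  then show "D \<in> derivations {1..n} \<and> (\<forall>i\<in>{1..s}. D (pvar i) = 0)"
    using assms g by (auto simp: D vf_pvar intro!: vf_in_derivations)
next
  assume D: "D \<in> derivations {1..n} \<and> (\<forall>i\<in>{1..s}. D (pvar i) = 0)"
  then have "D = vf {1..n} (\<lambda>i. D (pvar i))" by (intro derivations_eq_vf) auto
  also have "\<dots> = zero_ext (P n) (\<lambda>p. \<Sum>j=s+1..n. D (pvar j) * pdiff j p)"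
    unfolding vf_def sum_split_interval[OF assms] using D by simp
  finally have "D = zero_ext (P n) (\<lambda>p. \<Sum>j=s+1..n. D (pvar j) * pdiff j p)" .
  moreover have "\<forall>j\<in>{s+1..n}. D (pvar j) \<in> P n" using D by (blast intro: derivationsD(2))
  ultimately show "D \<in> I_set n s"
    unfolding I_set_def by (intro CollectI exI[of _ "\<lambda>j. D (pvar j)"] conjI)
qed

text \<open>The partial derivatives beyond index \<open>s\<close> vanish on \<open>P s\<close>.
  Hence elements of \<open>m_set n s\<close> preserve \<open>P s\<close>, and those of
  \<open>I_set n s\<close> kill it.\<close>

lemma derivations_apply_P:
  assumes "D \<in> derivations {1..n}" "s \<le> n" "p \<in> P s"
  shows "D p = (\<Sum>i=1..s. D (pvar i) * pdiff i p)"
proof -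
  have p: "p \<in> P n" by (rule polys_in_mono[OF _ assms(3)]) (use assms in auto)
  have "D p = (\<Sum>i=1..n. D (pvar i) * pdiff i p)"
    by (rule derivations_apply[OF assms(1) _ p]) simp
  also have "\<dots> = (\<Sum>i=1..s. D (pvar i) * pdiff i p)"
    unfolding sum_split_interval[OF assms(2)] using assms(3) by (simp add: pdiff_eq_0)
  finally show ?thesis .
qed

lemma m_set_apply:
  assumes "s \<le> n" "D \<in> m_set n s" "p \<in> P s"
  shows "D p \<in> P s"
proof -
  have D: "D \<in> derivations {1..n}" "\<forall>i\<in>{1..s}. D (pvar i) \<in> P s"
    using assms by (simp_all add: m_set_iff)
  show ?thesis
    unfolding derivations_apply_P[OF D(1) assms(1,3)] using D(2) assms(3)
    by (intro polys_in_sum polys_in_mult pdiff_polys_in) auto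
qed

lemma I_set_apply:
  assumes "s \<le> n" "D \<in> I_set n s" "p \<in> P s"
  shows "D p = 0"
proof -
  have D: "D \<in> derivations {1..n}" "\<forall>i\<in>{1..s}. D (pvar i) = 0"
    using assms by (simp_all add: I_set_iff)
  show ?thesis
    unfolding derivations_apply_P[OF D(1) assms(1,3)] using D(2) by simp
qed

lemma lie_subalgebra_m_set:
  assumes s: "s \<le> n"
  shows "lie_subalgebra (m_set n s :: 'k::field vfield set) (W n)"
  unfolding lie_subalgebra_def lie_subspace_def
proof (intro conjI ballI allI)
  fix D E :: "'k vfield" assume DE: "D \<in> m_set n s" "E \<in> m_set n s"
  then have "E (pvar i) \<in> P s" "D (pvar i) \<in> P s" if "i \<in> {1..s}" for i
    using that by (simp_all add: m_set_iff s)
  then show "lbracket (W n) D E \<in> m_set n s"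
    using DE m_set_apply[OF s DE(1)] m_set_apply[OF s DE(2)]
    by (simp add: m_set_iff s derivations_commutator polys_in_diff)
qed (auto simp: m_set_iff s derivations_null derivations_add derivations_scale polys_in_add polys_in_mult)

lemma I_set_subset_m_set: "s \<le> n \<Longrightarrow> I_set n s \<subseteq> m_set n s"
  by (auto simp: m_set_iff I_set_iff)

lemma lie_ideal_I_set:
  assumes s: "s \<le> n"
  shows "lie_ideal (I_set n s :: 'k::field vfield set) (m_alg n s)"
  unfolding lie_ideal_def lie_subspace_def
proof (intro conjI ballI allI)
  fix D E :: "'k vfield" assume DE: "D \<in> carrier (m_alg n s)" "E \<in> I_set n s"
  then have D: "D \<in> m_set n s" by simp
  have "E (pvar i) = 0" "D (pvar i) \<in> P s" if "i \<in> {1..s}" for i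
    using that D DE by (simp_all add: m_set_iff I_set_iff s)
  then show "lbracket (m_alg n s) D E \<in> I_set n s" "lbracket (m_alg n s) E D \<in> I_set n s"
    using D DE I_set_apply[OF s DE(2)]
    by (simp_all add: m_set_iff I_set_iff s derivations_commutator derivations_zero)
qed (use I_set_subset_m_set[OF s] in
    \<open>auto simp: I_set_iff s derivations_null derivations_add derivations_scale\<close>)

lemma polynomial_submodule_I_set:
  assumes "s \<le> n"
  shows "polynomial_submodule n (I_set n s)"
proof -
  have "(\<lambda>p. f * D p) \<in> derivations {1..n}" if f: "f \<in> P n" and D: "D \<in> derivations {1..n}" for f D
    unfolding derivations_def mem_Collect_eq
    using f derivationsD(2)[OF D]
    by (auto simp: derivationsD(1,3,5)[OF D] derivations_pconst[OF D] polys_in_mult algebra_simps)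
  then show ?thesis
    by (auto simp: polynomial_submodule_def I_set_iff[OF assms] derivations_null derivations_add)
qed

text \<open>The components of \<open>D\<close> beyond index \<open>s\<close> lie in
  \<open>I_set n s\<close> already, so only the first \<open>s\<close> have to be examined.\<close>

lemma subspace_above_I_set_memI:
  assumes "s \<le> n" "lie_subspace N (W n)" "I_set n s \<subseteq> N" "D \<in> derivations {1..n}"
    and "\<And>i. i \<in> {1..s} \<Longrightarrow> pf {1..n} (D (pvar i)) i \<in> N"
  shows "D \<in> N"
proof (rule lie_subspace_Der_memI[OF assms(2,4)])
  fix i assume i: "i \<in> {1..n}"
  show "pf {1..n} (D (pvar i)) i \<in> N"
  proof (cases "i \<le> s")
    case False
    then have "pf {1..n} (D (pvar i)) i \<in> I_set n s"
      using assms(1) by (auto simp: I_set_iff pf_in_derivations derivationsD(2)[OF assms(4)] pf_pvar)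
    then show ?thesis using assms(3) by blast
  qed (use i assms(5) in auto)
qed simp

section \<open>Maximality of \<open>m_set n s\<close>\<close>

lemma pf_in_m_set:
  assumes "s \<le> n" "g \<in> P n" "k \<le> s \<Longrightarrow> g \<in> P s"
  shows "pf {1..n} g k \<in> m_set n s"
  using assms by (auto simp: m_set_iff pf_in_derivations pf_pvar)

lemma maximal_subalgebra_m_set:
  assumes "1 \<le> s" "s < n"
  shows "maximal_subalgebra (m_set n s) (W n :: ('k::field_char_0, 'k vfield) bracket_alg)"
  unfolding maximal_subalgebra_def
proof (intro conjI allI impI)
  have s: "s \<le> n" using assms by simp
  show "lie_subalgebra (m_set n s) (W n :: ('k, 'k vfield) bracket_alg)"
    by (rule lie_subalgebra_m_set[OF s])
  have "pf {1..n} (pvar (s+1)) 1 \<notin> (m_set n s :: 'k vfield set)"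
    using assms by (auto simp: m_set_iff pf_pvar)
  moreover have "pf {1..n} (pvar (s+1)) 1 \<in> (derivations {1..n} :: 'k vfield set)"
    using assms by (intro pf_in_derivations) simp
  ultimately show "(m_set n s :: 'k vfield set) \<noteq> carrier (W n)" by auto
next
  have s: "s \<le> n" using assms by simp
  fix N :: "'k vfield set" assume N: "lie_subalgebra N (W n) \<and> N \<noteq> carrier (W n)"
  show "\<not> m_set n s \<subset> N"
  proof
    assume mN: "m_set n s \<subset> N"
    have subsp: "lie_subspace N (W n)" and br: "\<And>D E. D \<in> N \<Longrightarrow> E \<in> N \<Longrightarrow> (\<lambda>p. D (E p) - E (D p)) \<in> N"
      using N by (auto simp: lie_subalgebra_def)
    note Nd = lie_subspace_DerD[OF subsp]
    \<comment> \<open>Membership in \<open>N\<close> may be tested modulo \<open>m_set n s\<close>,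
      so the brackets below need to be computed only up to elements of
      \<open>m_set n s\<close>.\<close>
    have mem: "F \<in> N" if "E \<in> N" "F \<in> derivations {1..n}" "(\<lambda>p. E p - F p) \<in> m_set n s" for E F
    proof -
      have "(\<lambda>p. E p - F p) \<in> N" using that(3) mN by blast
      then show ?thesis using Nd(5)[OF that(1)] by fastforce
    qed
    obtain D0 where D0: "D0 \<in> N" "D0 \<notin> m_set n s" using mN by blast
    have ad: "lbracket (W n) (pf {1..n} 1 i) D \<in> N" if "i \<in> {1..n}" "D \<in> N" for i D
      using br[of "pf {1..n} 1 i" D] that pf_in_m_set[OF s, of 1 i] mN by auto
    obtain D where D: "D \<in> N" "D \<notin> m_set n s"
      and Dm: "\<And>i. i \<in> {1..n} \<Longrightarrow> lbracket (W n) (pf {1..n} 1 i) D \<in> m_set n s"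
      by (rule derivations_descent[OF D0 _ _ ad]) (use Nd s in \<open>auto simp: m_set_iff derivations_null\<close>)
    have Dd: "D \<in> derivations {1..n}" using Nd(1) D(1) by blast
    have dD: "pdiff i (D (pvar j)) \<in> P s" if "i \<in> {1..n}" "j \<in> {1..s}" for i j
    proof -
      have "lbracket (W n) (pf {1..n} 1 i) D (pvar j) \<in> P s"
        using Dm[OF that(1)] that(2) unfolding m_set_iff[OF s] by blast
      then show ?thesis
        using bracket_pf_one[OF Dd, of i j] that s by (simp del: Der_simps)
    qed
    obtain k where k: "k \<in> {1..s}" "D (pvar k) \<notin> P s"
      using D(2) Dd s by (auto simp: m_set_iff)
    define f where "f = D (pvar k)"
    have f: "f \<in> P n" using derivationsD(2)[OF Dd] by (simp add: f_def)
    \<comment> \<open>Otherwise \<open>f\<close> would be free of all variables beyond index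
      \<open>s\<close>, that is, in \<open>P s\<close>.\<close>
    have "\<exists>q\<in>{1..n} - {1..s}. pdiff q f \<noteq> 0"
      using polys_in_pdiff_eq_0[OF f, of "{1..s}"] k(2) unfolding f_def[symmetric] by blast
    then obtain q where q: "q \<in> {1..n}" "\<not> q \<le> s" "pdiff q f \<noteq> 0" by auto
    \<comment> \<open>For \<open>i \<le> s\<close> the polynomial \<open>pdiff i f\<close> is in
      \<open>P s\<close>, so differentiating it by the variable \<open>q > s\<close> gives 0. As
      derivatives commute, \<open>pdiff q f\<close> has no variables left.\<close>
    have "pdiff q f \<in> polys_in {}"
    proof (rule polys_in_pdiff_eq_0)
      show "pdiff q f \<in> P s" using dD q k by (simp add: f_def)
      fix i assume i: "i \<in> {1..s} - {}"
      then have "pdiff i f \<in> P s" using dD[of i k] k s by (simp add: f_def)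
      then show "pdiff i (pdiff q f) = 0"
        using q by (subst pdiff_commute) (auto intro: pdiff_eq_0)
    qed
    then obtain c where c: "pdiff q f = pconst c" using polys_in_empty by blast
    have c0: "c \<noteq> 0" using c q by auto
    \<comment> \<open>The bracket \<open>[D, x\<^sub>k \<partial>\<^sub>r]\<close> equals
      \<open>f \<partial>\<^sub>r\<close> up to the coefficients
      \<open>- x\<^sub>k \<partial>\<^sub>r (D x\<^sub>i)\<close>, which lie in \<open>P s\<close>
      for \<open>i \<le> s\<close>.\<close>
    have fN: "pf {1..n} f r \<in> N" if r: "r \<in> {1..s}" for r
    proof (rule mem)
      have x: "pvar k \<in> P s" "pvar k \<in> P n" using k s by auto
      have "pf {1..n} (pvar k) r \<in> N" using pf_in_m_set[OF s x(2) x(1)] mN by blast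
      then show E: "(\<lambda>p. D (pf {1..n} (pvar k) r p) - pf {1..n} (pvar k) r (D p)) \<in> N"
        by (rule br[OF D(1)])
      show F: "pf {1..n} f r \<in> derivations {1..n}" by (rule pf_in_derivations[OF f])
      have "D (pf {1..n} (pvar k) r (pvar i)) - pf {1..n} (pvar k) r (D (pvar i)) - pf {1..n} f r (pvar i)
        = - (pvar k * pdiff r (D (pvar i)))" if "i \<in> {1..n}" for i
        using that r s derivationsD(2)[OF Dd] derivations_pconst[OF Dd, of 0]
        by (simp add: pf_pvar pf_apply pdiff_pvar f_def)
      then show "(\<lambda>p. D (pf {1..n} (pvar k) r p) - pf {1..n} (pvar k) r (D p) - pf {1..n} f r p) \<in> m_set n s"
        using derivations_subtract[OF Nd(1)[OF E] F] s r dD x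
        by (auto simp: m_set_iff intro!: polys_in_uminus polys_in_mult)
    qed
    have gN: "pf {1..n} g r \<in> N" if r: "r \<in> {1..s}" and g: "g \<in> P n" for g r
    proof (rule mem)
      \<comment> \<open>With this scaling \<open>h \<partial>\<^sub>q f = g\<close>, so
        \<open>[h \<partial>\<^sub>q, f \<partial>\<^sub>r]\<close> has the first \<open>s\<close>
        coefficients of \<open>g \<partial>\<^sub>r\<close>; the other half of the bracket affects
        only index \<open>q > s\<close>.\<close>
      define h where "h = g * pconst (1 / c)"
      have h: "h \<in> P n" using g by (simp add: h_def polys_in_mult)
      have hc: "h * pconst c = g"
        using c0 by (simp add: h_def mult.assoc flip: pconst_simps(2)) (simp add: pconst_simps)
      have "pf {1..n} h q \<in> N" using pf_in_m_set[OF s h, of q] q mN by blast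
      then show E: "(\<lambda>p. pf {1..n} h q (pf {1..n} f r p) - pf {1..n} f r (pf {1..n} h q p)) \<in> N"
        by (rule br[OF _ fN[OF r]])
      show F: "pf {1..n} g r \<in> derivations {1..n}" by (rule pf_in_derivations[OF g])
      have "pf {1..n} h q (pf {1..n} f r (pvar i)) - pf {1..n} f r (pf {1..n} h q (pvar i))
          - pf {1..n} g r (pvar i) = 0" if "i \<in> {1..s}" for i
        using that r s q f h c hc by (auto simp: pf_pvar pf_apply pdiff_pvar)
      then show "(\<lambda>p. pf {1..n} h q (pf {1..n} f r p) - pf {1..n} f r (pf {1..n} h q p)
          - pf {1..n} g r p) \<in> m_set n s"
        using derivations_subtract[OF Nd(1)[OF E] F] s by (auto simp: m_set_iff)
    qed
    have "E \<in> N" if "E \<in> derivations {1..n}" for E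
      by (rule subspace_above_I_set_memI[OF s subsp _ that])
        (use gN mN I_set_subset_m_set[OF s] derivationsD(2)[OF that] in auto)
    then show False using N Nd(1) by auto
  qed
qed

section \<open>Classification of the ideals of \<open>m_alg n s\<close>\<close>

text \<open>For \<open>D\<close> with constant coefficients \<open>c\<^sub>i\<close>,
  \<open>[D, x\<^sub>j \<partial>\<^sub>l] = c\<^sub>j \<partial>\<^sub>l\<close>, and
  \<open>[\<partial>\<^sub>l, h \<partial>\<^sub>l] = g \<partial>\<^sub>l\<close> for an
  antiderivative \<open>h\<close> of \<open>g\<close>. \<open>U\<close> bounds the variables of
  \<open>g\<close>, \<open>T\<close> the directions \<open>l\<close>; the pairs used are
  \<open>{1..n}\<close>, \<open>{s+1..n}\<close> and \<open>{1..s}\<close>,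
  \<open>{1..s}\<close>.\<close>

lemma ideal_pf_mem:
  fixes J :: "'k::field_char_0 vfield set"
  assumes J: "lie_ideal J (m_alg n s)" and s: "s \<le> n"
    and D: "D \<in> J" and const: "\<And>i j. i \<in> {1..n} \<Longrightarrow> j \<in> {1..n} \<Longrightarrow> pdiff i (D (pvar j)) = 0"
    and j: "j \<in> U" "D (pvar j) \<noteq> 0" and U: "U \<subseteq> {1..n}" and T: "T \<subseteq> U"
    and m: "\<And>(g :: 'k mpol) l. g \<in> polys_in U \<Longrightarrow> l \<in> T \<Longrightarrow> pf {1..n} g l \<in> m_set n s"
    and g: "g \<in> polys_in U" and l: "l \<in> T"
  shows "pf {1..n} g l \<in> J"
proof -
  have Jm: "J \<subseteq> m_set n s" and br: "\<And>D E. D \<in> J \<Longrightarrow> E \<in> m_set n s \<Longrightarrow> (\<lambda>p. D (E p) - E (D p)) \<in> J"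
    and sc: "\<And>c D. D \<in> J \<Longrightarrow> (\<lambda>p. pconst c * D p) \<in> J"
    using J by (auto simp: lie_ideal_def lie_subspace_def)
  have Dd: "D \<in> derivations {1..n}" using D Jm s by (auto simp: m_set_iff)
  have "D (pvar i) \<in> polys_in {}" if "i \<in> {1..n}" for i
    by (rule polys_in_pdiff_eq_0[OF derivationsD(2)[OF Dd]]) (use const that in auto)
  then have "\<forall>i\<in>{1..n}. \<exists>c. D (pvar i) = pconst c" using polys_in_empty by blast
  then obtain c where c: "\<And>i. i \<in> {1..n} \<Longrightarrow> D (pvar i) = pconst (c i)" by metis
  have cj: "c j \<noteq> 0" using j c U by auto
  have n: "l \<in> {1..n}" "j \<in> {1..n}" "l \<in> U" using U T j l by auto
  have x: "pvar j \<in> polys_in U" using j by simp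
  have one: "pf {1..n} 1 l \<in> J"
  proof -
    have Un: "polys_in U \<subseteq> (P n :: 'k mpol set)" using polys_in_mono[OF U] by blast
    let ?E = "\<lambda>p. pconst (1 / c j) * (D (pf {1..n} (pvar j) l p) - pf {1..n} (pvar j) l (D p))"
    have "(\<lambda>p. D (pf {1..n} (pvar j) l p) - pf {1..n} (pvar j) l (D p)) \<in> J"
      by (rule br[OF D m[OF x l]])
    then have K: "?E \<in> J"
      by (rule sc)
    moreover have "?E = pf {1..n} 1 l"
    proof (rule derivations_eqI)
      show "?E \<in> derivations {1..n}"
        using K Jm s by (auto simp: m_set_iff)
      fix i assume i: "i \<in> {1..n}"
      show "?E (pvar i) = pf {1..n} 1 l (pvar i)"
        using i n cj derivations_zero[OF Dd]
        by (simp add: pf_pvar pf_apply c pdiff_pvar derivations_pconst[OF Dd] flip: pconst_simps(2))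
          (simp add: pconst_simps)
    qed (simp add: pf_in_derivations)
    ultimately show ?thesis by simp
  qed
  obtain h where h: "h \<in> polys_in U" "pdiff l h = g" using pdiff_surj[OF g n(3)] by blast
  have gh: "g \<in> P n" "h \<in> P n" using g h U polys_in_mono by blast+
  let ?E = "\<lambda>p. pf {1..n} 1 l (pf {1..n} h l p) - pf {1..n} h l (pf {1..n} 1 l p)"
  have K: "?E \<in> J"
    by (rule br[OF one m[OF h(1) l]])
  moreover have "?E = pf {1..n} g l"
    by (rule derivations_eqI)
      (use K Jm s gh h n in \<open>auto simp: m_set_iff pf_in_derivations pf_pvar pf_apply pdiff_pvar\<close>)
  ultimately show ?thesis by simp
qed

lemma nontrivial_ideal_m_alg_iff:
  assumes "1 \<le> s" "s < n"
  shows "nontrivial_ideal J (m_alg n s :: ('k::field_char_0, 'k vfield) bracket_alg) \<longleftrightarrow> J = I_set n s"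
proof
  have s: "s \<le> n" using assms by simp
  assume J: "J = I_set n s"
  \<comment> \<open>Non-triviality is witnessed by \<open>\<partial>\<^sub>n\<close>, a non-zero
    element of \<open>I_set n s\<close> as \<open>s < n\<close>, and by
    \<open>\<partial>\<^sub>1\<close>, which is outside \<open>I_set n s\<close> as
    \<open>1 \<le> s\<close>.\<close>
  have "pf {1..n} 1 n \<in> (I_set n s :: 'k vfield set)" "pf {1..n} 1 n (pvar n) = (1 :: 'k mpol)"
    using assms by (auto simp: I_set_iff pf_in_derivations pf_pvar)
  then have "J \<noteq> {\<lambda>p. 0}" using J by fastforce
  moreover have "pf {1..n} 1 1 \<in> (m_set n s :: 'k vfield set)" "pf {1..n} 1 1 \<notin> (I_set n s :: 'k vfield set)"
    using assms by (auto simp: I_set_iff m_set_iff pf_in_derivations pf_pvar)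
  then have "J \<noteq> m_set n s" using J by metis
  ultimately show "nontrivial_ideal J (m_alg n s)"
    using lie_ideal_I_set[OF s] J by (simp add: nontrivial_ideal_def)
next
  have s: "s \<le> n" using assms by simp
  assume "nontrivial_ideal J (m_alg n s :: ('k, 'k vfield) bracket_alg)"
  then have J: "lie_ideal J (m_alg n s)" and J0: "J \<noteq> {\<lambda>p. 0}" and J1: "J \<noteq> m_set n s"
    by (auto simp: nontrivial_ideal_def)
  have Jm: "J \<subseteq> m_set n s" and br: "\<And>D E. D \<in> m_set n s \<Longrightarrow> E \<in> J \<Longrightarrow> (\<lambda>p. D (E p) - E (D p)) \<in> J"
    using J by (auto simp: lie_ideal_def lie_subspace_def)
  have Jd: "D \<in> derivations {1..n}" if "D \<in> J" for D using that Jm s by (auto simp: m_set_iff)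
  have sub: "lie_subspace J (W n)"
    using J Jd by (auto simp: lie_ideal_def lie_subspace_def)
  have ad: "lbracket (W n) (pf {1..n} 1 i) D \<in> J" if "i \<in> {1..n}" "D \<in> J" for i D
    using br[of "pf {1..n} 1 i" D] that pf_in_m_set[OF s, of 1 i] by auto
  have coord: "lbracket (W n) (pf {1..n} 1 i) D (pvar j) = pdiff i (D (pvar j))"
    if "D \<in> J" "i \<in> {1..n}" "j \<in> {1..n}" for D i j
    using bracket_pf_one[OF Jd] that by blast
  \<comment> \<open>Descent with \<open>S\<close> the zero space. It is stated for any part
    \<open>K\<close> of \<open>J\<close> stable under the \<open>\<partial>\<^sub>i\<close>, because
    it is applied to \<open>J\<close> and then to a smaller set.\<close>
  have const: "\<exists>D\<in>K. (\<forall>i\<in>{1..n}. \<forall>j\<in>{1..n}. pdiff i (D (pvar j)) = 0) \<and> (\<exists>j\<in>{1..n}. D (pvar j) \<noteq> 0)"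
    if K: "K \<subseteq> J" "D \<in> K" "D \<noteq> (\<lambda>p. 0)"
      and adK: "\<And>i D. i \<in> {1..n} \<Longrightarrow> D \<in> K \<Longrightarrow> lbracket (W n) (pf {1..n} 1 i) D \<in> K" for K D
  proof -
    have Kd: "K \<subseteq> derivations {1..n}" using K Jd by blast
    obtain E where E: "E \<in> K" "E \<notin> {\<lambda>p. 0}"
      and z: "\<And>i. i \<in> {1..n} \<Longrightarrow> lbracket (W n) (pf {1..n} 1 i) E \<in> {\<lambda>p. 0}"
      by (rule derivations_descent[of D K "{\<lambda>p. 0}" "{1..n}", OF _ _ Kd _ adK]) (use K in auto)
    have "E \<in> J" using E K by blast
    then have "\<forall>i\<in>{1..n}. \<forall>j\<in>{1..n}. pdiff i (E (pvar j)) = 0"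
      using z coord by (metis singletonD)
    moreover have "\<exists>j\<in>{1..n}. E (pvar j) \<noteq> 0"
    proof (rule ccontr)
      assume "\<not> ?thesis"
      then have "E = (\<lambda>p. 0)"
        by (intro derivations_eqI[OF Jd[OF \<open>E \<in> J\<close>] derivations_null]) auto
      then show False using E by simp
    qed
    ultimately show ?thesis using E by blast
  qed
  have IJ: "I_set n s \<subseteq> J"
  proof
    fix F :: "'k vfield" assume F: "F \<in> I_set n s"
    have "(\<lambda>p. 0) \<in> J" using lie_subspace_DerD(2)[OF sub] .
    then obtain D0 where "D0 \<in> J" "D0 \<noteq> (\<lambda>p. 0)" using J0 by blast
    then obtain D j where D: "D \<in> J" "\<And>i j. i \<in> {1..n} \<Longrightarrow> j \<in> {1..n} \<Longrightarrow> pdiff i (D (pvar j)) = 0"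
      and j: "j \<in> {1..n}" "D (pvar j) \<noteq> 0"
      using const[of J D0] ad by blast
    have pfJ: "pf {1..n} g l \<in> J" if "g \<in> P n" "l \<in> {s+1..n}" for g l
      by (rule ideal_pf_mem[OF J s D j, of "{s+1..n}"]) (use that s in \<open>auto intro: pf_in_m_set\<close>)
    have Fd: "F \<in> derivations {1..n}" "\<forall>i\<in>{1..s}. F (pvar i) = 0" using F s by (auto simp: I_set_iff)
    show "F \<in> J"
    proof (rule lie_subspace_Der_memI[OF sub Fd(1)])
      fix i assume "i \<in> {1..n}"
      moreover have "pf {1..n} (0 :: 'k mpol) i = (\<lambda>p. 0)"
        by (simp add: pf_def vf_def zero_ext_def fun_eq_iff)
      ultimately show "pf {1..n} (F (pvar i)) i \<in> J"
        using pfJ[OF derivationsD(2)[OF Fd(1)]] Fd(2) lie_subspace_DerD(2)[OF sub]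
        by (cases "i \<le> s") auto
    qed simp
  qed
  moreover have "J \<subseteq> I_set n s"
  proof (rule ccontr)
    assume "\<not> J \<subseteq> I_set n s"
    then obtain D0 where D0: "D0 \<in> J" "D0 \<notin> I_set n s" by blast
    \<comment> \<open>Descent within this set makes the resulting constant field have its non-zero
      coefficient among the first \<open>s\<close>.\<close>
    define K where "K = {D \<in> J. \<forall>i\<in>{s+1..n}. D (pvar i) = 0}"
    \<comment> \<open>\<open>F\<close> is the part of \<open>D0\<close> in \<open>I_set n s\<close>;
      it belongs to \<open>J\<close> by \<open>IJ\<close>, so removing it leaves a non-zero element
      of \<open>K\<close>.\<close>
    define F where "F = vf {1..n} (\<lambda>i. if i \<le> s then 0 else D0 (pvar i))"
    have F: "F \<in> I_set n s"
      using derivationsD(2)[OF Jd[OF D0(1)]] s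
      by (auto simp: F_def I_set_iff vf_pvar intro!: vf_in_derivations)
    have DF: "(\<lambda>p. D0 p - F p) \<in> J" using lie_subspace_DerD(5)[OF sub D0(1)] F IJ by blast
    have "(\<lambda>p. D0 p - F p) \<in> K" using DF s by (auto simp: K_def F_def vf_pvar)
    moreover have "(\<lambda>p. D0 p - F p) \<noteq> (\<lambda>p. 0)"
    proof
      assume "(\<lambda>p. D0 p - F p) = (\<lambda>p. 0)"
      then have "D0 = F" by (simp add: fun_eq_iff)
      then show False using D0 F by simp
    qed
    moreover have "lbracket (W n) (pf {1..n} 1 i) D \<in> K" if "i \<in> {1..n}" "D \<in> K" for i D
      using that ad[of i D] coord[of D i] by (auto simp: K_def simp del: Der_simps)
    ultimately obtain D j where D: "D \<in> K" "\<And>i j. i \<in> {1..n} \<Longrightarrow> j \<in> {1..n} \<Longrightarrow> pdiff i (D (pvar j)) = 0"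
      and j: "j \<in> {1..n}" "D (pvar j) \<noteq> 0"
      using const[of K "\<lambda>p. D0 p - F p"] by (auto simp: K_def)
    have DJ: "D \<in> J" using D(1) by (simp add: K_def)
    have j': "j \<in> {1..s}" using j D(1) by (auto simp: K_def)
    have pfJ: "pf {1..n} g l \<in> J" if "g \<in> P s" "l \<in> {1..s}" for g l
      by (rule ideal_pf_mem[OF J s DJ D(2) j' j(2), of "{1..s}"])
        (use that s in \<open>auto intro!: pf_in_m_set elim: polys_in_mono[rotated]\<close>)
    have "E \<in> J" if E: "E \<in> m_set n s" for E
      by (rule subspace_above_I_set_memI[OF s sub IJ]) (use E s pfJ in \<open>auto simp: m_set_iff\<close>)
    then show False using Jm J1 by blast
  qed
  ultimately show "J = I_set n s" by blast
qed

section \<open>Homomorphisms, quotients and isomorphisms\<close>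

text \<open>Closure of the operations of \<open>L\<close> allows the inverse map to be cancelled on
  sums, multiples and brackets. In this generality it also covers quotients of the free tensor
  space.\<close>

lemma lie_isomorphic_sym:
  assumes add_closed: "\<And>x y. x \<in> carrier L \<Longrightarrow> y \<in> carrier L \<Longrightarrow> ladd L x y \<in> carrier L"
    and scale_closed: "\<And>c x. x \<in> carrier L \<Longrightarrow> lscale L c x \<in> carrier L"
    and bracket_closed: "\<And>x y. x \<in> carrier L \<Longrightarrow> y \<in> carrier L \<Longrightarrow> lbracket L x y \<in> carrier L"
    and iso: "L \<cong>\<^sub>L M"
  shows "M \<cong>\<^sub>L L"
proof -
  obtain \<phi> where \<phi>: "\<phi> \<in> lie_hom L M" "bij_betw \<phi> (carrier L) (carrier M)"
    using iso by (auto simp: lie_isomorphic_def)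
  define \<psi> where "\<psi> = inv_into (carrier L) \<phi>"
  have bij: "bij_betw \<psi> (carrier M) (carrier L)"
    unfolding \<psi>_def by (rule bij_betw_inv_into[OF \<phi>(2)])
  have cl: "\<psi> y \<in> carrier L" "\<phi> (\<psi> y) = y" if "y \<in> carrier M" for y
    using bij that \<phi>(2) by (auto simp: \<psi>_def bij_betw_def f_inv_into_f inv_into_into)
  have \<psi>\<phi>: "\<psi> (\<phi> x) = x" if "x \<in> carrier L" for x
    using \<phi>(2) that by (simp add: \<psi>_def bij_betw_inv_into_left)
  have "\<psi> \<in> lie_hom M L"
    unfolding lie_hom_def
  proof (intro CollectI conjI ballI allI)
    fix x y c assume xy: "x \<in> carrier M" "y \<in> carrier M"
    have "\<phi> (ladd L (\<psi> x) (\<psi> y)) = ladd M x y" "\<phi> (lbracket L (\<psi> x) (\<psi> y)) = lbracket M x y"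
      using \<phi>(1) cl xy by (simp_all add: lie_hom_def)
    then show "\<psi> (ladd M x y) = ladd L (\<psi> x) (\<psi> y)" "\<psi> (lbracket M x y) = lbracket L (\<psi> x) (\<psi> y)"
      using \<psi>\<phi>[OF add_closed[OF cl(1)[OF xy(1)] cl(1)[OF xy(2)]]]
        \<psi>\<phi>[OF bracket_closed[OF cl(1)[OF xy(1)] cl(1)[OF xy(2)]]] by simp_all
  next
    fix x c assume x: "x \<in> carrier M"
    have "\<phi> (lscale L c (\<psi> x)) = lscale M c x"
      using \<phi>(1) cl x by (simp add: lie_hom_def)
    then show "\<psi> (lscale M c x) = lscale L c (\<psi> x)" using \<psi>\<phi>[OF scale_closed[OF cl(1)[OF x], of c]] by simp
  qed (use cl in auto)
  then show ?thesis using bij by (auto simp: lie_isomorphic_def)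
qed

lemma bracket_algebra_scale_zero:
  assumes "bracket_algebra L" "x \<in> carrier L"
  shows "lscale L 0 x = lzero L"
proof -
  interpret bracket_algebra L by fact
  define z where "z = lscale L 0 x"
  have z: "z \<in> carrier L" "ladd L z z = z"
    using add_scale[OF assms(2), of 0 0] scale_closed[OF assms(2)] by (simp_all add: z_def)
  obtain w where w: "w \<in> carrier L" "ladd L z w = lzero L" using add_inverse[OF z(1)] by blast
  have "z = ladd L z (ladd L z w)"
    using add_zero[OF z(1)] w(2) add_commute[OF z(1) zero_closed] by simp
  also have "\<dots> = lzero L" using add_assoc[OF z(1) z(1) w(1)] z w by simp
  finally show ?thesis by (simp add: z_def)
qed

text \<open>First isomorphism theorem, stated for \<open>bracket_algebra\<close> so that it applies
  to the free space underlying the tensor product.\<close>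

lemma lie_quot_isomorphic:
  assumes L: "bracket_algebra L" and M: "bracket_algebra M" and \<phi>: "\<phi> \<in> lie_hom L M"
    and surj: "\<phi> ` carrier L = carrier M"
    and I: "lie_ideal I L" and ker: "I = {x \<in> carrier L. \<phi> x = lzero M}"
  shows "lie_quot L I \<cong>\<^sub>L M"
proof -
  interpret L: bracket_algebra L by (rule L)
  interpret M: bracket_algebra M by (rule M)
  have hom: "\<And>x. x \<in> carrier L \<Longrightarrow> \<phi> x \<in> carrier M"
    "\<And>x y. x \<in> carrier L \<Longrightarrow> y \<in> carrier L \<Longrightarrow> \<phi> (ladd L x y) = ladd M (\<phi> x) (\<phi> y)"
    "\<And>c x. x \<in> carrier L \<Longrightarrow> \<phi> (lscale L c x) = lscale M c (\<phi> x)"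
    "\<And>x y. x \<in> carrier L \<Longrightarrow> y \<in> carrier L \<Longrightarrow> \<phi> (lbracket L x y) = lbracket M (\<phi> x) (\<phi> y)"
    using \<phi> by (auto simp: lie_hom_def)
  have sub: "lie_subspace I L" using I by (simp add: lie_ideal_def)
  then have Ic: "\<And>i. i \<in> I \<Longrightarrow> i \<in> carrier L" "lzero L \<in> I" by (auto simp: lie_subspace_def)
  \<comment> \<open>\<open>\<phi>\<close> is constant on each coset of its kernel;
    \<open>the_elem\<close> extracts that value.\<close>
  define \<Phi> where "\<Phi> X = the_elem (\<phi> ` X)" for X
  have \<Phi>: "\<Phi> (lie_coset L I x) = \<phi> x" if x: "x \<in> carrier L" for x
  proof -
    have "\<phi> (ladd L x i) = \<phi> x" if "i \<in> I" for i
      using that x hom(2)[OF x Ic(1)[OF that]] ker M.add_commute[OF hom(1)[OF x] M.zero_closed]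
        M.add_zero[OF hom(1)[OF x]] by simp
    then have "\<phi> ` lie_coset L I x = {\<phi> x}" using Ic(2) by (auto simp: lie_coset_def image_image)
    then show ?thesis by (simp add: \<Phi>_def)
  qed
  have car: "carrier (lie_quot L I) = lie_coset L I ` carrier L" by (simp add: lie_quot_def)
  have "\<Phi> \<in> lie_hom (lie_quot L I) M"
    unfolding lie_hom_def car
    by (auto simp: \<Phi> hom L.lie_quot_add[OF I] L.lie_quot_scale[OF I] L.lie_quot_bracket[OF I]
        L.add_closed L.scale_closed L.bracket_closed)
  moreover have "inj_on \<Phi> (lie_coset L I ` carrier L)"
  proof (rule inj_onI, elim imageE)
    fix X Y x y assume XY: "\<Phi> X = \<Phi> Y" "X = lie_coset L I x" "Y = lie_coset L I y"
      and xy: "x \<in> carrier L" "y \<in> carrier L"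
    have eq: "\<phi> x = \<phi> y" using XY xy \<Phi> by simp
    \<comment> \<open>The difference \<open>x - y\<close> lies in the kernel and is absorbed by the
      coset of \<open>y\<close>.\<close>
    define z where "z = ladd L x (lscale L (-1) y)"
    have z: "z \<in> carrier L" using xy by (simp add: z_def L.add_closed L.scale_closed)
    have "\<phi> z = ladd M (lscale M 1 (\<phi> y)) (lscale M (-1) (\<phi> y))"
      using xy eq hom by (simp add: z_def M.scale_one L.scale_closed)
    also have "\<dots> = lscale M (1 + -1) (\<phi> y)" using M.add_scale[OF hom(1)[OF xy(2)], of 1 "-1"] by simp
    also have "\<dots> = lzero M" using bracket_algebra_scale_zero[OF M hom(1)[OF xy(2)]] by simp
    finally have "z \<in> I" using z ker by simp
    have "ladd L (lscale L (-1) y) y = lzero L"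
      using L.add_scale[OF xy(2), of "-1" 1] L.scale_one[OF xy(2)] bracket_algebra_scale_zero[OF L xy(2)]
      by simp
    then have "ladd L z y = x"
      using xy L.add_assoc[OF xy(1) L.scale_closed[OF xy(2), of "-1"] xy(2)] L.add_zero L.add_commute
        L.zero_closed by (simp add: z_def)
    then have "x = ladd L y z" using L.add_commute z xy by simp
    then show "X = Y" using L.lie_coset_absorb[OF sub xy(2) \<open>z \<in> I\<close>] XY by simp
  qed
  moreover have "\<Phi> ` (lie_coset L I ` carrier L) = carrier M"
    using \<Phi> surj by (auto simp: image_image)
  ultimately show ?thesis by (auto simp: lie_isomorphic_def bij_betw_def car)
qed

lemma lie_quot_closed:
  assumes L: "bracket_algebra L" and I: "lie_ideal I L"
  shows "X \<in> carrier (lie_quot L I) \<Longrightarrow> Y \<in> carrier (lie_quot L I) \<Longrightarrow>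
      ladd (lie_quot L I) X Y \<in> carrier (lie_quot L I)"
    and "X \<in> carrier (lie_quot L I) \<Longrightarrow> lscale (lie_quot L I) c X \<in> carrier (lie_quot L I)"
    and "X \<in> carrier (lie_quot L I) \<Longrightarrow> Y \<in> carrier (lie_quot L I) \<Longrightarrow>
      lbracket (lie_quot L I) X Y \<in> carrier (lie_quot L I)"
proof -
  interpret bracket_algebra L by (rule L)
  have car: "carrier (lie_quot L I) = lie_coset L I ` carrier L" by (simp add: lie_quot_def)
  show "X \<in> carrier (lie_quot L I) \<Longrightarrow> Y \<in> carrier (lie_quot L I) \<Longrightarrow>
      ladd (lie_quot L I) X Y \<in> carrier (lie_quot L I)"
    "X \<in> carrier (lie_quot L I) \<Longrightarrow> lscale (lie_quot L I) c X \<in> carrier (lie_quot L I)"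
    "X \<in> carrier (lie_quot L I) \<Longrightarrow> Y \<in> carrier (lie_quot L I) \<Longrightarrow>
      lbracket (lie_quot L I) X Y \<in> carrier (lie_quot L I)"
    unfolding car by (auto simp: lie_quot_add[OF I] lie_quot_scale[OF I] lie_quot_bracket[OF I]
        add_closed scale_closed bracket_closed)
qed

section \<open>Restriction to \<open>P\<^sub>s\<close>\<close>

text \<open>Elements of \<open>m_set n s\<close> preserve \<open>P s\<close>, so the composites in a
  bracket survive restriction; outside \<open>P s\<close> they are evaluated at 0 and
  vanish.\<close>

lemma restrict_in_lie_hom:
  assumes s: "s \<le> n"
  shows "zero_ext (P s) \<in> lie_hom (m_alg n s) (W s :: ('k::field, 'k vfield) bracket_alg)"
proof -
  have PP: "p \<in> P n" if "p \<in> P s" for p :: "'k mpol"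
    by (rule polys_in_mono[OF _ that]) (use s in auto)
  have "zero_ext (P s) D \<in> derivations {1..s}" if D: "D \<in> m_set n s" for D :: "'k vfield"
  proof -
    have Dd: "D \<in> derivations {1..n}" using D s by (simp add: m_set_iff)
    show ?thesis
      unfolding derivations_def mem_Collect_eq
      by (auto simp: zero_ext_def m_set_apply[OF s D] PP derivationsD(3,5)[OF Dd] derivations_pconst[OF Dd]
          polys_in_add polys_in_mult)
  qed
  moreover have "zero_ext (P s) (\<lambda>p. D (E p) - E (D p)) p =
      zero_ext (P s) D (zero_ext (P s) E p) - zero_ext (P s) E (zero_ext (P s) D p)"
    if DE: "D \<in> m_set n s" "E \<in> m_set n s" for D E :: "'k vfield" and p
  proof (cases "p \<in> P s")
    case True
    then show ?thesis
      using m_set_apply[OF s DE(1)] m_set_apply[OF s DE(2)] by (simp add: zero_ext_def)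
  next
    case False
    have "D 0 = 0" "E 0 = 0" using DE derivations_zero by (auto simp: m_set_iff s)
    then show ?thesis using False by (simp add: zero_ext_def)
  qed
  ultimately show ?thesis
    unfolding lie_hom_def by (auto simp: fun_eq_iff) (auto simp: zero_ext_def)
qed

lemma zero_ext_eq_zero_iff:
  assumes "s \<le> n" "D \<in> m_set n s"
  shows "zero_ext (P s) D = (\<lambda>p. 0) \<longleftrightarrow> D \<in> I_set n s"
proof
  assume z: "zero_ext (P s) D = (\<lambda>p. 0)"
  have "D (pvar i) = 0" if "i \<in> {1..s}" for i
    using fun_cong[OF z, of "pvar i"] that by (simp add: zero_ext_def)
  then show "D \<in> I_set n s" using assms by (auto simp: I_set_iff m_set_iff)
next
  assume "D \<in> I_set n s"
  then show "zero_ext (P s) D = (\<lambda>p. 0)"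
    using I_set_apply[OF assms(1) \<open>D \<in> I_set n s\<close>] by (auto simp: zero_ext_def)
qed

lemma restrict_surj:
  fixes E :: "'k::field vfield"
  assumes s: "s \<le> n" and E: "E \<in> derivations {1..s}"
  shows "\<exists>D\<in>m_set n s. zero_ext (P s) D = E"
proof -
  define D where "D = vf {1..n} (\<lambda>i. if i \<le> s then E (pvar i) else 0)"
  have PP: "p \<in> P n" if "p \<in> P s" for p :: "'k mpol"
    by (rule polys_in_mono[OF _ that]) (use s in auto)
  have D: "D \<in> m_set n s"
    using s derivationsD(2)[OF E] by (auto simp: D_def m_set_iff vf_pvar PP intro!: vf_in_derivations)
  have "zero_ext (P s) D = E"
  proof (rule derivations_eqI[OF _ E])
    show "zero_ext (P s) D \<in> derivations {1..s}"
      using restrict_in_lie_hom[OF s] D by (auto simp: lie_hom_def)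
    fix i assume "i \<in> {1..s}"
    then show "zero_ext (P s) D (pvar i) = E (pvar i)"
      using s by (simp add: zero_ext_def D_def vf_pvar)
  qed
  then show ?thesis using D by blast
qed

lemma lie_algebra_m_alg: "s \<le> n \<Longrightarrow> lie_algebra (m_alg n s)"
  by (rule lie_algebra_sub_alg[OF lie_algebra_Der lie_subalgebra_m_set])

lemma m_alg_quotient:
  assumes s: "s \<le> n"
  shows "lie_quot (m_alg n s :: ('k::field, 'k vfield) bracket_alg) (I_set n s) \<cong>\<^sub>L W s"
proof (rule lie_quot_isomorphic)
  show "bracket_algebra (m_alg n s :: ('k::field, 'k vfield) bracket_alg)"
    by (rule lie_algebra.axioms(1)[OF lie_algebra_m_alg[OF s]])
  show "bracket_algebra (W s :: ('k::field, 'k vfield) bracket_alg)"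
    by (rule lie_algebra.axioms(1)[OF lie_algebra_Der])
  show "zero_ext (P s) \<in> lie_hom (m_alg n s) (W s :: ('k::field, 'k vfield) bracket_alg)"
    by (rule restrict_in_lie_hom[OF s])
  then show "zero_ext (P s) ` carrier (m_alg n s) = carrier (W s :: ('k::field, 'k vfield) bracket_alg)"
  proof (intro equalityI subsetI)
    fix E :: "'k vfield" assume "E \<in> carrier (W s)"
    then show "E \<in> zero_ext (P s) ` carrier (m_alg n s)" using restrict_surj[OF s, of E] by auto
  qed (auto simp: lie_hom_def)
  show "lie_ideal (I_set n s) (m_alg n s :: ('k::field, 'k vfield) bracket_alg)"
    by (rule lie_ideal_I_set[OF s])
  show "I_set n s = {D \<in> carrier (m_alg n s). zero_ext (P s) D = lzero (W s :: ('k::field, 'k vfield) bracket_alg)}"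
    using zero_ext_eq_zero_iff[OF s] I_set_subset_m_set[OF s] by auto
qed

section \<open>Bounding the number of commuting Euler fields\<close>

text \<open>Gaussian elimination without division, by induction on the columns \<open>T\<close>. The
  coefficients stay in a subring \<open>A\<close>, later \<open>polys_in V\<close>.\<close>

lemma linear_relation_exists:
  fixes a :: "'i \<Rightarrow> 'j \<Rightarrow> 'r::idom"
  assumes "finite T" "finite S" "card T < card S"
    and A: "0 \<in> A" "1 \<in> A" "\<And>x y. x \<in> A \<Longrightarrow> y \<in> A \<Longrightarrow> x + y \<in> A"
      "\<And>x y. x \<in> A \<Longrightarrow> y \<in> A \<Longrightarrow> x * y \<in> A" "\<And>x. x \<in> A \<Longrightarrow> - x \<in> A"
    and "\<And>i j. i \<in> S \<Longrightarrow> j \<in> T \<Longrightarrow> a i j \<in> A"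
  shows "\<exists>c. (\<forall>i\<in>S. c i \<in> A) \<and> (\<exists>i\<in>S. c i \<noteq> 0) \<and> (\<forall>j\<in>T. (\<Sum>i\<in>S. c i * a i j) = 0)"
  using assms(1-3,9)
proof (induction T arbitrary: S a rule: finite_induct)
  case empty
  then have "S \<noteq> {}" by auto
  then show ?case using A by (intro exI[of _ "\<lambda>_. 1"]) auto
next
  case (insert t T)
  show ?case
  proof (cases "\<forall>i\<in>S. a i t = 0")
    case True
    have "card T < card S" using insert by simp
    then obtain c where "(\<forall>i\<in>S. c i \<in> A) \<and> (\<exists>i\<in>S. c i \<noteq> 0) \<and> (\<forall>j\<in>T. (\<Sum>i\<in>S. c i * a i j) = 0)"
      using insert.IH[of S a] insert.prems by auto
    then show ?thesis using True by (intro exI[of _ c]) simp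
  next
    case False
    then obtain z where z: "z \<in> S" "a z t \<noteq> 0" by blast
    \<comment> \<open>Cross-multiplication with the pivot row \<open>z\<close>, which clears column
      \<open>t\<close>.\<close>
    let ?b = "\<lambda>i j. a z t * a i j - a i t * a z j"
    have Adiff: "x - y \<in> A" if "x \<in> A" "y \<in> A" for x y
      using A(3)[OF that(1) A(5)[OF that(2)]] by simp
    have "card T < card (S - {z})" using insert z by simp
    moreover have "?b i j \<in> A" if "i \<in> S - {z}" "j \<in> T" for i j
      using that insert.prems(3) z A by (auto intro!: Adiff)
    ultimately obtain c where c: "\<forall>i\<in>S-{z}. c i \<in> A" "\<exists>i\<in>S-{z}. c i \<noteq> 0"
      "\<forall>j\<in>T. (\<Sum>i\<in>S-{z}. c i * ?b i j) = 0"
      using insert.IH[of "S - {z}" ?b] insert.prems by auto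
    \<comment> \<open>Back substitution: the relation is scaled by the pivot, and its entry at
      \<open>z\<close> is chosen so that column \<open>t\<close> cancels.\<close>
    define d where "d i = (if i = z then - (\<Sum>i\<in>S-{z}. c i * a i t) else a z t * c i)" for i
    have cA: "(\<Sum>i\<in>U. c i * a i t) \<in> A" if "U \<subseteq> S - {z}" for U
      using that c(1) insert.prems(3) A
      by (induction U rule: infinite_finite_induct) auto
    have "d i \<in> A" if "i \<in> S" for i
      using that c(1) insert.prems(3) z A cA by (auto simp: d_def)
    moreover have "\<exists>i\<in>S. d i \<noteq> 0" using c(2) z by (auto simp: d_def)
    moreover have "(\<Sum>i\<in>S. d i * a i j) = 0" if j: "j \<in> insert t T" for j
    proof -
      have "(\<Sum>i\<in>S. d i * a i j) = d z * a z j + (\<Sum>i\<in>S-{z}. d i * a i j)"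
        using insert.prems z by (simp add: sum.remove)
      also have "\<dots> = (\<Sum>i\<in>S-{z}. c i * ?b i j)"
        by (simp add: d_def sum_distrib_left sum_distrib_right sum_subtractf algebra_simps)
      also have "\<dots> = 0" using c(3) j by (auto simp: mult.commute)
      finally show ?thesis .
    qed
    ultimately show ?thesis by blast
  qed
qed

text \<open>Model: \<open>h\<^sub>i = x\<^sub>i \<partial>\<^sub>i\<close>, \<open>e\<^sub>i = \<partial>\<^sub>i\<close>. If there are more \<open>h\<^sub>i\<close> than variables, take a relation
  \<open>\<Sum>a\<^sub>i h\<^sub>i = 0\<close> over the polynomial ring of minimal support, with \<open>a\<^sub>z \<noteq> 0\<close>. Its bracket with \<open>e\<^sub>z\<close>
  gives \<open>a\<^sub>z\<^sup>2 e\<^sub>z = \<Sum>B\<^sub>i h\<^sub>i\<close> over \<open>i \<noteq> z\<close>. As the \<open>h\<^sub>i\<close> with \<open>i \<noteq> z\<close> are independent, bracketing with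
  \<open>h\<^sub>j\<close> shows that \<open>B\<^sub>i / a\<^sub>z\<^sup>2\<close> is an eigenvector of every \<open>h\<^sub>j\<close>, of eigenvalue \<open>-1\<close> for \<open>j = z\<close> and
  \<open>0\<close> otherwise; applying \<open>\<Sum>a\<^sub>j h\<^sub>j = 0\<close> to it yields \<open>a\<^sub>z B\<^sub>i = 0\<close>, hence \<open>e\<^sub>z = 0\<close>.\<close>

lemma euler_fields_bound:
  fixes h e :: "'i \<Rightarrow> 'k::field_char_0 vfield"
  assumes V: "finite V" and S: "finite S"
    and h: "\<And>i. i \<in> S \<Longrightarrow> h i \<in> derivations V" and e: "\<And>i. i \<in> S \<Longrightarrow> e i \<in> derivations V"
    and e0: "\<And>i. i \<in> S \<Longrightarrow> e i \<noteq> (\<lambda>p. 0)"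
    and hh: "\<And>i j p. i \<in> S \<Longrightarrow> j \<in> S \<Longrightarrow> h i (h j p) = h j (h i p)"
    and eh: "\<And>i j p. i \<in> S \<Longrightarrow> j \<in> S \<Longrightarrow> e i (h j p) - h j (e i p) = (if i = j then e i p else 0)"
  shows "card S \<le> card V"
proof (rule ccontr)
  assume "\<not> card S \<le> card V"
  \<comment> \<open>Linear dependence of the operators \<open>h i\<close> over the ring
    \<open>polys_in V\<close>.\<close>
  define dep where "dep U \<longleftrightarrow> (\<exists>a. (\<forall>i\<in>U. a i \<in> polys_in V) \<and> (\<exists>i\<in>U. a i \<noteq> 0) \<and>
    (\<forall>p\<in>polys_in V. (\<Sum>i\<in>U. a i * h i p) = 0))" for U
  have "dep S"
  \<comment> \<open>There are more \<open>h i\<close> than coordinates, so their coordinate vectors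
    are dependent; a relation on the variables extends to all polynomials.\<close>
  proof -
    have "\<exists>c. (\<forall>i\<in>S. c i \<in> polys_in V) \<and> (\<exists>i\<in>S. c i \<noteq> 0) \<and>
        (\<forall>j\<in>V. (\<Sum>i\<in>S. c i * h i (pvar j)) = 0)"
      by (rule linear_relation_exists)
        (use V S h \<open>\<not> card S \<le> card V\<close> in
          \<open>auto intro: polys_in_add polys_in_mult polys_in_uminus derivationsD(2)\<close>)
    then obtain c where c: "\<forall>i\<in>S. c i \<in> polys_in V" "\<exists>i\<in>S. c i \<noteq> 0"
      "\<forall>j\<in>V. (\<Sum>i\<in>S. c i * h i (pvar j)) = 0" by blast
    have "(\<Sum>i\<in>S. c i * h i p) = 0" if "p \<in> polys_in V" for p
    proof -
      have "(\<Sum>i\<in>S. c i * h i p) = (\<Sum>i\<in>S. \<Sum>j\<in>V. c i * h i (pvar j) * pdiff j p)"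
        using derivations_apply[OF h V that] by (simp add: sum_distrib_left mult.assoc)
      also have "\<dots> = (\<Sum>j\<in>V. (\<Sum>i\<in>S. c i * h i (pvar j)) * pdiff j p)"
        by (subst sum.swap) (simp add: sum_distrib_right)
      also have "\<dots> = 0" using c(3) by simp
      finally show ?thesis .
    qed
    then show ?thesis using c unfolding dep_def by blast
  qed
  then have "\<exists>U. (U \<subseteq> S \<and> dep U) \<and> (\<forall>U'. U' \<subseteq> S \<and> dep U' \<longrightarrow> card U \<le> card U')"
    by (intro ex_has_least_nat[where k = S]) simp
  then obtain U where U: "U \<subseteq> S" "dep U" and least: "\<And>U'. U' \<subseteq> S \<Longrightarrow> dep U' \<Longrightarrow> card U \<le> card U'"
    by metis
  have fU: "finite U" using U S finite_subset by blast
  have min: "\<not> dep U'" if "U' \<subset> U" for U'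
    using least[of U'] psubset_card_mono[OF fU that] that U by auto
  obtain a where a: "\<And>i. i \<in> U \<Longrightarrow> a i \<in> polys_in V" and rel: "\<And>p. p \<in> polys_in V \<Longrightarrow> (\<Sum>i\<in>U. a i * h i p) = 0"
    and "\<exists>z\<in>U. a z \<noteq> 0"
    using U(2) unfolding dep_def by blast
  then obtain z where z: "z \<in> U" "a z \<noteq> 0" by blast
  have zS: "z \<in> S" and US: "\<And>i. i \<in> U \<Longrightarrow> i \<in> S" using z U by auto
  define Q where "Q = a z * a z"
  \<comment> \<open>These coefficients eliminate \<open>h z\<close> between the relation and its
    bracket with \<open>e z\<close>; indeed \<open>B z = 0\<close>.\<close>
  define B where "B i = e z (a z) * a i - a z * e z (a i)" for i
  note hcl = derivationsD(2)[OF h] and ecl = derivationsD(2)[OF e[OF zS]]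
  have QP: "Q \<in> polys_in V" using a z by (simp add: Q_def polys_in_mult)
  have BP: "B i \<in> polys_in V" if "i \<in> U" for i
    using a[OF that] a[OF z(1)] ecl by (simp add: B_def polys_in_mult polys_in_diff)
  have esum: "D (sum f T) = (\<Sum>i\<in>T. D (f i))" if "D \<in> derivations V" "finite T" "\<And>i. i \<in> T \<Longrightarrow> f i \<in> polys_in V"
    for D :: "'k vfield" and f :: "'i \<Rightarrow> 'k mpol" and T
    using that(2,3)
    by (induction T rule: finite_induct) (auto simp: derivations_zero[OF that(1)] derivationsD(3)[OF that(1)] polys_in_sum)
  have 1: "(\<Sum>i\<in>U. e z (a i) * h i p) + a z * e z p = 0" if p: "p \<in> polys_in V" for p
  proof -
    have "0 = e z (\<Sum>i\<in>U. a i * h i p) - (\<Sum>i\<in>U. a i * h i (e z p))"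
      using rel[OF p] rel[OF ecl, of p] derivations_zero[OF e[OF zS]] by simp
    also have "e z (\<Sum>i\<in>U. a i * h i p) = (\<Sum>i\<in>U. e z (a i) * h i p + a i * e z (h i p))"
      using a hcl[OF US] by (simp add: esum[OF e[OF zS] fU] polys_in_mult derivationsD(5)[OF e[OF zS]])
    also have "\<dots> - (\<Sum>i\<in>U. a i * h i (e z p)) = (\<Sum>i\<in>U. e z (a i) * h i p + a i * (e z (h i p) - h i (e z p)))"
      by (simp add: sum_subtractf[symmetric] algebra_simps)
    also have "\<dots> = (\<Sum>i\<in>U. e z (a i) * h i p) + (\<Sum>i\<in>U. if i = z then a z * e z p else 0)"
      unfolding sum.distrib[symmetric] by (rule sum.cong[OF refl]) (use eh[OF zS US] in auto)
    finally show ?thesis using z fU by simp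
  qed
  have 2: "Q * e z p = (\<Sum>i\<in>U-{z}. B i * h i p)" if p: "p \<in> polys_in V" for p
  proof -
    have "a z * (a z * e z p) = - (\<Sum>i\<in>U. a z * (e z (a i) * h i p))"
      using 1[OF p] by (simp add: eq_neg_iff_add_eq_0 add.commute flip: sum_distrib_left distrib_left)
    also have "\<dots> = (\<Sum>i\<in>U. e z (a z) * (a i * h i p)) - (\<Sum>i\<in>U. a z * (e z (a i) * h i p))"
      using rel[OF p] by (simp flip: sum_distrib_left)
    also have "\<dots> = (\<Sum>i\<in>U. B i * h i p)"
      by (simp add: B_def sum_subtractf[symmetric] algebra_simps)
    also have "\<dots> = (\<Sum>i\<in>U-{z}. B i * h i p)"
      using fU z by (simp add: sum.remove B_def mult.commute)
    finally show ?thesis by (simp add: Q_def mult.assoc)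
  qed
  \<comment> \<open>The eigenvector equation for \<open>B i / Q\<close>, with denominators
    cleared.\<close>
  have 3: "(h j Q - (if j = z then Q else 0)) * B i = Q * h j (B i)" if j: "j \<in> U" and i: "i \<in> U - {z}" for i j
  proof (rule ccontr)
    assume ne: "\<not> ?thesis"
    \<comment> \<open>If \<open>3\<close> failed, these would be the coefficients of a non-trivial
      relation supported on \<open>U - {z}\<close>, against the minimality of
      \<open>U\<close>.\<close>
    define b where "b i = (h j Q - (if j = z then Q else 0)) * B i - Q * h j (B i)" for i
    have "(\<Sum>i\<in>U-{z}. b i * h i p) = 0" if p: "p \<in> polys_in V" for p
    proof -
      note hj = h[OF US[OF j]]
      have "h j (Q * e z p) = (\<Sum>i\<in>U-{z}. h j (B i) * h i p + B i * h i (h j p))"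
      proof -
        have "h j (Q * e z p) = (\<Sum>i\<in>U-{z}. h j (B i * h i p))"
          unfolding 2[OF p] by (rule esum[OF hj]) (use fU in \<open>auto intro: polys_in_mult BP hcl US\<close>)
        also have "\<dots> = (\<Sum>i\<in>U-{z}. h j (B i) * h i p + B i * h i (h j p))"
          using j by (intro sum.cong refl) (simp add: derivationsD(5)[OF hj BP hcl[OF US]] hh[OF US US])
        finally show ?thesis .
      qed
      moreover have "h j (Q * e z p) = h j Q * e z p + Q * (e z (h j p) - (if j = z then e z p else 0))"
        using eh[OF zS US[OF j], of p] by (auto simp: derivationsD(5)[OF hj QP ecl] algebra_simps)
      ultimately have "(h j Q - (if j = z then Q else 0)) * e z p = (\<Sum>i\<in>U-{z}. h j (B i) * h i p)"
        using 2[OF derivationsD(2)[OF hj], of p] by (auto simp: sum.distrib algebra_simps)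
      then have "(h j Q - (if j = z then Q else 0)) * (Q * e z p) = Q * (\<Sum>i\<in>U-{z}. h j (B i) * h i p)"
        by (simp add: mult.left_commute)
      moreover have "(\<Sum>i\<in>U-{z}. b i * h i p) = (h j Q - (if j = z then Q else 0)) * (\<Sum>i\<in>U-{z}. B i * h i p)
          - Q * (\<Sum>i\<in>U-{z}. h j (B i) * h i p)"
        unfolding b_def sum_distrib_left sum_subtractf[symmetric] by (simp only: left_diff_distrib mult.assoc)
      ultimately show ?thesis unfolding 2[OF p] by simp
    qed
    moreover have "b i \<in> polys_in V" if "i \<in> U - {z}" for i
      using that BP QP hcl[OF US[OF j]] by (auto simp: b_def intro!: polys_in_diff polys_in_mult)
    moreover have "b i \<noteq> 0" using ne by (simp add: b_def)
    ultimately have "dep (U - {z})" using i unfolding dep_def by blast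
    then show False using min[of "U - {z}"] z by blast
  qed
  have "B i = 0" if i: "i \<in> U - {z}" for i
  proof -
    \<comment> \<open>The relation is applied to \<open>B i\<close>, rewritten by \<open>3\<close>,
      and then applied to \<open>Q\<close>; only the term \<open>j = z\<close> is left over.\<close>
    have "0 = Q * (\<Sum>j\<in>U. a j * h j (B i))" using rel[OF BP, of i] i by simp
    also have "\<dots> = (\<Sum>j\<in>U. a j * (Q * h j (B i)))"
      by (simp add: sum_distrib_left mult.left_commute)
    also have "\<dots> = (\<Sum>j\<in>U. a j * ((h j Q - (if j = z then Q else 0)) * B i))"
      using 3[OF _ i] by simp
    also have "\<dots> = (\<Sum>j\<in>U. a j * h j Q) * B i - (\<Sum>j\<in>U. if j = z then a z * Q * B i else 0)"
      unfolding sum_distrib_right sum_subtractf[symmetric]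
      by (rule sum.cong[OF refl]) (auto simp: algebra_simps)
    also have "\<dots> = - (a z * Q * B i)" using rel[OF QP] z fU by simp
    finally show ?thesis using z by (auto simp: Q_def)
  qed
  then have "Q * e z p = 0" if "p \<in> polys_in V" for p using 2[OF that] by simp
  then have "e z p = 0" for p
    using z derivationsD(1)[OF e[OF zS]] by (cases "p \<in> polys_in V") (auto simp: Q_def)
  then show False using e0[OF zS] by auto
qed

section \<open>The tensor product decomposition of \<open>I\<^sub>s\<close>\<close>

text \<open>For \<open>D\<close> a derivation in the variables \<open>s+1..n\<close>, this is its
  \<open>P s\<close>-linear extension to \<open>P n\<close>.\<close>

definition extend_der :: "nat \<Rightarrow> nat \<Rightarrow> 'k::field vfield \<Rightarrow> 'k vfield" where
  "extend_der n s D = vf {1..n} (\<lambda>i. if i \<le> s then 0 else D (pvar i))"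

text \<open>The map \<open>a \<otimes> D \<mapsto> a D\<close>, on the free space before passing to the tensor product.\<close>

definition tensor_eval :: "nat \<Rightarrow> nat \<Rightarrow> (('k mpol \<times> 'k vfield) \<Rightarrow>\<^sub>0 'k) \<Rightarrow> 'k::field vfield" where
  "tensor_eval n s u = (\<lambda>p. \<Sum>x\<in>Poly_Mapping.keys u.
     pconst (Poly_Mapping.lookup u x) * (fst x * extend_der n s (snd x) p))"

definition restrict_exponent :: "nat set \<Rightarrow> (nat \<Rightarrow>\<^sub>0 nat) \<Rightarrow> (nat \<Rightarrow>\<^sub>0 nat)" where
  "restrict_exponent U m = Poly_Mapping.mapp (\<lambda>i k. if i \<in> U then k else 0) m"

text \<open>A section of the previous map: \<open>x\<^sup>l x\<^sup>m \<partial>\<^sub>j \<mapsto> x\<^sup>l \<otimes> x\<^sup>m \<partial>\<^sub>j\<close> for monomials \<open>x\<^sup>l\<close> in the variables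
  from \<open>U\<close> and \<open>x\<^sup>m\<close> in those from \<open>V\<close>.\<close>

definition tensor_split ::
  "nat set \<Rightarrow> nat set \<Rightarrow> nat \<Rightarrow> 'k mpol \<Rightarrow> ('k mpol \<times> 'k vfield) \<Rightarrow>\<^sub>0 'k::field" where
  "tensor_split U V j g = (\<Sum>m\<in>Poly_Mapping.keys g.
     Poly_Mapping.single (Poly_Mapping.single (restrict_exponent U m) 1,
       pf V (Poly_Mapping.single (restrict_exponent V m) 1) j) (Poly_Mapping.lookup g m))"

section \<open>Splitting monomials into two blocks of variables\<close>

lemma lookup_restrict_exponent:
  "Poly_Mapping.lookup (restrict_exponent U m) i = (if i \<in> U then Poly_Mapping.lookup m i else 0)"
  by (simp add: restrict_exponent_def lookup_mapp when_def in_keys_iff)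

lemma keys_restrict_exponent: "Poly_Mapping.keys (restrict_exponent U m) = Poly_Mapping.keys m \<inter> U"
  by (auto simp: in_keys_iff lookup_restrict_exponent split: if_splits)

lemma restrict_exponent_decompose:
  assumes "U \<inter> V = {}" "Poly_Mapping.keys m \<subseteq> U \<union> V"
  shows "restrict_exponent U m + restrict_exponent V m = m"
proof (rule poly_mapping_eqI)
  fix i
  have "Poly_Mapping.lookup m i = 0" if "i \<notin> U \<union> V"
    using that assms(2) by (meson in_keys_iff subsetD)
  then show "Poly_Mapping.lookup (restrict_exponent U m + restrict_exponent V m) i = Poly_Mapping.lookup m i"
    using assms(1) by (auto simp: lookup_add lookup_restrict_exponent)
qed

lemma restrict_exponent_add:
  assumes "U \<inter> V = {}" "Poly_Mapping.keys l \<subseteq> U" "Poly_Mapping.keys m \<subseteq> V"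
  shows "restrict_exponent U (l + m) = l" "restrict_exponent V (l + m) = m"
proof -
  have z: "Poly_Mapping.lookup l i = 0" if "i \<notin> U" for i
    using that assms by (auto simp: in_keys_iff)
  have z': "Poly_Mapping.lookup m i = 0" if "i \<notin> V" for i
    using that assms by (auto simp: in_keys_iff)
  have d: "i \<in> U \<Longrightarrow> i \<notin> V" "i \<in> V \<Longrightarrow> i \<notin> U" for i
    using assms(1) by auto
  show "restrict_exponent U (l + m) = l" "restrict_exponent V (l + m) = m"
    using z z' d
    by (auto intro!: poly_mapping_eqI simp: lookup_restrict_exponent lookup_add)
qed

text \<open>A common finite index set lets sums over different supports be compared term by
  term.\<close>

lemma tensor_split_superset:
  assumes "finite S" "Poly_Mapping.keys g \<subseteq> S"
  shows "tensor_split U V j g = (\<Sum>m\<in>S.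
     Poly_Mapping.single (Poly_Mapping.single (restrict_exponent U m) 1,
       pf V (Poly_Mapping.single (restrict_exponent V m) 1) j) (Poly_Mapping.lookup g m))"
  unfolding tensor_split_def
  by (rule sum.mono_neutral_left) (use assms in \<open>auto simp: in_keys_iff\<close>)

lemma tensor_split_add: "tensor_split U V j (g + h) = tensor_split U V j g + tensor_split U V j h"
proof -
  let ?S = "Poly_Mapping.keys g \<union> Poly_Mapping.keys h"
  have "Poly_Mapping.keys (g + h) \<subseteq> ?S" by (rule Poly_Mapping.keys_add)
  then show ?thesis
    by (simp add: tensor_split_superset[where S = ?S] lookup_add single_add sum.distrib)
qed

lemma tensor_split_zero [simp]: "tensor_split U V j 0 = 0"
  by (simp add: tensor_split_def)

lemma tensor_split_sum: "tensor_split U V j (sum f S) = (\<Sum>x\<in>S. tensor_split U V j (f x))"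
  by (induction S rule: infinite_finite_induct) (simp_all add: tensor_split_add)

lemma tensor_split_scale: "tensor_split U V j (pconst c * g) = pm_scale c (tensor_split U V j g)"
proof -
  have "Poly_Mapping.keys (pconst c * g) \<subseteq> Poly_Mapping.keys g"
    by (auto simp: in_keys_iff lookup_pconst_mult)
  then show ?thesis
    by (simp add: tensor_split_superset[where S = "Poly_Mapping.keys g"] pm_scale_sum lookup_pconst_mult)
qed

lemma tensor_split_single:
  "tensor_split U V j (Poly_Mapping.single m c) =
    Poly_Mapping.single (Poly_Mapping.single (restrict_exponent U m) 1,
       pf V (Poly_Mapping.single (restrict_exponent V m) 1) j) c"
  by (simp add: tensor_split_superset[where S = "{m}"])

lemma free_tensor_simps [simp]:
  "carrier (free_tensor A L) = {u. Poly_Mapping.keys u \<subseteq> A \<times> carrier L}"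
  "lzero (free_tensor A L) = 0" "ladd (free_tensor A L) = (+)" "lscale (free_tensor A L) = pm_scale"
  by (simp_all add: free_tensor_def)

context
  fixes n s :: nat assumes s: "s \<le> n"
begin

private abbreviation (input) "V \<equiv> {s+1..n}"

private lemma UV: "{1..s} \<inter> V = {}" "{1..s} \<union> V = {1..n}" "V \<subseteq> {1..n}"
  using s by auto

private lemma P_mono: "p \<in> P s \<Longrightarrow> p \<in> P n" "p \<in> polys_in V \<Longrightarrow> p \<in> P n"
  using polys_in_mono UV by (metis sup_ge1, metis sup_ge2)

private abbreviation (input) FT :: "('k::field, ('k mpol \<times> 'k vfield) \<Rightarrow>\<^sub>0 'k) bracket_alg" where
  "FT \<equiv> free_tensor (P s) (Der V)"

private abbreviation (input) N :: "(('k::field mpol \<times> 'k vfield) \<Rightarrow>\<^sub>0 'k) set" where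
  "N \<equiv> lie_span FT (tensor_relations (P s) (Der V))"

private abbreviation (input) e :: "'k::field mpol \<Rightarrow> 'k vfield \<Rightarrow> ('k mpol \<times> 'k vfield) \<Rightarrow>\<^sub>0 'k" where
  "e a D \<equiv> Poly_Mapping.single (a, D) 1"

section \<open>Extending derivations from the last variables\<close>

lemma extend_der_in_derivations:
  assumes "D \<in> derivations V"
  shows "extend_der n s D \<in> derivations {1..n}"
  unfolding extend_der_def using assms
  by (auto intro!: vf_in_derivations P_mono dest: derivationsD(2))

lemma extend_der_pvar: "i \<in> {1..n} \<Longrightarrow> extend_der n s D (pvar i) = (if i \<le> s then 0 else D (pvar i))"
  by (simp add: extend_der_def vf_pvar)

lemma extend_der_in_I_set: "D \<in> derivations V \<Longrightarrow> extend_der n s D \<in> I_set n s"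
  using extend_der_in_derivations s by (simp add: I_set_iff extend_der_pvar)

text \<open>Linearity over \<open>P s\<close> holds because the extension kills \<open>P s\<close>;
  it is what makes \<open>a \<otimes> D \<mapsto> a D\<close> compatible with brackets.\<close>

lemma extend_der_mult_P:
  assumes "D \<in> derivations V" "b \<in> P s" "p \<in> P n"
  shows "extend_der n s D (b * p) = b * extend_der n s D p"
  using derivationsD(5)[OF extend_der_in_derivations[OF assms(1)] P_mono(1)[OF assms(2)] assms(3)]
    I_set_apply[OF s extend_der_in_I_set[OF assms(1)] assms(2)] by simp

lemma extend_der_apply:
  assumes D: "D \<in> derivations V" and p: "p \<in> polys_in V"
  shows "extend_der n s D p = D p"
proof -
  have "extend_der n s D p = (\<Sum>i=1..n. extend_der n s D (pvar i) * pdiff i p)"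
    by (rule derivations_apply[OF extend_der_in_derivations[OF D] _ P_mono(2)[OF p]]) simp
  also have "\<dots> = (\<Sum>i\<in>V. D (pvar i) * pdiff i p)"
    unfolding sum_split_interval[OF s] using s by (simp add: extend_der_pvar)
  also have "\<dots> = D p" using derivations_apply[OF D _ p] by simp
  finally show ?thesis .
qed

lemma extend_der_add:
  assumes "D \<in> derivations V" "E \<in> derivations V"
  shows "extend_der n s (\<lambda>p. D p + E p) = (\<lambda>p. extend_der n s D p + extend_der n s E p)"
  by (rule derivations_eqI[of _ "{1..n}"])
    (use assms in \<open>auto simp: extend_der_pvar intro!: extend_der_in_derivations derivations_add\<close>)

lemma extend_der_scale:
  assumes "D \<in> derivations V"
  shows "extend_der n s (\<lambda>p. pconst c * D p) = (\<lambda>p. pconst c * extend_der n s D p)"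
  by (rule derivations_eqI[of _ "{1..n}"])
    (use assms in \<open>auto simp: extend_der_pvar intro!: extend_der_in_derivations derivations_scale\<close>)

lemma extend_der_bracket:
  assumes D: "D \<in> derivations V" and E: "E \<in> derivations V"
  shows "extend_der n s (\<lambda>p. D (E p) - E (D p)) =
    (\<lambda>p. extend_der n s D (extend_der n s E p) - extend_der n s E (extend_der n s D p))"
proof (rule derivations_eqI[of _ "{1..n}"])
  fix i assume i: "i \<in> {1..n}"
  show "extend_der n s (\<lambda>p. D (E p) - E (D p)) (pvar i) =
      extend_der n s D (extend_der n s E (pvar i)) - extend_der n s E (extend_der n s D (pvar i))"
    using i derivations_zero[OF extend_der_in_derivations[OF D]] derivations_zero[OF extend_der_in_derivations[OF E]]
    by (simp add: extend_der_pvar extend_der_apply[OF D derivationsD(2)[OF E]] extend_der_apply[OF E derivationsD(2)[OF D]])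
qed (use D E in \<open>auto intro!: extend_der_in_derivations derivations_commutator\<close>)

lemma extend_der_pf:
  assumes "g \<in> polys_in V" "j \<in> V"
  shows "extend_der n s (pf V g j) = pf {1..n} g j"
  by (rule derivations_eqI[of _ "{1..n}"])
    (use assms in \<open>auto simp: extend_der_pvar pf_pvar P_mono intro!: extend_der_in_derivations pf_in_derivations\<close>)

section \<open>The evaluation map on the free space\<close>

lemma tensor_eval_superset:
  assumes "finite S" "Poly_Mapping.keys u \<subseteq> S"
  shows "tensor_eval n s u p = (\<Sum>x\<in>S. pconst (Poly_Mapping.lookup u x) * (fst x * extend_der n s (snd x) p))"
  unfolding tensor_eval_def
  by (rule sum.mono_neutral_left) (use assms in \<open>auto simp: in_keys_iff\<close>)

lemma tensor_eval_add: "tensor_eval n s (u + v) p = tensor_eval n s u p + tensor_eval n s v p"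
proof -
  let ?S = "Poly_Mapping.keys u \<union> Poly_Mapping.keys v"
  have "Poly_Mapping.keys (u + v) \<subseteq> ?S" by (rule Poly_Mapping.keys_add)
  then show ?thesis
    by (simp add: tensor_eval_superset[where S = ?S] lookup_add pconst_simps distrib_right sum.distrib)
qed

lemma tensor_eval_zero [simp]: "tensor_eval n s 0 p = 0"
  by (simp add: tensor_eval_def)

lemma tensor_eval_diff: "tensor_eval n s (u - v) p = tensor_eval n s u p - tensor_eval n s v p"
  using tensor_eval_add[of "u - v" v p] by simp

lemma tensor_eval_sum: "tensor_eval n s (sum f S) p = (\<Sum>x\<in>S. tensor_eval n s (f x) p)"
  by (induction S rule: infinite_finite_induct) (simp_all add: tensor_eval_add)

lemma tensor_eval_scale: "tensor_eval n s (pm_scale c u) p = pconst c * tensor_eval n s u p"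
proof -
  have "Poly_Mapping.keys (pm_scale c u) \<subseteq> Poly_Mapping.keys u" by (auto simp: in_keys_iff)
  then show ?thesis
    by (simp add: tensor_eval_superset[where S = "Poly_Mapping.keys u"] sum_distrib_left pconst_simps mult.assoc)
qed

lemma tensor_eval_single: "tensor_eval n s (Poly_Mapping.single (a, D) c) p = pconst c * (a * extend_der n s D p)"
  by (simp add: tensor_eval_superset[where S = "{(a, D)}"])

lemma tensor_eval_in_I_set:
  fixes u :: "('k::field mpol \<times> 'k vfield) \<Rightarrow>\<^sub>0 'k"
  assumes u: "u \<in> carrier FT"
  shows "tensor_eval n s u \<in> I_set n s"
proof -
  have ps: "polynomial_submodule n (I_set n s :: 'k vfield set)" by (rule polynomial_submodule_I_set[OF s])
  have sub: "lie_subspace (I_set n s :: 'k vfield set) (W n)"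
    using ps by (auto simp: polynomial_submodule_def lie_subspace_def)
  have "(\<lambda>p. pconst (Poly_Mapping.lookup u x) * (fst x * extend_der n s (snd x) p)) \<in> I_set n s"
    if "x \<in> Poly_Mapping.keys u" for x
  proof -
    have "x \<in> P s \<times> derivations V" using u that by auto
    then have x: "fst x \<in> P n" "snd x \<in> derivations V" by (simp_all add: mem_Times_iff P_mono(1))
    have "(\<lambda>p. fst x * extend_der n s (snd x) p) \<in> I_set n s"
      using ps x(1) extend_der_in_I_set[OF x(2)] by (simp add: polynomial_submodule_def)
    then show ?thesis by (rule lie_subspace_DerD(4)[OF sub])
  qed
  then show ?thesis unfolding tensor_eval_def by (rule lie_subspace_Der_sum[OF sub])
qed

text \<open>On generators this is \<open>[a D, b E] = a b [D, E]\<close>, valid since the extended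
  derivations kill the coefficients from \<open>P s\<close>. Both sides are expanded into double
  sums.\<close>

lemma tensor_eval_bracket:
  fixes u v :: "('k::field mpol \<times> 'k vfield) \<Rightarrow>\<^sub>0 'k"
  assumes u: "u \<in> carrier FT" and v: "v \<in> carrier FT" and p: "p \<in> P n"
  shows "tensor_eval n s (lbracket FT u v) p =
    tensor_eval n s u (tensor_eval n s v p) - tensor_eval n s v (tensor_eval n s u p)"
proof -
  let ?c = "\<lambda>u x. pconst (Poly_Mapping.lookup u x)"
  let ?x = "\<lambda>D. extend_der n s (snd D)"
  have eval2: "tensor_eval n s u (tensor_eval n s v p) = (\<Sum>x\<in>Poly_Mapping.keys u. \<Sum>y\<in>Poly_Mapping.keys v.
      ?c u x * ?c v y * (fst x * fst y) * ?x x (?x y p))"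
    if u: "u \<in> carrier FT" and v: "v \<in> carrier FT" for u v :: "('k mpol \<times> 'k vfield) \<Rightarrow>\<^sub>0 'k"
  proof -
    have "?x x (tensor_eval n s v p) = (\<Sum>y\<in>Poly_Mapping.keys v. ?c v y * (fst y * ?x x (?x y p)))"
      if x: "x \<in> Poly_Mapping.keys u" for x
    proof -
      have Dx: "snd x \<in> derivations V" using u x by auto
      have y: "fst y \<in> P s" "?x y p \<in> P n" "fst y * ?x y p \<in> P n" if "y \<in> Poly_Mapping.keys v" for y
      proof -
        have "y \<in> P s \<times> derivations V" using v that by auto
        then show "fst y \<in> P s" "?x y p \<in> P n"
          using derivationsD(2)[OF extend_der_in_derivations[of "snd y"]] by (auto simp: mem_Times_iff)
        then show "fst y * ?x y p \<in> P n" by (rule polys_in_mult[OF P_mono(1)])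
      qed
      have "?x x (sum f T) = (\<Sum>i\<in>T. ?x x (f i))" if "finite T" "\<And>i. i \<in> T \<Longrightarrow> f i \<in> P n"
        for f :: "('k mpol \<times> 'k vfield) \<Rightarrow> 'k mpol" and T
        using that by (induction T rule: finite_induct)
          (auto simp: derivations_zero[OF extend_der_in_derivations[OF Dx]]
            derivationsD(3)[OF extend_der_in_derivations[OF Dx]] polys_in_sum)
      then have "?x x (tensor_eval n s v p) = (\<Sum>y\<in>Poly_Mapping.keys v. ?x x (?c v y * (fst y * ?x y p)))"
        unfolding tensor_eval_def using y by (simp add: polys_in_mult)
      also have "\<dots> = (\<Sum>y\<in>Poly_Mapping.keys v. ?c v y * (fst y * ?x x (?x y p)))"
        by (intro sum.cong refl)
          (simp add: derivationsD(4)[OF extend_der_in_derivations[OF Dx] y(3)] extend_der_mult_P[OF Dx y(1,2)])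
      finally show ?thesis .
    qed
    then show ?thesis
      unfolding tensor_eval_def[of n s u] by (simp add: sum_distrib_left mult_ac)
  qed
  have "tensor_eval n s (lbracket FT u v) p = (\<Sum>x\<in>Poly_Mapping.keys u. \<Sum>y\<in>Poly_Mapping.keys v.
      ?c u x * ?c v y * (fst x * fst y) * (?x x (?x y p) - ?x y (?x x p)))"
  proof -
    have "extend_der n s (lbracket (Der V) (snd x) (snd y)) p = ?x x (?x y p) - ?x y (?x x p)"
      if "x \<in> Poly_Mapping.keys u" "y \<in> Poly_Mapping.keys v" for x y
    proof -
      have "snd x \<in> derivations V" "snd y \<in> derivations V" using u v that by auto
      from extend_der_bracket[OF this] show ?thesis by simp
    qed
    then show ?thesis
      unfolding free_tensor_def
      by (simp add: split_def tensor_eval_sum tensor_eval_single pconst_simps mult.assoc)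
  qed
  also have "\<dots> = tensor_eval n s u (tensor_eval n s v p) - tensor_eval n s v (tensor_eval n s u p)"
    unfolding eval2[OF u v] eval2[OF v u]
    by (subst (2) sum.swap) (simp add: sum_subtractf[symmetric] right_diff_distrib mult_ac)
  finally show ?thesis .
qed

section \<open>Normal forms modulo the tensor relations\<close>

private lemma bracket_algebra_FT: "bracket_algebra (FT :: ('k::field, _) bracket_alg)"
  by (rule bracket_algebra_free_tensor)
    (auto intro: polys_in_add polys_in_mult lie_algebra.axioms(1)[OF lie_algebra_Der])

private lemma ideal_N: "lie_ideal N (FT :: ('k::field, _) bracket_alg)"
  by (rule tensor_relations_ideal)
    (auto intro: polys_in_add polys_in_mult lie_algebra.axioms(1)[OF lie_algebra_Der])

private lemma N_ops:
  "u \<in> N \<Longrightarrow> v \<in> N \<Longrightarrow> u + v \<in> N" "u \<in> N \<Longrightarrow> pm_scale c u \<in> N" "0 \<in> N" "u \<in> N \<Longrightarrow> u \<in> carrier FT"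
  using ideal_N by (auto simp: lie_ideal_def lie_subspace_def)

private lemma N_sum: "(\<And>x. x \<in> S \<Longrightarrow> f x \<in> N) \<Longrightarrow> sum f S \<in> N"
  by (induction S rule: infinite_finite_induct) (auto intro: N_ops)

private lemma N_rel: "tensor_relations (P s) (Der V) \<subseteq> N"
  unfolding lie_span_def by blast

private lemma N_rels:
  "\<lbrakk>a \<in> P s; b \<in> P s; D \<in> derivations V\<rbrakk> \<Longrightarrow> e (a + b) D - e a D - e b D \<in> N"
  "\<lbrakk>a \<in> P s; D \<in> derivations V; E \<in> derivations V\<rbrakk> \<Longrightarrow> e a (\<lambda>p. D p + E p) - e a D - e a E \<in> N"
  "\<lbrakk>a \<in> P s; D \<in> derivations V\<rbrakk> \<Longrightarrow> e (pconst c * a) D - pm_scale c (e a D) \<in> N"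
  "\<lbrakk>a \<in> P s; D \<in> derivations V\<rbrakk> \<Longrightarrow> e a (\<lambda>p. pconst c * D p) - pm_scale c (e a D) \<in> N"
  by (rule subsetD[OF N_rel], unfold tensor_relations_def Let_def, auto; fail)+

private lemma tensor_split_in_carrier:
  fixes g :: "'k::field mpol"
  assumes "g \<in> P n" "j \<in> V"
  shows "tensor_split {1..s} V j g \<in> carrier FT"
  using assms(1)
proof (induction rule: polys_in_add_induct)
  case (single m c)
  have "Poly_Mapping.single (restrict_exponent {1..s} m) (1::'k) \<in> P s"
    "Poly_Mapping.single (restrict_exponent V m) (1::'k) \<in> polys_in V"
    by (intro polys_in_single; simp add: keys_restrict_exponent)+
  then show ?case by (simp add: tensor_split_single pf_in_derivations)
next
  case (add p q)
  then show ?case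
    using Poly_Mapping.keys_add[of "tensor_split {1..s} V j p" "tensor_split {1..s} V j q"]
    by (auto simp: tensor_split_add)
qed

private lemma tensor_eval_split:
  assumes "g \<in> P n" "j \<in> V"
  shows "tensor_eval n s (tensor_split {1..s} V j g) = pf {1..n} g j"
  using assms(1)
proof (induction rule: polys_in_add_induct)
  case (single m c)
  let ?l = "Poly_Mapping.single (restrict_exponent {1..s} m) 1"
  let ?r = "Poly_Mapping.single (restrict_exponent V m) 1"
  have r: "?r \<in> polys_in V" by (intro polys_in_single) (simp add: keys_restrict_exponent)
  have m: "Poly_Mapping.single m c = pconst c * (?l * ?r)"
    using restrict_exponent_decompose[OF UV(1), of m] single UV(2) by (simp add: pconst_def mult_single)
  have mn: "Poly_Mapping.single m c \<in> P n" using single by (rule polys_in_single)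
  show ?case
  proof
    fix p
    have "pconst c * (?l * pf {1..n} ?r j p) = pf {1..n} (Poly_Mapping.single m c) j p"
    proof (cases "p \<in> P n")
      case True
      have "j \<in> {1..n}" using assms(2) UV by blast
      then show ?thesis using True by (simp add: pf_apply m mult.assoc)
    next
      case False
      then show ?thesis by (simp add: pf_def vf_def zero_ext_def)
    qed
    then show "tensor_eval n s (tensor_split {1..s} V j (Poly_Mapping.single m c)) p
      = pf {1..n} (Poly_Mapping.single m c) j p"
      by (simp only: tensor_split_single tensor_eval_single extend_der_pf[OF r assms(2)])
  qed
next
  case (add p q)
  have "(\<lambda>x. pf {1..n} p j x + pf {1..n} q j x) = pf {1..n} (p + q) j"
    by (rule derivations_eqI[of _ "{1..n}"])
      (use add in \<open>auto simp: pf_pvar intro!: derivations_add pf_in_derivations polys_in_add\<close>)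
  then show ?case using add.IH by (simp add: tensor_split_add tensor_eval_add fun_eq_iff)
qed

text \<open>The relations expand both factors into monomials and move the scalars out; on a pair of
  monomials \<open>tensor_split\<close> returns the pure tensor itself.\<close>

private lemma e_pf_split:
  fixes a g :: "'k::field mpol"
  assumes a: "a \<in> P s" and g: "g \<in> polys_in V" and j: "j \<in> V"
  shows "e a (pf V g j) - tensor_split {1..s} V j (a * g) \<in> N"
  using a
proof (induction rule: polys_in_add_induct)
  case (single l c)
  note l = single
  show ?case
    using g
  proof (induction rule: polys_in_add_induct)
    case (single m d)
    let ?l = "Poly_Mapping.single l (1::'k)" and ?m = "Poly_Mapping.single m (1::'k)"
    have lP: "?l \<in> P s" "Poly_Mapping.single l c \<in> P s" and mV: "?m \<in> polys_in V" "Poly_Mapping.single m d \<in> polys_in V"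
      using l single by (auto intro: polys_in_single)
    have md: "pf V (Poly_Mapping.single m d) j = (\<lambda>p. pconst d * pf V ?m j p)"
      by (rule derivations_eqI[of _ V])
        (use mV in \<open>auto simp: pf_pvar pconst_def mult_single pf_in_derivations
          intro!: derivations_scale[unfolded pconst_def]\<close>)
    have lc: "Poly_Mapping.single l c = pconst c * ?l" by (simp add: pconst_def mult_single)
    have T: "tensor_split {1..s} V j (Poly_Mapping.single l c * Poly_Mapping.single m d)
        = pm_scale (c * d) (e ?l (pf V ?m j))"
      using restrict_exponent_add[OF UV(1) l single]
      by (simp add: mult_single tensor_split_single)
    have 1: "e (Poly_Mapping.single l c) (pf V (Poly_Mapping.single m d) j)
        - pm_scale c (e ?l (pf V (Poly_Mapping.single m d) j)) \<in> N"
      unfolding lc by (rule N_rels(3)[OF lP(1) pf_in_derivations[OF mV(2)]])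
    have 2: "e ?l (pf V (Poly_Mapping.single m d) j) - pm_scale d (e ?l (pf V ?m j)) \<in> N"
      unfolding md by (rule N_rels(4)[OF lP(1) pf_in_derivations[OF mV(1)]])
    have "pm_scale c (e ?l (pf V (Poly_Mapping.single m d) j)) - pm_scale (c * d) (e ?l (pf V ?m j)) \<in> N"
    proof -
      have "pm_scale c (e ?l (pf V (Poly_Mapping.single m d) j)) - pm_scale (c * d) (e ?l (pf V ?m j))
        = pm_scale c (e ?l (pf V (Poly_Mapping.single m d) j) - pm_scale d (e ?l (pf V ?m j)))"
        by (rule poly_mapping_eqI) (simp add: lookup_minus lookup_single when_def algebra_simps)
      then show ?thesis using N_ops(2)[OF 2] by simp
    qed
    from N_ops(1)[OF 1 this] show ?case unfolding T by simp
  next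
    case (add p q)
    let ?a = "Poly_Mapping.single l c"
    have aP: "?a \<in> P s" using l by (rule polys_in_single)
    have "pf V (p + q) j = (\<lambda>x. pf V p j x + pf V q j x)"
      by (rule derivations_eqI[of _ V])
        (use add in \<open>auto simp: pf_pvar intro!: derivations_add pf_in_derivations polys_in_add\<close>)
    then have "e ?a (pf V (p + q) j) - e ?a (pf V p j) - e ?a (pf V q j) \<in> N"
      using N_rels(2)[OF aP pf_in_derivations[OF add.hyps(1)] pf_in_derivations[OF add.hyps(2)]] by simp
    from N_ops(1)[OF this N_ops(1)[OF add.IH]] show ?case
      by (simp add: distrib_left tensor_split_add algebra_simps)
  qed
next
  case (add p q)
  have "e (p + q) (pf V g j) - e p (pf V g j) - e q (pf V g j) \<in> N"
    by (rule N_rels(1)[OF add.hyps pf_in_derivations[OF g]])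
  from N_ops(1)[OF this N_ops(1)[OF add.IH]] show ?case
    by (simp add: distrib_right tensor_split_add algebra_simps)
qed

private lemma e_split:
  fixes a :: "'k::field mpol"
  assumes a: "a \<in> P s" and D: "D \<in> derivations V"
  shows "e a D - (\<Sum>j\<in>V. tensor_split {1..s} V j (a * D (pvar j))) \<in> N"
proof -
  have *: "e a (\<lambda>p. \<Sum>j\<in>T. pf V (D (pvar j)) j p) - (\<Sum>j\<in>T. tensor_split {1..s} V j (a * D (pvar j))) \<in> N
    \<and> (\<lambda>p. \<Sum>j\<in>T. pf V (D (pvar j)) j p) \<in> derivations V"
    if "finite T" "T \<subseteq> V" for T
    using that
  proof (induction T rule: finite_induct)
    case empty
    \<comment> \<open>The scalar relation with scalar 0 shows that \<open>a \<otimes> 0\<close>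
      vanishes modulo \<open>N\<close>.\<close>
    have "e a (\<lambda>p. pconst 0 * 0) - pm_scale 0 (e a (\<lambda>p. 0)) \<in> N"
      by (rule N_rels(4)[OF a derivations_null])
    moreover have "pm_scale 0 (e a (\<lambda>p. 0)) = 0" by (rule poly_mapping_eqI) simp
    ultimately show ?case by (simp add: derivations_null)
  next
    case (insert j T)
    let ?S = "\<lambda>p. \<Sum>j\<in>T. pf V (D (pvar j)) j p"
    have S: "?S \<in> derivations V" and IH: "e a ?S - (\<Sum>j\<in>T. tensor_split {1..s} V j (a * D (pvar j))) \<in> N"
      using insert by auto
    have j: "j \<in> V" "D (pvar j) \<in> polys_in V" using insert derivationsD(2)[OF D] by auto
    have pd: "pf V (D (pvar j)) j \<in> derivations V" by (rule pf_in_derivations[OF j(2)])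
    have "e a (\<lambda>p. pf V (D (pvar j)) j p + ?S p) - e a (pf V (D (pvar j)) j) - e a ?S \<in> N"
      by (rule N_rels(2)[OF a pd S])
    from N_ops(1)[OF this N_ops(1)[OF IH e_pf_split[OF a j(2,1)]]]
    have "e a (\<lambda>p. pf V (D (pvar j)) j p + ?S p) -
        (tensor_split {1..s} V j (a * D (pvar j)) + (\<Sum>j\<in>T. tensor_split {1..s} V j (a * D (pvar j)))) \<in> N"
      by (simp add: algebra_simps)
    then show ?case using insert(1,2) derivations_add[OF pd S] by simp
  qed
  have "e a D - (\<Sum>j\<in>V. tensor_split {1..s} V j (a * D (pvar j))) =
    e a (\<lambda>p. \<Sum>j\<in>V. pf V (D (pvar j)) j p) - (\<Sum>j\<in>V. tensor_split {1..s} V j (a * D (pvar j)))"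
    using derivations_eq_sum_pf[OF D] by simp
  then show ?thesis using *[of V] by simp
qed

text \<open>Modulo the relations, an element is recovered from its evaluation. In particular, an
  element evaluating to zero lies in \<open>N\<close>, which gives injectivity.\<close>

private lemma tensor_normal_form:
  fixes u :: "('k::field mpol \<times> 'k vfield) \<Rightarrow>\<^sub>0 'k"
  assumes u: "u \<in> carrier FT"
  shows "u - (\<Sum>j\<in>V. tensor_split {1..s} V j (tensor_eval n s u (pvar j))) \<in> N"
proof -
  let ?T = "tensor_split {1..s} V"
  let ?K = "Poly_Mapping.keys u"
  have 1: "u = (\<Sum>x\<in>?K. pm_scale (Poly_Mapping.lookup u x) (e (fst x) (snd x)))"
    by (simp flip: sum_single_lookup)
  have "(\<Sum>j\<in>V. ?T j (tensor_eval n s u (pvar j))) =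
      (\<Sum>j\<in>V. \<Sum>x\<in>?K. pm_scale (Poly_Mapping.lookup u x) (?T j (fst x * snd x (pvar j))))"
    by (simp add: tensor_eval_def tensor_split_sum tensor_split_scale extend_der_pvar)
  also have "\<dots> = (\<Sum>x\<in>?K. pm_scale (Poly_Mapping.lookup u x) (\<Sum>j\<in>V. ?T j (fst x * snd x (pvar j))))"
    by (subst sum.swap) (simp add: pm_scale_sum)
  finally have "u - (\<Sum>j\<in>V. ?T j (tensor_eval n s u (pvar j))) =
    (\<Sum>x\<in>?K. pm_scale (Poly_Mapping.lookup u x) (e (fst x) (snd x))) -
    (\<Sum>x\<in>?K. pm_scale (Poly_Mapping.lookup u x) (\<Sum>j\<in>V. ?T j (fst x * snd x (pvar j))))"
    using 1 by simp
  also have "\<dots> = (\<Sum>x\<in>?K. pm_scale (Poly_Mapping.lookup u x)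
      (e (fst x) (snd x) - (\<Sum>j\<in>V. ?T j (fst x * snd x (pvar j)))))"
    unfolding sum_subtractf[symmetric]
    by (intro sum.cong refl poly_mapping_eqI) (simp add: lookup_minus lookup_single when_def right_diff_distrib)
  also have "\<dots> \<in> N"
  proof (intro N_sum N_ops(2) e_split)
    fix x assume "x \<in> ?K"
    then show "fst x \<in> P s" "snd x \<in> derivations V" using u by auto
  qed
  finally show ?thesis .
qed

text \<open>The first isomorphism theorem is applied to \<open>tensor_eval\<close>, and the result
  inverted. Splitting gives surjectivity; the kernel is \<open>N\<close>, since relations evaluate
  to zero and \<open>tensor_normal_form\<close> gives the converse.\<close>

lemma I_alg_isomorphic_tensor_alg:
  "(I_alg n s :: ('k::field, 'k vfield) bracket_alg) \<cong>\<^sub>L tensor_alg (P s) (Der V)"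
proof -
  have IW: "lie_subalgebra (I_set n s) (W n :: ('k, 'k vfield) bracket_alg)"
  proof -
    have "I_set n s \<subseteq> (derivations {1..n} :: 'k vfield set)" by (auto simp: I_set_iff s)
    then show ?thesis
      using lie_ideal_I_set[OF s] I_set_subset_m_set[OF s]
      unfolding lie_ideal_def lie_subalgebra_def lie_subspace_def by auto
  qed
  have ba: "bracket_algebra (I_alg n s :: ('k, 'k vfield) bracket_alg)"
    by (rule lie_algebra.axioms(1)[OF lie_algebra_sub_alg[OF lie_algebra_Der IW]])
  have Id: "F p = 0" if "F \<in> I_set n s" "p \<notin> P n" for F :: "'k vfield" and p
    using that s derivationsD(1) by (auto simp: I_set_iff)
  have hom: "tensor_eval n s \<in> lie_hom FT (I_alg n s :: ('k, 'k vfield) bracket_alg)"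
    unfolding lie_hom_def
  proof (intro CollectI conjI ballI allI)
    fix u v :: "('k mpol \<times> 'k vfield) \<Rightarrow>\<^sub>0 'k" assume u: "u \<in> carrier FT" and v: "v \<in> carrier FT"
    have uv: "lbracket FT u v \<in> carrier FT"
      by (rule bracket_algebra.bracket_closed[OF bracket_algebra_FT u v])
    show "tensor_eval n s (lbracket FT u v) = lbracket (I_alg n s) (tensor_eval n s u) (tensor_eval n s v)"
    proof
      fix p
      show "tensor_eval n s (lbracket FT u v) p = lbracket (I_alg n s) (tensor_eval n s u) (tensor_eval n s v) p"
      proof (cases "p \<in> P n")
        case True
        then show ?thesis using tensor_eval_bracket[OF u v] by simp
      next
        case False
        have z: "tensor_eval n s u 0 = 0" "tensor_eval n s v 0 = 0"
          using tensor_eval_in_I_set[OF u] tensor_eval_in_I_set[OF v] derivations_zero s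
          by (auto simp: I_set_iff)
        show ?thesis
          using Id[OF tensor_eval_in_I_set[OF uv] False] Id[OF tensor_eval_in_I_set[OF u] False]
            Id[OF tensor_eval_in_I_set[OF v] False] z by simp
      qed
    qed
  qed (auto simp: tensor_eval_add tensor_eval_scale intro!: tensor_eval_in_I_set)
  have "lie_quot FT N \<cong>\<^sub>L (I_alg n s :: ('k, 'k vfield) bracket_alg)"
  proof (rule lie_quot_isomorphic[OF bracket_algebra_FT ba hom _ ideal_N])
    show "tensor_eval n s ` carrier FT = carrier (I_alg n s :: ('k, 'k vfield) bracket_alg)"
    proof (intro equalityI subsetI)
      fix F :: "'k vfield" assume F: "F \<in> carrier (I_alg n s)"
      then have Fd: "F \<in> derivations {1..n}" "\<forall>i\<in>{1..s}. F (pvar i) = 0" using s by (auto simp: I_set_iff)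
      let ?u = "\<Sum>j\<in>V. tensor_split {1..s} V j (F (pvar j))"
      interpret FT: bracket_algebra "FT :: ('k, _) bracket_alg" by (rule bracket_algebra_FT)
      have sum_closed: "sum f T \<in> carrier FT" if "\<And>x. x \<in> T \<Longrightarrow> f x \<in> carrier FT"
        for f :: "nat \<Rightarrow> ('k mpol \<times> 'k vfield) \<Rightarrow>\<^sub>0 'k" and T
        using that
        by (induction T rule: infinite_finite_induct)
          (use FT.zero_closed FT.add_closed in \<open>simp_all del: free_tensor_simps(1)\<close>)
      have u: "?u \<in> carrier FT"
        by (rule sum_closed[OF tensor_split_in_carrier[OF derivationsD(2)[OF Fd(1)]]])
      have "tensor_eval n s ?u p = F p" for p
      proof -
        have "F p = (\<Sum>i\<in>{1..n}. pf {1..n} (F (pvar i)) i p)"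
          using fun_cong[OF derivations_eq_sum_pf[OF Fd(1)], of p] by simp
        also have "\<dots> = (\<Sum>j\<in>V. pf {1..n} (F (pvar j)) j p)"
          unfolding sum_split_interval[OF s] using Fd(2) by (simp add: pf_def vf_def zero_ext_def)
        also have "\<dots> = tensor_eval n s ?u p"
          by (simp add: tensor_eval_sum tensor_eval_split[OF derivationsD(2)[OF Fd(1)]])
        finally show ?thesis by simp
      qed
      then have "F = tensor_eval n s ?u" by (simp add: fun_eq_iff)
      then show "F \<in> tensor_eval n s ` carrier FT" using u by (rule image_eqI)
    qed (use tensor_eval_in_I_set in auto)
    let ?K = "{u \<in> carrier FT. tensor_eval n s u = (\<lambda>p. 0 :: 'k mpol)}"
    have "N = ?K"
    proof (rule equalityI)
      have "tensor_relations (P s) (Der V) \<subseteq> ?K"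
      proof
        fix r :: "('k mpol \<times> 'k vfield) \<Rightarrow>\<^sub>0 'k" assume r: "r \<in> tensor_relations (P s) (Der V)"
        then have "r \<in> carrier FT" using N_rel N_ops(4) by blast
        moreover have "tensor_eval n s r p = 0" for p
          using r unfolding tensor_relations_def Let_def
          by (auto simp: tensor_eval_diff tensor_eval_scale tensor_eval_single extend_der_add extend_der_scale
              pconst_simps distrib_left distrib_right mult.assoc mult.left_commute)
        ultimately show "r \<in> ?K" by auto
      qed
      moreover have "lie_subspace ?K FT"
        using bracket_algebra.add_closed[OF bracket_algebra_FT] bracket_algebra.scale_closed[OF bracket_algebra_FT]
          bracket_algebra.zero_closed[OF bracket_algebra_FT]
        by (auto simp: lie_subspace_def fun_eq_iff tensor_eval_add tensor_eval_scale
            simp del: free_tensor_simps(1))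
      ultimately show "N \<subseteq> ?K" unfolding lie_span_def by blast
      show "?K \<subseteq> N"
      proof
        fix u assume "u \<in> ?K"
        then show "u \<in> N" using tensor_normal_form[of u] by simp
      qed
    qed
    then show "N = {u \<in> carrier FT. tensor_eval n s u = lzero (I_alg n s :: ('k, 'k vfield) bracket_alg)}"
      by simp
  qed
  from lie_isomorphic_sym[rotated -1, OF this] show ?thesis
    unfolding tensor_alg_def using lie_quot_closed[OF bracket_algebra_FT ideal_N] by blast
qed

end

section \<open>The algebras \<open>m\<^sub>s\<close> are pairwise non-isomorphic\<close>

lemma m_alg_hom_index_le:
  fixes \<phi> :: "'k::field_char_0 vfield \<Rightarrow> 'k vfield"
  assumes s: "1 \<le> s" "s < n" and t: "1 \<le> t" "t < n"
    and \<phi>: "\<phi> \<in> lie_hom (m_alg n s) (m_alg n t)" and surj: "\<phi> ` m_set n s = m_set n t"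
  shows "s \<le> t"
proof -
  have sn: "s \<le> n" and tn: "t \<le> n" using s t by auto
  define \<rho> where "\<rho> D = zero_ext (P t) (\<phi> D)" for D
  have hom: "\<phi> D \<in> m_set n t" "\<phi> (\<lambda>p. D p + E p) = (\<lambda>p. \<phi> D p + \<phi> E p)"
    "\<phi> (\<lambda>p. pconst c * D p) = (\<lambda>p. pconst c * \<phi> D p)"
    "\<phi> (\<lambda>p. D (E p) - E (D p)) = (\<lambda>p. \<phi> D (\<phi> E p) - \<phi> E (\<phi> D p))"
    if "D \<in> m_set n s" "E \<in> m_set n s" for D E c
    using \<phi> that by (auto simp: lie_hom_def)
  have \<rho>_W: "\<rho> D \<in> derivations {1..t}" if "D \<in> m_set n s" for D
    using restrict_in_lie_hom[OF tn] hom(1)[OF that that] by (auto simp: lie_hom_def \<rho>_def)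
  have \<rho>_br: "\<rho> (\<lambda>p. D (E p) - E (D p)) = (\<lambda>p. \<rho> D (\<rho> E p) - \<rho> E (\<rho> D p))"
    if "D \<in> m_set n s" "E \<in> m_set n s" for D E
    using restrict_in_lie_hom[OF tn] hom(1)[OF that(1,1)] hom(1)[OF that(2,2)]
    by (auto simp: lie_hom_def \<rho>_def hom(4)[OF that])
  have null: "(\<lambda>p. 0) \<in> m_set n s" "(\<lambda>p. 0) \<in> I_set n s"
    by (auto simp: m_set_iff I_set_iff sn derivations_null)
  have \<phi>0: "\<phi> (\<lambda>p. 0) = (\<lambda>p. 0)" using hom(3)[OF null(1,1), of 0] by simp
  \<comment> \<open>The kernel of \<open>\<rho>\<close> on \<open>m_set n s\<close>, as
    \<open>I_set n t\<close> is the kernel of restriction to \<open>P t\<close>.\<close>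
  define K where "K = {D \<in> m_set n s. \<phi> D \<in> I_set n t}"
  have It: "lie_ideal (I_set n t) (m_alg n t :: ('k, 'k vfield) bracket_alg)" by (rule lie_ideal_I_set[OF tn])
  have Is: "lie_subalgebra (m_set n s) (W n :: ('k, 'k vfield) bracket_alg)" by (rule lie_subalgebra_m_set[OF sn])
  have K: "lie_ideal K (m_alg n s :: ('k, 'k vfield) bracket_alg)"
    unfolding lie_ideal_def lie_subspace_def
  proof (intro conjI ballI allI)
    fix D E assume "D \<in> carrier (m_alg n s :: ('k, 'k vfield) bracket_alg)" "E \<in> K"
    then have D: "D \<in> m_set n s" and E: "E \<in> m_set n s" "\<phi> E \<in> I_set n t" by (auto simp: K_def)
    show "lbracket (m_alg n s) D E \<in> K" "lbracket (m_alg n s) E D \<in> K"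
      using D E It Is hom(1)[OF D D]
      by (auto simp: K_def lie_ideal_def lie_subalgebra_def hom(4)[OF D E(1)] hom(4)[OF E(1) D])
  next
    fix D E assume "D \<in> K" "E \<in> K"
    then have D: "D \<in> m_set n s" "\<phi> D \<in> I_set n t" and E: "E \<in> m_set n s" "\<phi> E \<in> I_set n t"
      by (auto simp: K_def)
    show "ladd (m_alg n s) D E \<in> K"
      using D E It Is
      by (auto simp: K_def lie_ideal_def lie_subalgebra_def lie_subspace_def hom(2)[OF D(1) E(1)])
  next
    fix c D assume "D \<in> K"
    then have D: "D \<in> m_set n s" "\<phi> D \<in> I_set n t" by (auto simp: K_def)
    show "lscale (m_alg n s) c D \<in> K"
      using D It Is
      by (auto simp: K_def lie_ideal_def lie_subalgebra_def lie_subspace_def hom(3)[OF D(1) D(1)])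
  qed (use null \<phi>0 tn in \<open>auto simp: K_def I_set_iff derivations_null\<close>)
  have K1: "K \<noteq> m_set n s"
  proof
    assume Km: "K = m_set n s"
    \<comment> \<open>If \<open>K\<close> were everything, surjectivity would force
      \<open>\<partial>\<^sub>1\<close> into \<open>I_set n t\<close>.\<close>
    have "pf {1..n} 1 1 \<in> (m_set n t :: 'k vfield set)" "pf {1..n} 1 1 \<notin> (I_set n t :: 'k vfield set)"
      using t by (auto simp: I_set_iff m_set_iff pf_in_derivations pf_pvar)
    moreover have "\<phi> ` m_set n s \<subseteq> I_set n t" using Km unfolding K_def by blast
    ultimately show False using surj by blast
  qed
  let ?e = "\<lambda>i. pf {1..n} 1 i :: 'k vfield" and ?h = "\<lambda>i. pf {1..n} (pvar i) i :: 'k vfield"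
  have m: "?e i \<in> m_set n s" "?h i \<in> m_set n s" if "i \<in> {1..s}" for i
    using that sn by (auto intro!: pf_in_m_set)
  \<comment> \<open>If \<open>\<rho>\<close> killed \<open>\<partial>\<^sub>i\<close>, then
    \<open>K\<close> would be non-zero and proper, hence equal to \<open>I_set n s\<close>, which
    does not contain \<open>\<partial>\<^sub>i\<close> for \<open>i \<le> s\<close>.\<close>
  have e0: "\<rho> (?e i) \<noteq> (\<lambda>p. 0)" if i: "i \<in> {1..s}" for i
  proof
    assume "\<rho> (?e i) = (\<lambda>p. 0)"
    then have "?e i \<in> K"
      using zero_ext_eq_zero_iff[OF tn hom(1)[OF m(1)[OF i] m(1)[OF i]]] m(1)[OF i]
      by (simp add: K_def \<rho>_def)
    moreover have nI: "?e i \<notin> I_set n s" using i sn by (auto simp: I_set_iff pf_pvar)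
    then have "?e i \<noteq> (\<lambda>p. 0)" using null(2) by metis
    ultimately have "nontrivial_ideal K (m_alg n s)" using K K1 by (auto simp: nontrivial_ideal_def)
    then have "K = I_set n s" using nontrivial_ideal_m_alg_iff[OF s] by blast
    then show False using \<open>?e i \<in> K\<close> nI by simp
  qed
  have br: "(\<lambda>p. ?e i (?h j p) - ?h j (?e i p)) = (if i = j then ?e i else (\<lambda>p. 0))"
    "(\<lambda>p. ?h i (?h j p) - ?h j (?h i p)) = (\<lambda>p. 0)" if ij: "i \<in> {1..s}" "j \<in> {1..s}" for i j
  proof -
    have n: "i \<in> {1..n}" "j \<in> {1..n}" using ij sn by auto
    note d = pf_in_derivations[OF one_in_polys_in] pf_in_derivations[of "pvar i :: 'k mpol" "{1..n}"]
      pf_in_derivations[of "pvar j :: 'k mpol" "{1..n}"]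
    show "(\<lambda>p. ?e i (?h j p) - ?h j (?e i p)) = (if i = j then ?e i else (\<lambda>p. 0))"
      by (rule derivations_eqI[OF derivations_commutator])
        (use n d in \<open>auto simp: pf_pvar pf_apply pdiff_pvar derivations_null\<close>)
    show "(\<lambda>p. ?h i (?h j p) - ?h j (?h i p)) = (\<lambda>p. 0)"
      by (rule derivations_eqI[OF derivations_commutator])
        (use n d in \<open>auto simp: pf_pvar pf_apply pdiff_pvar derivations_null\<close>)
  qed
  have "card {1..s} \<le> card {1..t}"
  proof (rule euler_fields_bound[where h = "\<lambda>i. \<rho> (?h i)" and e = "\<lambda>i. \<rho> (?e i)"])
    have \<rho>0: "\<rho> (\<lambda>p. 0) = (\<lambda>p. 0)" by (simp add: \<rho>_def \<phi>0 zero_ext_def fun_eq_iff)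
    fix i j p assume ij: "i \<in> {1..s}" "j \<in> {1..s}"
    have "\<rho> (?h i) (\<rho> (?h j) p) - \<rho> (?h j) (\<rho> (?h i) p) = 0"
      using fun_cong[OF \<rho>_br[OF m(2)[OF ij(1)] m(2)[OF ij(2)]], of p] unfolding br(2)[OF ij] \<rho>0 by simp
    then show "\<rho> (?h i) (\<rho> (?h j) p) = \<rho> (?h j) (\<rho> (?h i) p)" by simp
    show "\<rho> (?e i) (\<rho> (?h j) p) - \<rho> (?h j) (\<rho> (?e i) p) = (if i = j then \<rho> (?e i) p else 0)"
      using fun_cong[OF \<rho>_br[OF m(1)[OF ij(1)] m(2)[OF ij(2)]], of p] unfolding br(1)[OF ij]
      by (cases "i = j") (simp_all add: \<rho>0)
  qed (use m \<rho>_W e0 in auto)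
  then show ?thesis by simp
qed

lemma m_alg_not_isomorphic:
  assumes s: "1 \<le> s" "s < n" and t: "1 \<le> t" "t < n" and "s \<noteq> t"
  shows "\<not> (m_alg n s :: ('k::field_char_0, 'k vfield) bracket_alg) \<cong>\<^sub>L m_alg n t"
proof
  assume iso: "(m_alg n s :: ('k, 'k vfield) bracket_alg) \<cong>\<^sub>L m_alg n t"
  have le: "i \<le> j" if "1 \<le> i" "i < n" "1 \<le> j" "j < n"
    and "(m_alg n i :: ('k, 'k vfield) bracket_alg) \<cong>\<^sub>L m_alg n j" for i j
    using that m_alg_hom_index_le[of i n j] by (auto simp: lie_isomorphic_def bij_betw_def)
  interpret bracket_algebra "m_alg n s :: ('k, 'k vfield) bracket_alg"
    by (rule lie_algebra.axioms(1)[OF lie_algebra_m_alg]) (use s in simp)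
  have "(m_alg n t :: ('k, 'k vfield) bracket_alg) \<cong>\<^sub>L m_alg n s"
    using lie_isomorphic_sym[rotated -1, OF iso] add_closed scale_closed bracket_closed by blast
  then have "s = t" using le[OF s t iso] le[OF t s] by simp
  then show False using assms by simp
qed

theorem theorem1:
  fixes n :: nat
  assumes "n \<ge> 2"
  shows "(\<forall>s\<in>{1..n-1}. maximal_subalgebra (m_set n s)
            (W n :: ('k::{alg_closed_field, field_char_0}, 'k vfield) bracket_alg)) \<and>
    (\<forall>s\<in>{1..n-1}.
       lie_ideal (I_set n s) (m_alg n s :: ('k, 'k vfield) bracket_alg) \<and>
       polynomial_submodule n (I_set n s :: 'k vfield set) \<and>
       (I_alg n s :: ('k, 'k vfield) bracket_alg) \<cong>\<^sub>L tensor_alg (P s) (Der {s+1..n}) \<and>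
       lie_quot (m_alg n s :: ('k, 'k vfield) bracket_alg) (I_set n s) \<cong>\<^sub>L W s) \<and>
    (\<forall>s\<in>{1..n-1}. \<forall>J. nontrivial_ideal J (m_alg n s :: ('k, 'k vfield) bracket_alg) \<longleftrightarrow>
       J = I_set n s) \<and>
    (\<forall>s\<in>{1..n-1}. \<forall>t\<in>{1..n-1}. s \<noteq> t \<longrightarrow>
       \<not> (m_alg n s :: ('k, 'k vfield) bracket_alg) \<cong>\<^sub>L (m_alg n t :: ('k, 'k vfield) bracket_alg))"
proof (intro conjI ballI allI impI)
  fix s t J assume s: "s \<in> {1..n-1}"
  then have sn: "1 \<le> s" "s < n" "s \<le> n" using assms by auto
  show "maximal_subalgebra (m_set n s) (W n :: ('k, 'k vfield) bracket_alg)"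
    by (rule maximal_subalgebra_m_set[OF sn(1,2)])
  show "lie_ideal (I_set n s) (m_alg n s :: ('k, 'k vfield) bracket_alg)"
    by (rule lie_ideal_I_set[OF sn(3)])
  show "polynomial_submodule n (I_set n s :: 'k vfield set)"
    by (rule polynomial_submodule_I_set[OF sn(3)])
  show "(I_alg n s :: ('k, 'k vfield) bracket_alg) \<cong>\<^sub>L tensor_alg (P s) (Der {s+1..n})"
    by (rule I_alg_isomorphic_tensor_alg[OF sn(3)])
  show "lie_quot (m_alg n s :: ('k, 'k vfield) bracket_alg) (I_set n s) \<cong>\<^sub>L W s"
    by (rule m_alg_quotient[OF sn(3)])
  show "nontrivial_ideal J (m_alg n s :: ('k, 'k vfield) bracket_alg) \<longleftrightarrow> J = I_set n s"
    by (rule nontrivial_ideal_m_alg_iff[OF sn(1,2)])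
  assume t: "t \<in> {1..n-1}" and st: "s \<noteq> t"
  then have tn: "1 \<le> t" "t < n" using assms by auto
  show "\<not> (m_alg n s :: ('k, 'k vfield) bracket_alg) \<cong>\<^sub>L (m_alg n t :: ('k, 'k vfield) bracket_alg)"
    by (rule m_alg_not_isomorphic[OF sn(1,2) tn st])
qed

end
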